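(* Let $m\ge1$. All the lattices $\Gamma_J$ ($J\subseteq M_+$) and $\Lambda_I$ ($I\subseteq M_-$) are universally strongly perfect.
   Context: A lattice $L\subset\mathbb R^N$ is universally strongly perfect if for every $a$ with $L_a=\{\ell\in L:(\ell,\ell)=a\}\ne\emptyset$ the set $L_a$ is a spherical 4-design. Setup: $\mathcal V=\mathbb F_{4^m}$ as $\mathbb F_2$-space, $\zeta$ a primitive element, $\sigma$ multiplication by $\zeta$; orthogonal basis $(b_v)_{v\in\mathcal V}$ of $\mathbb R^{4^m}$ with $(b_v,b_v)=2^{-m}$, $\sigma$ acting by $b_v\mapsto b_{\sigma(v)}$. For an $\mathbb F_2$-basis $v_1,\dots,v_{2m}$ of $\mathcal V$ and $\mathcal T_r$ the subspaces spanned by exactly $r$ of the $v_i$, $\mathrm{BW}_{2m}=\langle2^{\lfloor(2m-r+1)/2\rfloor}\sum_{v\in U}b_v:U\in\mathcal T_r,0\le r\le2m\rangle_{\mathbb Z}$, $\mathrm{BW}_{2m}^{\#}$ its dual. $\mathcal G_{2m}=\mathrm{Aut}(\mathrm{BW}_{2m})\ni\sigma$, $\mathcal E_{2m}\cong2^{1+4m}_+$ its largest normal 2-subgroup with centre $Z$, $\eta=\sigma^{(4^m-1)/3}$, $\mathcal U_m$ = normaliser in $\mathcal G_{2m}$ of $\langle\mathcal E_{2m},\eta\rangle$; $\mathcal E_{2m}$ acts trivially on $\mathrm{BW}_{2m}/2\mathrm{BW}_{2m}^{\#}$ and $\mathrm{BW}_{2m}^{\#}/\mathrm{BW}_{2m}$;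 $W=\mathcal E_{2m}/Z$ with $\eta$ acting as a scalar in $\mathbb F_4\setminus\mathbb F_2$ is a $2m$-dim Hermitian $\mathbb F_4$-space with $\mathcal U_m/\mathcal E_{2m}\cong\Gamma\mathrm U(W)\supseteq\mathrm U(W)$. $W_k=\det\otimes\Lambda^k_{\mathbb F_4}W$; for $0\le k<m$, $Y_k$ is the $\mathbb F_2\Gamma\mathrm U(W)$-module of dimension $2\binom{2m}k$ with $(\mathbb F_4\otimes Y_k)|_{\mathrm U(W)}\cong W_k\oplus W_{2m-k}$; $Y_m$ the one of dimension $\binom{2m}m$ with $(\mathbb F_4\otimes Y_m)|_{\mathrm U(W)}\cong W_m$. $M_+=\{0\le k\le m:m-k\text{ even}\}$, $M_-=\{0\le k\le m:m-k\text{ odd}\}$. $\mathcal L_+$: $\sigma$-invariant $\Gamma$ with $2\mathrm{BW}_{2m}^{\#}\subseteq\Gamma\subseteq\mathrm{BW}_{2m}$ on whose quotient by $2\mathrm{BW}^\#_{2m}$ the eigenvalue 1 of $\sigma$ has multiplicity 0 or 2; $\mathcal L_-$: $\sigma$-invariant $\Lambda$ with $\mathrm{BW}_{2m}\subseteq\Lambda\subseteq\mathrm{BW}_{2m}^{\#}$. $\Gamma_J$ is the unique $\mathcal U_m$-invariant lattice in $\mathcal L_+$ with $\Gamma_J/2\mathrm{BW}_{2m}^{\#}\cong\bigoplus_{k\in J}Y_k$, $\Lambda_I$ the unique $\mathcal U_m$-invariant lattice in $\mathcal L_-$ with $\Lambda_I/\mathrm{BW}_{2m}\cong\bigoplus_{k\in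 I}Y_k$ (these are all the $\mathcal U_m$-invariant lattices in $\mathcal L_\pm$). *)

theory Defs
  imports
    "HOL-Analysis.Analysis"
    "HOL-Algebra.Group_Action"
    "HOL-Algebra.Module"
    "HOL-Algebra.Algebraic_Closure_Type"
    "HOL-Library.Z2"
    "HOL-Library.Poly_Mapping"
begin

section \<open>Universally strongly perfect lattices\<close>

definition int_span :: "'e::real_vector set \<Rightarrow> 'e set" where
  "int_span = Modules.module.span (\<lambda>(k::int) x. of_int k *\<^sub>R x)"

definition is_lattice :: "'e::euclidean_space set \<Rightarrow> bool" where
  "is_lattice L \<longleftrightarrow> (\<exists>B. independent B \<and> span B = UNIV \<and> L = int_span B)"

definition dual_lattice :: "'e::euclidean_space set \<Rightarrow> 'e set" where
  "dual_lattice L = {x. \<forall>y\<in>L. inner x y \<in> \<int>}"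

definition poly_fun_degree_le :: "nat \<Rightarrow> ('e::euclidean_space \<Rightarrow> real) \<Rightarrow> bool" where
  "poly_fun_degree_le t f \<longleftrightarrow>
     (\<exists>A c. finite A \<and> (\<forall>\<alpha>\<in>A. (\<Sum>i\<in>Basis. \<alpha> i) \<le> t) \<and>
        f = (\<lambda>x. \<Sum>\<alpha>\<in>A. c \<alpha> * (\<Prod>i\<in>Basis. inner x i ^ \<alpha> i)))"

text \<open>
  The rotation invariant probability measure on the sphere of radius \<open>r\<close> is the image of the
  uniform distribution on the unit ball under radial projection.
\<close>

definition sphere_mean :: "real \<Rightarrow> ('e::euclidean_space \<Rightarrow> real) \<Rightarrow> real" where
  "sphere_mean r f =
     integral\<^sup>L (uniform_measure lborel (cball 0 1)) (\<lambda>x. f ((r / norm x) *\<^sub>R x))"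

definition spherical_design :: "nat \<Rightarrow> 'e::euclidean_space set \<Rightarrow> bool" where
  "spherical_design t C \<longleftrightarrow> finite C \<and> C \<noteq> {} \<and>
     (\<exists>r. C \<subseteq> sphere 0 r \<and>
        (\<forall>f. poly_fun_degree_le t f \<longrightarrow> (\<Sum>x\<in>C. f x) / real (card C) = sphere_mean r f))"

definition layer :: "'e::euclidean_space set \<Rightarrow> real \<Rightarrow> 'e set" where
  "layer L a = {x \<in> L. inner x x = a}"

definition universally_strongly_perfect :: "'e::euclidean_space set \<Rightarrow> bool" where
  "universally_strongly_perfect L \<longleftrightarrow> (\<forall>a. layer L a \<noteq> {} \<longrightarrow> spherical_design 4 (layer L a))"


section \<open>The field with four elements\<close>

text \<open>\<open>GF4 a b\<close> stands for \<open>a + b \<omega>\<close>, where \<open>\<omega>\<^sup>2 = \<omega> + 1\<close>.\<close>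

datatype gf4 = GF4 (coeff_1: bit) (coeff_w: bit)

lemma gf4_cases: "x = GF4 0 0 \<or> x = GF4 1 0 \<or> x = GF4 0 1 \<or> x = GF4 1 1"
proof (cases x)
  case (GF4 a b)
  then show ?thesis by (cases a; cases b) auto
qed

instantiation gf4 :: field
begin

definition "0 = GF4 0 0"
definition "1 = GF4 1 0"
definition "x + y = GF4 (coeff_1 x + coeff_1 y) (coeff_w x + coeff_w y)"
definition "- (x::gf4) = x"
definition "(x::gf4) - y = x + y"
definition "x * y = GF4 (coeff_1 x * coeff_1 y + coeff_w x * coeff_w y)
   (coeff_1 x * coeff_w y + coeff_w x * coeff_1 y + coeff_w x * coeff_w y)"
definition "inverse (x::gf4) = x * x"
definition "(x::gf4) div y = x * inverse y"

instance
proof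
  fix a b c :: gf4
  note defs = plus_gf4_def times_gf4_def zero_gf4_def one_gf4_def uminus_gf4_def minus_gf4_def
    inverse_gf4_def divide_gf4_def
  note ca = gf4_cases[of a] and cb = gf4_cases[of b] and cc = gf4_cases[of c]
  show "a * b * c = a * (b * c)" "a + b + c = a + (b + c)" "(a + b) * c = a * c + b * c"
    using ca cb cc by (elim disjE; simp add: defs)+
  show "a * b = b * a" "a + b = b + a" "a - b = a + - b" "a div b = a * inverse b"
    using ca cb by (elim disjE; simp add: defs)+
  show "0 + a = a" "1 * a = a" "(0::gf4) \<noteq> 1" "- a + a = 0" "inverse (0::gf4) = 0"
    using ca by (elim disjE; simp add: defs)+
  show "a \<noteq> 0 \<Longrightarrow> inverse a * a = 1"
    using ca by (elim disjE; simp add: defs)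
qed

end


section \<open>Modules and group actions on them\<close>

text \<open>
  A module is a record of the algebra library together with an action, which is a function from
  group elements to maps. The ring components \<open>mult\<close> and \<open>one\<close> of the record play no role.
\<close>

definition linear_rep ::
  "'g monoid \<Rightarrow> ('k::field, 'v) module \<Rightarrow> ('g \<Rightarrow> 'v \<Rightarrow> 'v) \<Rightarrow> bool" where
  "linear_rep H M \<rho> \<longleftrightarrow> Module.module ring_of_type_algebra M \<and> group_action H (carrier M) \<rho> \<and>
     (\<forall>g\<in>carrier H. \<rho> g \<in> hom (add_monoid M) (add_monoid M) \<and>
        (\<forall>c. \<forall>x\<in>carrier M. \<rho> g (c \<odot>\<^bsub>M\<^esub> x) = c \<odot>\<^bsub>M\<^esub> \<rho> g x))"

definition rep_iso :: "'g set \<Rightarrow> ('k::field, 'v) module \<Rightarrow> ('g \<Rightarrow> 'v \<Rightarrow> 'v)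
    \<Rightarrow> ('k, 'w) module \<Rightarrow> ('g \<Rightarrow> 'w \<Rightarrow> 'w) \<Rightarrow> bool" where
  "rep_iso S M \<rho> N \<tau> \<longleftrightarrow> (\<exists>f \<in> iso (add_monoid M) (add_monoid N).
     (\<forall>c. \<forall>x\<in>carrier M. f (c \<odot>\<^bsub>M\<^esub> x) = c \<odot>\<^bsub>N\<^esub> f x) \<and>
     (\<forall>g\<in>S. \<forall>x\<in>carrier M. f (\<rho> g x) = \<tau> g (f x)))"

definition direct_sum :: "'i set \<Rightarrow> ('i \<Rightarrow> ('k, 'v) module) \<Rightarrow> ('k, 'i \<Rightarrow> 'v) module" where
  "direct_sum J M = \<lparr>carrier = (\<Pi>\<^sub>E j\<in>J. carrier (M j)), mult = undefined, one = undefined,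
     zero = (\<lambda>j\<in>J. \<zero>\<^bsub>M j\<^esub>), add = (\<lambda>x y. \<lambda>j\<in>J. x j \<oplus>\<^bsub>M j\<^esub> y j),
     smult = (\<lambda>c x. \<lambda>j\<in>J. c \<odot>\<^bsub>M j\<^esub> x j)\<rparr>"

definition direct_sum_act :: "'i set \<Rightarrow> ('i \<Rightarrow> 'g \<Rightarrow> 'v \<Rightarrow> 'v) \<Rightarrow> 'g \<Rightarrow> ('i \<Rightarrow> 'v) \<Rightarrow> ('i \<Rightarrow> 'v)" where
  "direct_sum_act J \<rho> g x = (\<lambda>j\<in>J. \<rho> j g (x j))"

text \<open>
  The quotient \<open>A / B\<close> of additive subgroups of a type, with scalars acting through \<open>sc\<close>;
  maps act on its elements, the cosets, by taking images.
\<close>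

definition coset_module :: "('k \<Rightarrow> 'a::ab_group_add \<Rightarrow> 'a) \<Rightarrow> 'a set \<Rightarrow> 'a set \<Rightarrow> ('k, 'a set) module"
  where
  "coset_module sc A B = \<lparr>carrier = (\<lambda>x. (+) x ` B) ` A, mult = undefined, one = undefined,
     zero = B, add = (\<lambda>C D. {x + y | x y. x \<in> C \<and> y \<in> D}),
     smult = (\<lambda>c C. {sc c x + y | x y. x \<in> C \<and> y \<in> B})\<rparr>"

definition bit_scale :: "bit \<Rightarrow> 'a::ab_group_add \<Rightarrow> 'a" where
  "bit_scale c x = (if c = 0 then 0 else x)"

text \<open>
  \<open>\<F>\<^sub>4 \<otimes> M\<close> for a module \<open>M\<close> over the field with two elements: the pair \<open>(x, y)\<close> stands for
  \<open>1 \<otimes> x + \<omega> \<otimes> y\<close>.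
\<close>

definition extend_scalars :: "(bit, 'v) module \<Rightarrow> (gf4, 'v \<times> 'v) module" where
  "extend_scalars M = \<lparr>carrier = carrier M \<times> carrier M, mult = undefined, one = undefined,
     zero = (\<zero>\<^bsub>M\<^esub>, \<zero>\<^bsub>M\<^esub>),
     add = (\<lambda>(x, y) (x', y'). (x \<oplus>\<^bsub>M\<^esub> x', y \<oplus>\<^bsub>M\<^esub> y')),
     smult = (\<lambda>c (x, y).
       ((coeff_1 c \<odot>\<^bsub>M\<^esub> x) \<oplus>\<^bsub>M\<^esub> (coeff_w c \<odot>\<^bsub>M\<^esub> y),
        (coeff_w c \<odot>\<^bsub>M\<^esub> x) \<oplus>\<^bsub>M\<^esub> ((coeff_1 c + coeff_w c) \<odot>\<^bsub>M\<^esub> y)))\<rparr>"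

definition extend_scalars_act :: "('g \<Rightarrow> 'v \<Rightarrow> 'v) \<Rightarrow> 'g \<Rightarrow> 'v \<times> 'v \<Rightarrow> 'v \<times> 'v" where
  "extend_scalars_act \<rho> g = map_prod (\<rho> g) (\<rho> g)"


subsection \<open>Exterior powers\<close>

text \<open>
  The \<open>k\<close>-th exterior power of \<open>W\<close> is the free module on the \<open>k\<close>-tuples of elements of \<open>W\<close> modulo
  the relations making the tuples multilinear and alternating in their entries.
\<close>

definition pm_scale :: "'k::field \<Rightarrow> ('a \<Rightarrow>\<^sub>0 'k) \<Rightarrow> ('a \<Rightarrow>\<^sub>0 'k)" where
  "pm_scale c p = Poly_Mapping.map (\<lambda>x. c * x) p"

definition tuples :: "('k, 'w) module \<Rightarrow> nat \<Rightarrow> 'w list set" where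
  "tuples W k = {xs. length xs = k \<and> set xs \<subseteq> carrier W}"

definition exterior_relations :: "('k::field, 'w) module \<Rightarrow> nat \<Rightarrow> ('w list \<Rightarrow>\<^sub>0 'k) set" where
  "exterior_relations W k =
     {Poly_Mapping.single (xs[i := x \<oplus>\<^bsub>W\<^esub> y]) 1 - Poly_Mapping.single (xs[i := x]) 1
        - Poly_Mapping.single (xs[i := y]) 1 |
        xs i x y. xs \<in> tuples W k \<and> i < k \<and> x \<in> carrier W \<and> y \<in> carrier W} \<union>
     {Poly_Mapping.single (xs[i := c \<odot>\<^bsub>W\<^esub> x]) 1 - Poly_Mapping.single (xs[i := x]) c |
        xs i c x. xs \<in> tuples W k \<and> i < k \<and> x \<in> carrier W} \<union>
     {Poly_Mapping.single xs 1 | xs i j. xs \<in> tuples W k \<and> i < j \<and> j < k \<and> xs ! i = xs ! j}"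

definition exterior_power ::
  "('k::field, 'w) module \<Rightarrow> nat \<Rightarrow> ('k, ('w list \<Rightarrow>\<^sub>0 'k) set) module" where
  "exterior_power W k = coset_module pm_scale {p. Poly_Mapping.keys p \<subseteq> tuples W k}
     (Modules.module.span pm_scale (exterior_relations W k))"

definition exterior_act ::
  "('w \<Rightarrow> 'w) \<Rightarrow> ('w list \<Rightarrow>\<^sub>0 'k::field) set \<Rightarrow> ('w list \<Rightarrow>\<^sub>0 'k) set" where
  "exterior_act g C =
     (\<lambda>p. \<Sum>xs\<in>Poly_Mapping.keys p.
        Poly_Mapping.single (map g xs) (Poly_Mapping.lookup p xs)) ` C"

text \<open>The determinant of \<open>g\<close> is the scalar by which it acts on the top exterior power.\<close>

definition det_on :: "nat \<Rightarrow> ('k::field, 'w) module \<Rightarrow> ('w \<Rightarrow> 'w) \<Rightarrow> 'k" where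
  "det_on d W g = (THE c. \<forall>C\<in>carrier (exterior_power W d).
     exterior_act g C = c \<odot>\<^bsub>exterior_power W d\<^esub> C)"

text \<open>The action on \<open>det \<otimes> \<Lambda>\<^sup>k W\<close>, realised on the module \<open>\<Lambda>\<^sup>k W\<close>, where \<open>d = dim W\<close>.\<close>

definition det_exterior_act :: "nat \<Rightarrow> ('k::field, 'w) module \<Rightarrow> nat
    \<Rightarrow> ('w \<Rightarrow> 'w) \<Rightarrow> ('w list \<Rightarrow>\<^sub>0 'k) set \<Rightarrow> ('w list \<Rightarrow>\<^sub>0 'k) set" where
  "det_exterior_act d W k g C = det_on d W g \<odot>\<^bsub>exterior_power W k\<^esub> exterior_act g C"


subsection \<open>Unitary and semilinear unitary groups\<close>

definition unitary_set ::
  "(gf4 \<Rightarrow> gf4) \<Rightarrow> (gf4, 'w) module \<Rightarrow> ('w \<Rightarrow> 'w \<Rightarrow> gf4) \<Rightarrow> ('w \<Rightarrow> 'w) set" where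
  "unitary_set \<alpha> W h = {g \<in> Bij (carrier W). g \<in> hom (add_monoid W) (add_monoid W) \<and>
     (\<forall>c. \<forall>x\<in>carrier W. g (c \<odot>\<^bsub>W\<^esub> x) = \<alpha> c \<odot>\<^bsub>W\<^esub> g x) \<and>
     (\<forall>x\<in>carrier W. \<forall>y\<in>carrier W. h (g x) (g y) = \<alpha> (h x y))}"

definition unitary :: "(gf4, 'w) module \<Rightarrow> ('w \<Rightarrow> 'w \<Rightarrow> gf4) \<Rightarrow> ('w \<Rightarrow> 'w) set" where
  "unitary W h = unitary_set (\<lambda>c. c) W h"

definition gamma_unitary :: "(gf4, 'w) module \<Rightarrow> ('w \<Rightarrow> 'w \<Rightarrow> gf4) \<Rightarrow> ('w \<Rightarrow> 'w) monoid" where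
  "gamma_unitary W h =
     BijGroup (carrier W) \<lparr>carrier := unitary_set (\<lambda>c. c) W h \<union> unitary_set (\<lambda>c. c ^ 2) W h\<rparr>"


section \<open>Barnes-Wall lattices\<close>

definition primitive_element :: "'f::field \<Rightarrow> bool" where
  "primitive_element \<zeta> \<longleftrightarrow> range (\<lambda>n::nat. \<zeta> ^ n) = UNIV - {0}"

definition f2_basis :: "nat \<Rightarrow> (nat \<Rightarrow> 'f::field) \<Rightarrow> bool" where
  "f2_basis n v \<longleftrightarrow> inj_on v {1..n} \<and> \<not> Modules.module.dependent bit_scale (v ` {1..n}) \<and>
     Modules.module.span bit_scale (v ` {1..n}) = UNIV"

definition basis_subspaces :: "nat \<Rightarrow> (nat \<Rightarrow> 'f::field) \<Rightarrow> nat \<Rightarrow> 'f set set" where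
  "basis_subspaces n v r =
     {Modules.module.span bit_scale (v ` S) | S. S \<subseteq> {1..n} \<and> card S = r}"

definition barnes_wall :: "nat \<Rightarrow> ('f::field \<Rightarrow> 'e::euclidean_space) \<Rightarrow> (nat \<Rightarrow> 'f) \<Rightarrow> 'e set" where
  "barnes_wall m b v =
     int_span {(2 ^ ((2 * m - r + 1) div 2)) *\<^sub>R (\<Sum>u\<in>U. b u) | U r.
                 r \<le> 2 * m \<and> U \<in> basis_subspaces (2 * m) v r}"

definition Aut_lattice :: "'e::euclidean_space set \<Rightarrow> ('e \<Rightarrow> 'e) monoid" where
  "Aut_lattice L = \<lparr>carrier = {g. orthogonal_transformation g \<and> g ` L = L}, mult = (\<circ>), one = id\<rparr>"

text \<open>The largest (with respect to inclusion) normal 2-subgroup.\<close>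

definition O2 :: "'g monoid \<Rightarrow> 'g set" where
  "O2 G = (GREATEST N. N \<lhd> G \<and> (\<exists>k. card N = 2 ^ k))"

definition center_of :: "'g monoid \<Rightarrow> 'g set \<Rightarrow> 'g set" where
  "center_of G E = {z \<in> E. \<forall>x\<in>E. z \<otimes>\<^bsub>G\<^esub> x = x \<otimes>\<^bsub>G\<^esub> z}"

definition U_group :: "'e::euclidean_space set \<Rightarrow> ('e \<Rightarrow> 'e) \<Rightarrow> ('e \<Rightarrow> 'e) set" where
  "U_group L \<eta> = (let G = Aut_lattice L in normalizer G (generate G (O2 G \<union> {\<eta>})))"

definition conj_coset :: "'g monoid \<Rightarrow> 'g \<Rightarrow> 'g set \<Rightarrow> 'g set" where
  "conj_coset G g C = g <#\<^bsub>G\<^esub> C #>\<^bsub>G\<^esub> inv\<^bsub>G\<^esub> g"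

text \<open>\<open>W = E / Z(E)\<close> written additively, the scalar \<open>\<omega>\<close> acting as conjugation by \<open>\<eta>\<close>.\<close>

definition W_space :: "'e::euclidean_space set \<Rightarrow> ('e \<Rightarrow> 'e) \<Rightarrow> (gf4, ('e \<Rightarrow> 'e) set) module" where
  "W_space L \<eta> = (let G = Aut_lattice L; E = O2 G; Q = G \<lparr>carrier := E\<rparr> Mod center_of G E in
     \<lparr>carrier = carrier Q, mult = undefined, one = undefined, zero = \<one>\<^bsub>Q\<^esub>, add = mult Q,
      smult = (\<lambda>c C. (if coeff_1 c = 0 then \<one>\<^bsub>Q\<^esub> else C) \<otimes>\<^bsub>Q\<^esub>
                      (if coeff_w c = 0 then \<one>\<^bsub>Q\<^esub> else conj_coset G \<eta> C))\<rparr>)"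

text \<open>The commutator of \<open>E\<close> as a symplectic form on \<open>W\<close>, the group \<open>Z(E)\<close> having order 2.\<close>

definition commutator_form :: "('e \<Rightarrow> 'e) set \<Rightarrow> ('e \<Rightarrow> 'e) set \<Rightarrow> bit" where
  "commutator_form C D = (if \<forall>x\<in>C. \<forall>y\<in>D. x \<circ> y = y \<circ> x then 0 else 1)"

text \<open>
  The Hermitian form on \<open>W\<close>, linear in the first argument, whose trace to the field with two
  elements is the commutator form \<open>\<beta>\<close>; explicitly, \<open>h C D = \<beta> (\<omega> C) D + \<omega>\<^sup>2 \<beta> C D\<close>. Its value
  at \<open>(x Z, x Z)\<close> is 0 if \<open>x\<^sup>2 = 1\<close>, and 1 otherwise.
\<close>

definition W_form ::
  "'e::euclidean_space set \<Rightarrow> ('e \<Rightarrow> 'e) \<Rightarrow> ('e \<Rightarrow> 'e) set \<Rightarrow> ('e \<Rightarrow> 'e) set \<Rightarrow> gf4" where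
  "W_form L \<eta> C D = GF4
     (commutator_form (conj_coset (Aut_lattice L) \<eta> C) D + commutator_form C D)
     (commutator_form C D)"

text \<open>The homomorphism from \<open>U_group L \<eta>\<close> to the semilinear unitary group of \<open>W\<close>.\<close>

definition W_act :: "'e::euclidean_space set \<Rightarrow> ('e \<Rightarrow> 'e) \<Rightarrow> ('e \<Rightarrow> 'e)
    \<Rightarrow> ('e \<Rightarrow> 'e) set \<Rightarrow> ('e \<Rightarrow> 'e) set" where
  "W_act L \<eta> g = (\<lambda>C\<in>carrier (W_space L \<eta>). conj_coset (Aut_lattice L) g C)"

text \<open>
  \<open>Y\<close> is (a copy of) the module \<open>Y\<^sub>k\<close>. For \<open>k = m\<close> the direct sum over \<open>{k, 2 m - k}\<close> has the
  single summand \<open>W\<^sub>m\<close>.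
\<close>

definition is_Y :: "nat \<Rightarrow> 'e::euclidean_space set \<Rightarrow> ('e \<Rightarrow> 'e) \<Rightarrow> nat \<Rightarrow> (bit, 'y) module
    \<Rightarrow> ((('e \<Rightarrow> 'e) set \<Rightarrow> ('e \<Rightarrow> 'e) set) \<Rightarrow> 'y \<Rightarrow> 'y) \<Rightarrow> bool" where
  "is_Y m L \<eta> k Y \<rho> \<longleftrightarrow> (let W = W_space L \<eta>; h = W_form L \<eta> in
     linear_rep (gamma_unitary W h) Y \<rho> \<and>
     card (carrier Y) = 2 ^ (if k < m then 2 * (2 * m choose k) else 2 * m choose m) \<and>
     rep_iso (unitary W h) (extend_scalars Y) (extend_scalars_act \<rho>)
       (direct_sum {k, 2 * m - k} (exterior_power W))
       (direct_sum_act {k, 2 * m - k} (det_exterior_act (2 * m) W)))"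

definition M_plus :: "nat \<Rightarrow> nat set" where
  "M_plus m = {k. k \<le> m \<and> even (m - k)}"

definition M_minus :: "nat \<Rightarrow> nat set" where
  "M_minus m = {k. k \<le> m \<and> odd (m - k)}"

definition twice_dual :: "'e::euclidean_space set \<Rightarrow> 'e set" where
  "twice_dual L = (\<lambda>x. 2 *\<^sub>R x) ` dual_lattice L"

abbreviation f2_quotient :: "'e::euclidean_space set \<Rightarrow> 'e set \<Rightarrow> (bit, 'e set) module" where
  "f2_quotient \<equiv> coset_module bit_scale"

text \<open>
  As \<open>\<sigma>\<close> has odd order, the multiplicity of its eigenvalue 1 on a module over the field with two
  elements is the dimension of the space of fixed points.
\<close>

definition L_plus :: "'e::euclidean_space set \<Rightarrow> ('e \<Rightarrow> 'e) \<Rightarrow> 'e set set" where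
  "L_plus L \<sigma> = {\<Gamma>. is_lattice \<Gamma> \<and> \<sigma> ` \<Gamma> = \<Gamma> \<and> twice_dual L \<subseteq> \<Gamma> \<and> \<Gamma> \<subseteq> L \<and>
     card {C \<in> carrier (f2_quotient \<Gamma> (twice_dual L)). \<sigma> ` C = C} \<in> {2 ^ 0, 2 ^ 2}}"

definition L_minus :: "'e::euclidean_space set \<Rightarrow> ('e \<Rightarrow> 'e) \<Rightarrow> 'e set set" where
  "L_minus L \<sigma> = {\<Lambda>. is_lattice \<Lambda> \<and> \<sigma> ` \<Lambda> = \<Lambda> \<and> L \<subseteq> \<Lambda> \<and> \<Lambda> \<subseteq> dual_lattice L}"

text \<open>
  \<open>A / B\<close> is isomorphic, as a module for \<open>U_group L \<eta>\<close>, to the direct sum of the \<open>Y\<^sub>k\<close>, \<open>k \<in> J\<close>,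
  on which the group acts through the semilinear unitary group.
\<close>

definition quotient_iso_Y :: "'e::euclidean_space set \<Rightarrow> ('e \<Rightarrow> 'e) \<Rightarrow> (nat \<Rightarrow> (bit, 'y) module)
    \<Rightarrow> (nat \<Rightarrow> (('e \<Rightarrow> 'e) set \<Rightarrow> ('e \<Rightarrow> 'e) set) \<Rightarrow> 'y \<Rightarrow> 'y) \<Rightarrow> nat set \<Rightarrow> 'e set \<Rightarrow> 'e set \<Rightarrow> bool"
  where
  "quotient_iso_Y L \<eta> Y \<rho> J A B \<longleftrightarrow>
     rep_iso (U_group L \<eta>) (f2_quotient A B) (\<lambda>g C. g ` C)
       (direct_sum J Y) (\<lambda>g. direct_sum_act J \<rho> (W_act L \<eta> g))"

definition is_Gamma :: "'e::euclidean_space set \<Rightarrow> ('e \<Rightarrow> 'e) \<Rightarrow> ('e \<Rightarrow> 'e)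
    \<Rightarrow> (nat \<Rightarrow> (bit, 'y) module) \<Rightarrow> (nat \<Rightarrow> (('e \<Rightarrow> 'e) set \<Rightarrow> ('e \<Rightarrow> 'e) set) \<Rightarrow> 'y \<Rightarrow> 'y)
    \<Rightarrow> nat set \<Rightarrow> 'e set \<Rightarrow> bool" where
  "is_Gamma L \<sigma> \<eta> Y \<rho> J \<Gamma> \<longleftrightarrow> \<Gamma> \<in> L_plus L \<sigma> \<and> (\<forall>g\<in>U_group L \<eta>. g ` \<Gamma> = \<Gamma>) \<and>
     quotient_iso_Y L \<eta> Y \<rho> J \<Gamma> (twice_dual L)"

definition is_Lambda :: "'e::euclidean_space set \<Rightarrow> ('e \<Rightarrow> 'e) \<Rightarrow> ('e \<Rightarrow> 'e)
    \<Rightarrow> (nat \<Rightarrow> (bit, 'y) module) \<Rightarrow> (nat \<Rightarrow> (('e \<Rightarrow> 'e) set \<Rightarrow> ('e \<Rightarrow> 'e) set) \<Rightarrow> 'y \<Rightarrow> 'y)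
    \<Rightarrow> nat set \<Rightarrow> 'e set \<Rightarrow> bool" where
  "is_Lambda L \<sigma> \<eta> Y \<rho> I \<Lambda> \<longleftrightarrow> \<Lambda> \<in> L_minus L \<sigma> \<and> (\<forall>g\<in>U_group L \<eta>. g ` \<Lambda> = \<Lambda>) \<and>
     quotient_iso_Y L \<eta> Y \<rho> I \<Lambda> L"

end

theory Submission
  imports Defs "HOL-Algebra.SndIsomorphismGrp"
begin

text \<open>
  Write the basis of the ambient space as functions on the field \<open>F\<close> with \<open>4\<^sup>m\<close> elements and let
  \<open>chi\<close> be the additive character of \<open>F\<close> of order 2. Translations \<open>shift a\<close> and multiplications
  \<open>modulate c\<close> by characters generate the extraspecial group. As it acts trivially on the two
  quotients of the Barnes-Wall lattice \<open>BW\<close>, it preserves every lattice in \<open>\<L>\<^sub>+\<close> and \<open>\<L>\<^sub>-\<close>; no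
  knowledge of the largest normal 2-subgroup of \<open>Aut BW\<close> is needed for this. The Fourier
  transform \<open>hadamard\<close> inverts \<open>\<eta>\<close> and the multiplications \<open>cubic l\<close> by \<open>chi (l u\<^sup>3)\<close> commute with
  \<open>\<eta>\<close>, so they belong to \<open>\<U>\<^sub>m\<close>.

  An average that is invariant under these maps is determined on polynomials of degree at most 4:
  its quartic moments are Fourier transforms of the averages of \<open>(x, w x)\<^sup>2\<close>, where \<open>w\<close> runs
  through the pairs \<open>(a, c)\<close> describing the extraspecial group modulo its centre. These vanish at
  anisotropic \<open>w\<close> and agree at all nonzero isotropic \<open>w\<close>: \<open>\<sigma>\<close> moves \<open>(a, c)\<close> to \<open>(1, a c)\<close>, the
  map \<open>cubic (\<mu>\<^sup>2)\<close> changes \<open>(1, c)\<close> to \<open>(1, c + \<mu> + \<mu>\<^sup>2)\<close>, and by Hilbert 90 this reaches \<open>(1, 0)\<close>.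
  Since the sum over all \<open>w\<close> is a multiple of \<open>(x, x)\<^sup>2\<close>, their common value is fixed. Both the
  average over a layer and the average over a sphere are of this kind, hence they agree.
\<close>

section \<open>Finite fields of characteristic two\<close>

locale binary_field =
  fixes m :: nat and dummy :: "'f::{field,finite}"
  assumes m_ge_1: "1 \<le> m"
    and card_field: "CARD('f) = 4 ^ m"
begin

text \<open>Translation by 1 permutes the field, so comparing the sum of all elements with its
  translate shows that \<open>4 ^ m\<close>, a power of 2, vanishes in the field.\<close>

lemma char_two: "x + x = (0::'f)"
proof -
  have "(\<Sum>x\<in>UNIV. x + 1) = (\<Sum>x\<in>UNIV. x::'f)"
    by (rule sum.reindex_bij_witness[where i="\<lambda>x. x - 1" and j="\<lambda>x. x + 1"]) auto
  then have "of_nat (4 ^ m) = (0::'f)"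
    by (simp add: sum.distrib flip: card_field)
  then have "(2::'f) ^ (2 * m) = 0" by (simp add: power_mult)
  then have "(2::'f) = 0" by simp
  then show ?thesis by (metis mult_2 mult_zero_left)
qed

lemma two_eq_0 [simp]: "(2::'f) = 0"
  using char_two[of 1] by simp

lemma add_cancel2 [simp]: "x + (x + y) = (y::'f)" "y + x + x = (y::'f)"
  by (metis add.assoc add_0 char_two) (metis add.assoc add_0_right char_two)

lemma add_eq_iff: "x + y = z \<longleftrightarrow> x = z + (y::'f)"
  by (metis add_cancel2(2))

lemma square_add: "(x + y)^2 = x^2 + (y::'f)^2"
  using char_two[of 1] by (simp add: power2_sum)

lemma bij_square: "bij (\<lambda>x::'f. x^2)"
proof -
  have "inj (\<lambda>x::'f. x^2)"
  proof (rule injI)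
    fix x y :: 'f assume "x^2 = y^2"
    then have "(x + y)^2 = 0" by (simp add: square_add char_two)
    then have "x + y = 0" by simp
    then show "x = y" by (simp add: add_eq_iff)
  qed
  then show ?thesis by (simp add: bij_def finite_UNIV_inj_surj)
qed

lemma obtain_sqrt: obtains y :: 'f where "y^2 = x"
  using bij_square by (metis bij_pointE)

section \<open>The Artin-Schreier subgroup and the additive character of order two\<close>

definition artin_schreier :: "'f set" where
  "artin_schreier = range (\<lambda>y. y^2 + y)"

lemma artin_schreier_add: "x \<in> artin_schreier \<Longrightarrow> y \<in> artin_schreier \<Longrightarrow> x + y \<in> artin_schreier"
proof -
  assume "x \<in> artin_schreier" "y \<in> artin_schreier"
  then obtain s t where "x = s^2 + s" "y = t^2 + t" by (auto simp: artin_schreier_def)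
  then have "x + y = (s + t)^2 + (s + t)" by (simp add: square_add algebra_simps)
  then show ?thesis by (auto simp: artin_schreier_def)
qed

text \<open>The map sending \<open>y\<close> to \<open>y^2 + y\<close> is additive with kernel {0,
  1}, so each of its nonempty fibres is a pair \<open>{t, t + 1}\<close>.\<close>

lemma card_artin_schreier: "2 * card artin_schreier = CARD('f)"
proof -
  have fib: "card {y::'f. y^2 + y = t^2 + t} = 2" for t :: 'f
  proof -
    have "{y::'f. y^2 + y = t^2 + t} = {t, t + 1}"
    proof (intro equalityI subsetI)
      fix y assume "y \<in> {y::'f. y^2 + y = t^2 + t}"
      then have "y^2 + y + (t^2 + t) = 0" by (simp add: char_two)
      then have "(y + t)^2 + (y + t) = 0" by (simp add: square_add ac_simps)
      then have "(y + t) * (y + t + 1) = 0" by (simp add: power2_eq_square algebra_simps)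
      then have "y + t = 0 \<or> y + t + 1 = 0" by simp
      then show "y \<in> {t, t + 1}"
        by (auto simp: add_eq_iff add.commute)
    next
      fix y assume "y \<in> {t, t + 1}"
      then show "y \<in> {y. y^2 + y = t^2 + t}"
        by (auto simp: square_add ac_simps char_two)
    qed
    then show ?thesis by simp
  qed
  have "CARD('f) = (\<Sum>x\<in>artin_schreier. card {y::'f. y^2 + y = x})"
    by (subst card_UN_disjoint[symmetric])
      (auto simp: artin_schreier_def intro!: arg_cong[where f=card])
  also have "\<dots> = (\<Sum>x\<in>artin_schreier. 2)"
    by (rule sum.cong) (auto simp: artin_schreier_def fib)
  finally show ?thesis by simp
qed

text \<open>By additive Hilbert 90 the set \<open>artin_schreier\<close> is the kernel of the
  absolute trace, so this is -1 to the power of the trace. Defining it through the image of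
  \<open>y^2 + y\<close> avoids the trace and supplies the preimage \<open>y\<close> at
  once.\<close>

definition chi :: "'f \<Rightarrow> real" where
  "chi x = (if x \<in> artin_schreier then 1 else -1)"

lemma chi_cases: "chi x = 1 \<or> chi x = -1"
  by (simp add: chi_def)

lemma chi_0 [simp]: "chi 0 = 1"
  by (auto simp: chi_def artin_schreier_def image_iff intro!: exI[of _ 0])

lemma chi_Ints [simp]: "chi x \<in> \<int>"
  by (simp add: chi_def)

lemma chi_mult_self [simp]: "chi x * chi x = 1" "chi x * (chi x * y) = y"
  using chi_cases[of x] by auto

text \<open>The Artin-Schreier set is a subgroup of index two: for \<open>x\<close> outside of it,
  the set and its translate by \<open>x\<close> are disjoint halves of the field, so another outside
  element \<open>y\<close> lies in the translate and \<open>x + y\<close> in the subgroup.\<close>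

lemma chi_add: "chi (x + y) = chi x * chi y"
proof -
  have *: "x + y \<in> artin_schreier \<longleftrightarrow> y \<in> artin_schreier" if "x \<in> artin_schreier" for x y
    using artin_schreier_add[of x y] artin_schreier_add[of x "x + y"] that by auto
  have "x + y \<in> artin_schreier" if x: "x \<notin> artin_schreier" and y: "y \<notin> artin_schreier"
  proof -
    have "artin_schreier \<inter> (+) x ` artin_schreier = {}"
      using * x by (auto simp: add.commute)
    then have "card (artin_schreier \<union> (+) x ` artin_schreier) = CARD('f)"
      by (subst card_Un_disjoint) (auto simp: card_image simp flip: card_artin_schreier)
    then have "artin_schreier \<union> (+) x ` artin_schreier = UNIV"
      by (simp add: card_eq_UNIV_imp_eq_UNIV)
    then have "y \<in> (+) x ` artin_schreier" using y by blast
    then show ?thesis by auto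
  qed
  moreover have "x + y \<in> artin_schreier \<longleftrightarrow> x \<in> artin_schreier" if "y \<in> artin_schreier"
    using *[OF that, of x] by (simp add: add.commute)
  ultimately show ?thesis using *[of x y] by (auto simp: chi_def)
qed

lemma chi_square [simp]: "chi (x^2) = chi x"
proof -
  have "chi (x^2 + x) = 1" by (auto simp: chi_def artin_schreier_def)
  then show ?thesis using chi_cases[of x] by (auto simp: chi_add)
qed

lemma chi_eq_1E:
  assumes "chi c = 1" obtains y where "c = y^2 + y"
  using assms by (auto simp: chi_def artin_schreier_def split: if_splits)

lemma chi_nontrivial:
  assumes "c \<noteq> 0" obtains u where "chi (c * u) = -1"
proof -
  have "artin_schreier \<noteq> (UNIV::'f set)"
  proof
    assume "artin_schreier = (UNIV::'f set)"
    then have "2 * CARD('f) = CARD('f)" using card_artin_schreier by simp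
    then show False by simp
  qed
  then obtain x where "x \<notin> artin_schreier" by auto
  then have "chi (c * (x / c)) = -1" using assms by (simp add: chi_def)
  then show thesis using that by blast
qed

section \<open>Additive subgroups, character sums and orthogonal complements\<close>

definition subgp :: "'f set \<Rightarrow> bool" where
  "subgp U \<longleftrightarrow> 0 \<in> U \<and> (\<forall>x\<in>U. \<forall>y\<in>U. x + y \<in> U)"

lemma subgp_0: "subgp U \<Longrightarrow> 0 \<in> U" and subgp_add: "subgp U \<Longrightarrow> x \<in> U \<Longrightarrow> y \<in> U \<Longrightarrow> x + y \<in> U"
  by (auto simp: subgp_def)

lemma subgp_add_iff: "subgp U \<Longrightarrow> x \<in> U \<Longrightarrow> y + x \<in> U \<longleftrightarrow> y \<in> U"
  by (metis add_cancel2(2) subgp_add)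

lemma subgp_UNIV: "subgp UNIV"
  by (simp add: subgp_def)

lemma subgp_Int: "subgp U \<Longrightarrow> subgp V \<Longrightarrow> subgp (U \<inter> V)"
  by (simp add: subgp_def)

text \<open>Since negation is the identity in characteristic two, the condition
  \<open>v + a \<in> U\<close> describes the coset \<open>U + a\<close>; adjoining one new element
  to a subgroup adds just this coset.\<close>

lemma subgp_extend:
  assumes U: "subgp U" and a: "a \<notin> U"
  shows "subgp (U \<union> {v. v + a \<in> U})" "U \<inter> {v. v + a \<in> U} = {}"
    "card (U \<union> {v. v + a \<in> U}) = 2 * card U"
proof -
  show disj: "U \<inter> {v. v + a \<in> U} = {}"
  proof -
    have "v + a \<notin> U" if "v \<in> U" for v
      using subgp_add[OF U that, of "v + a"] a by auto
    then show ?thesis by blast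
  qed
  have "x + y \<in> U \<union> {v. v + a \<in> U}" if xy: "x \<in> U \<union> {v. v + a \<in> U}" "y \<in> U \<union> {v. v + a \<in> U}" for x y
  proof -
    have 1: "x + y + a = (x + a) + y" "x + y + a = x + (y + a)" by (simp_all add: ac_simps)
    have "(x + a) + (y + a) = (x + y) + (a + a)" by (simp only: ac_simps)
    then have sum: "x + y = (x + a) + (y + a)" by (simp add: char_two)
    consider "x \<in> U" "y \<in> U" | "x + a \<in> U" "y \<in> U" | "x \<in> U" "y + a \<in> U" | "x + a \<in> U" "y + a \<in> U"
      using xy by blast
    then show ?thesis
    proof cases
      case 2
      then have "x + y + a \<in> U" by (metis 1(1) subgp_add[OF U])
      then show ?thesis by simp
    next
      case 3
      then have "x + y + a \<in> U" by (metis 1(2) subgp_add[OF U])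
      then show ?thesis by simp
    next
      case 4
      then have "x + y \<in> U" by (metis sum subgp_add[OF U])
      then show ?thesis by simp
    qed (simp add: subgp_add[OF U])
  qed
  then show "subgp (U \<union> {v. v + a \<in> U})"
    unfolding subgp_def using subgp_0[OF U] by blast
  have "{v. v + a \<in> U} = (\<lambda>u. u + a) ` U"
  proof (intro equalityI subsetI)
    fix v assume "v \<in> {v. v + a \<in> U}"
    then show "v \<in> (\<lambda>u. u + a) ` U" by (intro image_eqI[where x="v + a"]) simp_all
  qed fastforce
  then have "card {v. v + a \<in> U} = card U"
    by (simp add: card_image)
  then show "card (U \<union> {v. v + a \<in> U}) = 2 * card U"
    using disj by (simp add: card_Un_disjoint)
qed

text \<open>Adjoining elements of \<open>U\<close> one at a time doubles the order at each stage, so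
  there are subgroups of order \<open>2 ^ k\<close> inside \<open>U\<close> for growing
  \<open>k\<close> until \<open>U\<close> itself is reached.\<close>

lemma card_subgp:
  assumes U: "subgp U" obtains k where "card U = 2 ^ k"
proof -
  have "(\<exists>V\<subseteq>U. subgp V \<and> card V = 2 ^ k) \<or> (\<exists>j. card U = 2 ^ j)" for k
  proof (induction k)
    case 0
    have "{0} \<subseteq> U" "subgp {0}" using U by (auto simp: subgp_def)
    then show ?case by (auto intro!: exI[of _ "{0}"])
  next
    case (Suc k)
    show ?case
    proof (cases "\<exists>j. card U = 2 ^ j")
      case False
      then obtain V where V: "V \<subseteq> U" "subgp V" "card V = 2 ^ k" using Suc by auto
      then obtain a where a: "a \<in> U" "a \<notin> V" using False by (metis equalityI subsetI)
      have "V \<union> {v. v + a \<in> V} \<subseteq> U"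
        using V a U by (auto dest!: subsetD simp: subgp_add_iff)
      then show ?thesis using subgp_extend[OF V(2) a(2)] V(3) by (metis power_Suc)
    qed auto
  qed
  \<comment> \<open>A subset of \<open>U\<close> with \<open>2 ^ card U\<close> elements would be
    larger than \<open>U\<close>, which excludes the first alternative.\<close>
  from this[of "card U"] have "\<exists>j. card U = 2 ^ j"
    by (metis card_mono finite less_exp linorder_not_less)
  then show thesis using that by blast
qed

text \<open>Each fibre of the addition map on \<open>U \<times> V\<close> has at most
  \<open>card (U \<inter> V)\<close> elements. In dimensions this is the inequality dim U + dim V
  \<le> dim (U \<inter> V) + 2m.\<close>

lemma card_subgp_Int:
  assumes "subgp U" "subgp V"
  shows "card U * card V \<le> card (U \<inter> V) * CARD('f)"
proof -
  have fib: "card {p \<in> U \<times> V. fst p + snd p = z} \<le> card (U \<inter> V)" for z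
  proof (cases "{p \<in> U \<times> V. fst p + snd p = z} = {}")
    case False
    then obtain x0 y0 where 0: "x0 \<in> U" "y0 \<in> V" "x0 + y0 = z" by auto
    show ?thesis
    proof (rule card_inj_on_le[where f="\<lambda>p. fst p + x0"])
      show "inj_on (\<lambda>p. fst p + x0) {p \<in> U \<times> V. fst p + snd p = z}"
        by (auto simp: inj_on_def)
      have "x + x0 \<in> U \<inter> V" if "x \<in> U" "y \<in> V" "x + y = z" for x y
      proof -
        have "x + x0 = y + y0" using that 0 by (metis add.commute add.left_commute add_cancel2(1))
        then show ?thesis using that 0 assms by (metis IntI subgp_add)
      qed
      then show "(\<lambda>p. fst p + x0) ` {p \<in> U \<times> V. fst p + snd p = z} \<subseteq> U \<inter> V" by auto
    qed simp
  next
    case True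
    then show ?thesis by (metis card.empty le0)
  qed
  have "card U * card V = card (U \<times> V)" by (simp add: card_cartesian_product)
  also have "\<dots> = card (\<Union>z\<in>UNIV. {p \<in> U \<times> V. fst p + snd p = z})"
    by (intro arg_cong[where f=card]) auto
  also have "\<dots> \<le> (\<Sum>z\<in>UNIV. card {p \<in> U \<times> V. fst p + snd p = z})"
    by (rule card_UN_le) simp
  also have "\<dots> \<le> (\<Sum>z\<in>(UNIV::'f set). card (U \<inter> V))"
    by (rule sum_mono) (rule fib)
  finally show ?thesis by (simp add: mult.commute)
qed

text \<open>Orthogonality of characters: a translation by an element with character value -1
  permutes \<open>U\<close> and negates the sum.\<close>

lemma sum_chi_subgp:
  assumes U: "subgp U"
  shows "(\<Sum>u\<in>U. chi (c * u)) = (if \<forall>u\<in>U. chi (c * u) = 1 then card U else 0)"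
proof (cases "\<forall>u\<in>U. chi (c * u) = 1")
  case False
  then obtain w where w: "w \<in> U" "chi (c * w) = -1" using chi_cases by blast
  have "(\<Sum>u\<in>U. chi (c * u)) = (\<Sum>u\<in>U. chi (c * (u + w)))"
    by (rule sum.reindex_bij_witness[where i="\<lambda>x. x + w" and j="\<lambda>x. x + w"])
      (use U w in \<open>auto simp: subgp_add\<close>)
  also have "\<dots> = - (\<Sum>u\<in>U. chi (c * u))"
    by (simp add: distrib_left chi_add w sum_negf)
  finally have "(\<Sum>u\<in>U. chi (c * u)) = 0" by simp
  then show ?thesis by (simp only: False if_False of_nat_0)
qed simp

lemma sum_chi_UNIV: "(\<Sum>u\<in>UNIV. chi (c * u)) = (if c = 0 then 4 ^ m else 0)"
proof (cases "c = 0")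
  case True
  then show ?thesis by (simp add: card_field)
next
  case False
  then obtain u where "chi (c * u) = -1" by (rule chi_nontrivial)
  then have no: "\<not> (\<forall>u\<in>UNIV. chi (c * u) = 1)" by (metis UNIV_I one_neq_neg_one)
  show ?thesis using sum_chi_subgp[OF subgp_UNIV, of c] by (simp only: no False if_False of_nat_0)
qed

text \<open>For a subgroup this is the orthogonal complement with respect to the trace form of the
  field over its prime field.\<close>

definition perp :: "'f set \<Rightarrow> 'f set" where
  "perp U = {w. \<forall>u\<in>U. chi (w * u) = 1}"

lemma subgp_perp: "subgp (perp U)"
  by (auto simp: subgp_def perp_def distrib_right chi_add)

text \<open>The double sum of \<open>chi (w * u)\<close> over all \<open>w\<close> and over
  \<open>u\<close> in \<open>U\<close> is evaluated in both orders.\<close>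

lemma card_perp:
  assumes U: "subgp U" shows "card (perp U) * card U = 4 ^ m"
proof -
  have "real (card (perp U) * card U) = (\<Sum>w\<in>UNIV. if w \<in> perp U then card U else 0)"
    by (simp add: sum.If_cases)
  also have "\<dots> = (\<Sum>w\<in>UNIV. \<Sum>u\<in>U. chi (w * u))"
    unfolding of_nat_sum by (rule sum.cong) (auto simp: sum_chi_subgp[OF U] perp_def)
  also have "\<dots> = (\<Sum>u\<in>U. \<Sum>w\<in>UNIV. chi (u * w))"
    by (subst sum.swap) (simp add: mult.commute)
  also have "\<dots> = 4 ^ m"
    using subgp_0[OF U] by (simp add: sum_chi_UNIV)
  finally show ?thesis by (metis of_nat_eq_iff of_nat_numeral of_nat_power)
qed

end

section \<open>Invariant means on spheres\<close>

lemma nn_integral_lborel_translate: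
  fixes f :: "'e::euclidean_space \<Rightarrow> ennreal"
  assumes [measurable]: "f \<in> borel_measurable borel"
  shows "(\<integral>\<^sup>+x. f (c + x) \<partial>lborel) = (\<integral>\<^sup>+x. f x \<partial>lborel)"
proof -
  have "(\<integral>\<^sup>+x. f x \<partial>lborel) = (\<integral>\<^sup>+x. f x \<partial>distr lborel borel ((+) c))"
    by (simp add: lborel_distr_plus)
  also have "\<dots> = (\<integral>\<^sup>+x. f (c + x) \<partial>lborel)"
    by (subst nn_integral_distr) auto
  finally show ?thesis ..
qed

lemma orthogonal_transformation_measurable:
  fixes g :: "'e::euclidean_space \<Rightarrow> 'e"
  shows "orthogonal_transformation g \<Longrightarrow> g \<in> borel_measurable borel"
  by (intro borel_measurable_continuous_onI linear_continuous_on linear_conv_bounded_linear[THEN iffD1])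
    (simp add: orthogonal_transformation_linear)

lemma emeasure_cball_1:
  "emeasure lborel (cball (0::'e::euclidean_space) 1) \<noteq> 0"
  "emeasure lborel (cball (0::'e::euclidean_space) 1) \<noteq> \<infinity>"
proof -
  show "emeasure lborel (cball (0::'e) 1) \<noteq> \<infinity>"
    using emeasure_lborel_cball_finite[of "0::'e" 1] by auto
  show "emeasure lborel (cball (0::'e) 1) \<noteq> 0"
    using content_cball_pos[of 1 "0::'e"] by (auto simp: measure_def)
qed

text \<open>
  Both \<open>lborel\<close> and its image under \<open>g\<close> are translation invariant. Computing
  \<open>\<integral>\<integral> 1\<^sub>A (g x) 1\<^sub>B (y - g x) dy dx\<close> in two ways, with \<open>B\<close> the unit ball, shows
  that they agree.
\<close>

lemma lborel_distr_orthogonal: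
  fixes g :: "'e::euclidean_space \<Rightarrow> 'e"
  assumes g: "orthogonal_transformation g"
  shows "distr lborel borel g = lborel"
proof (rule measure_eqI)
  fix A :: "'e set" assume "A \<in> sets (distr lborel borel g)"
  then have A [measurable]: "A \<in> sets borel" by simp
  note gm [measurable] = orthogonal_transformation_measurable[OF g]
  have lin: "linear g" using g by (rule orthogonal_transformation_linear)
  define B where "B = cball (0::'e) 1"
  have B [measurable]: "B \<in> sets borel" by (simp add: B_def)
  have ind: "indicator B (- g x) = (indicator B x :: ennreal)" for x
    using orthogonal_transformation_norm[OF g, of x] by (simp add: B_def indicator_def)
  have "(\<integral>\<^sup>+x. indicator A (g x) \<partial>lborel) * emeasure lborel B
      = (\<integral>\<^sup>+x. \<integral>\<^sup>+y. indicator A (g x) * indicator B y \<partial>lborel \<partial>lborel)"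
    by (simp add: nn_integral_cmult nn_integral_multc)
  also have "\<dots> = (\<integral>\<^sup>+x. \<integral>\<^sup>+y. indicator A (g x) * indicator B (- g x + y) \<partial>lborel \<partial>lborel)"
    by (subst nn_integral_lborel_translate) auto
  also have "\<dots> = (\<integral>\<^sup>+y. \<integral>\<^sup>+x. indicator A (g x) * indicator B (- g x + y) \<partial>lborel \<partial>lborel)"
    by (rule lborel_pair.Fubini') measurable
  also have "\<dots> = (\<integral>\<^sup>+y. \<integral>\<^sup>+x. indicator A (g x + y) * indicator B (- g x) \<partial>lborel \<partial>lborel)"
  proof (rule nn_integral_cong)
    fix y :: 'e
    obtain z where z: "g z = y"
      using orthogonal_transformation_surj[OF g] by (metis surjD)
    have "(\<integral>\<^sup>+x. indicator A (g x) * indicator B (- g x + y) \<partial>lborel)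
        = (\<integral>\<^sup>+x. indicator A (g (z + x)) * indicator B (- g (z + x) + y) \<partial>lborel)"
      by (rule nn_integral_lborel_translate[symmetric]) measurable
    also have "\<dots> = (\<integral>\<^sup>+x. indicator A (g x + y) * indicator B (- g x) \<partial>lborel)"
      by (simp add: linear_add[OF lin] z add.commute)
    finally show "(\<integral>\<^sup>+x. indicator A (g x) * indicator B (- g x + y) \<partial>lborel)
      = (\<integral>\<^sup>+x. indicator A (g x + y) * indicator B (- g x) \<partial>lborel)" .
  qed
  also have "\<dots> = (\<integral>\<^sup>+x. \<integral>\<^sup>+y. indicator A (g x + y) * indicator B (- g x) \<partial>lborel \<partial>lborel)"
    by (rule lborel_pair.Fubini') measurable
  also have "\<dots> = (\<integral>\<^sup>+x. \<integral>\<^sup>+y. indicator A y * indicator B x \<partial>lborel \<partial>lborel)"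
    by (subst nn_integral_lborel_translate[of "\<lambda>y. indicator A y * indicator B (- g x)" for x])
      (simp_all add: ind)
  also have "\<dots> = emeasure lborel A * emeasure lborel B"
    by (simp add: nn_integral_cmult nn_integral_multc)
  finally have *: "(\<integral>\<^sup>+x. indicator A (g x) \<partial>lborel) * emeasure lborel B
    = emeasure lborel A * emeasure lborel B" .
  have "emeasure lborel B \<noteq> 0" "emeasure lborel B \<noteq> \<infinity>"
    unfolding B_def by (rule emeasure_cball_1)+
  then have "(\<integral>\<^sup>+x. indicator A (g x) \<partial>lborel) = emeasure lborel A"
    using * by (metis mult_divide_eq_ennreal infinity_ennreal_def)
  moreover have "emeasure (distr lborel borel g) A = (\<integral>\<^sup>+x. indicator A x \<partial>distr lborel borel g)"
    by simp
  then have "emeasure (distr lborel borel g) A = (\<integral>\<^sup>+x. indicator A (g x) \<partial>lborel)"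
    by (simp only:) (subst nn_integral_distr, auto)
  ultimately show "emeasure (distr lborel borel g) A = emeasure lborel A" by simp
qed simp

section \<open>The uniform probability measure on the unit ball\<close>

abbreviation ball_measure :: "'e::euclidean_space measure" where
  "ball_measure \<equiv> uniform_measure lborel (cball 0 1)"

lemma finite_measure_ball: "finite_measure (ball_measure :: 'e::euclidean_space measure)"
  using emeasure_cball_1[where 'e='e]
  by (intro finite_measureI) (simp add: ennreal_divide_self less_top)

lemma measure_ball_space: "measure (ball_measure :: 'e::euclidean_space measure) (space ball_measure) = 1"
  using emeasure_cball_1[where 'e='e] by (simp add: measure_def ennreal_divide_self less_top)

lemma ball_measure_distr_orthogonal:
  fixes g :: "'e::euclidean_space \<Rightarrow> 'e"
  assumes g: "orthogonal_transformation g"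
  shows "distr ball_measure borel g = ball_measure"
proof (rule measure_eqI)
  note gm [measurable] = orthogonal_transformation_measurable[OF g]
  fix A :: "'e set" assume "A \<in> sets (distr ball_measure borel g)"
  then have A [measurable]: "A \<in> sets borel" by simp
  have "g -` (cball 0 1 \<inter> A) = cball 0 1 \<inter> g -` A"
    using orthogonal_transformation_norm[OF g] by auto
  moreover have "emeasure lborel (g -` (cball 0 1 \<inter> A)) = emeasure lborel (cball 0 1 \<inter> A)"
    by (subst (2) lborel_distr_orthogonal[OF g, symmetric]) (simp add: emeasure_distr)
  moreover have "g -` A \<in> sets borel"
    using measurable_sets[OF gm A] by simp
  ultimately show "emeasure (distr ball_measure borel g) A = emeasure ball_measure A"
    by (simp add: emeasure_distr)
qed simp

text \<open>Common abstraction of the average over a layer and the average over a sphere. Working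
  with continuous functions guarantees integrability. Together with linearity,
  \<open>mean_const\<close> normalises \<open>I\<close> and makes it depend only on the values on
  the sphere of radius \<open>r\<close>.\<close>

locale invariant_mean =
  fixes r :: real and G :: "('e::euclidean_space \<Rightarrow> 'e) set" and I :: "('e \<Rightarrow> real) \<Rightarrow> real"
  assumes mean_add: "continuous_on UNIV f \<Longrightarrow> continuous_on UNIV h \<Longrightarrow> I (\<lambda>x. f x + h x) = I f + I h"
    and mean_scale: "continuous_on UNIV f \<Longrightarrow> I (\<lambda>x. c * f x) = c * I f"
    and mean_inv: "continuous_on UNIV f \<Longrightarrow> g \<in> G \<Longrightarrow> I (\<lambda>x. f (g x)) = I f"
    and mean_const: "continuous_on UNIV f \<Longrightarrow> (\<And>x. norm x = r \<Longrightarrow> f x = c) \<Longrightarrow> I f = c"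
begin

lemma mean_sum:
  assumes "finite A" "\<And>i. i \<in> A \<Longrightarrow> continuous_on UNIV (f i)"
  shows "I (\<lambda>x. \<Sum>i\<in>A. f i x) = (\<Sum>i\<in>A. I (f i))"
  using assms
proof (induction A rule: finite_induct)
  case empty
  then show ?case by (simp add: mean_const)
next
  case (insert a A)
  then have "continuous_on UNIV (\<lambda>x. \<Sum>i\<in>A. f i x)" by (intro continuous_on_sum) auto
  then show ?case using insert by (simp add: mean_add)
qed

end

text \<open>Radial projection lands in the compact ball of radius \<open>\<bar>r\<bar>\<close>,
  where \<open>f\<close> is bounded, and the measure is finite.\<close>

lemma radial_integrable:
  fixes f :: "'e::euclidean_space \<Rightarrow> real"
  assumes f: "continuous_on UNIV f"
  shows "integrable ball_measure (\<lambda>x. f ((r / norm x) *\<^sub>R x))"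
proof -
  interpret finite_measure "ball_measure :: 'e measure" by (rule finite_measure_ball)
  have "compact (f ` cball 0 \<bar>r\<bar>)"
    by (intro compact_continuous_image continuous_on_subset[OF f]) auto
  then obtain B where B: "\<And>x. norm x \<le> \<bar>r\<bar> \<Longrightarrow> norm (f x) \<le> B"
    by (meson bounded_iff compact_imp_bounded imageI mem_cball_0)
  have "norm ((r / norm x) *\<^sub>R x) \<le> \<bar>r\<bar>" for x :: 'e
    by (cases "x = 0") auto
  moreover have "(\<lambda>x. f ((r / norm x) *\<^sub>R x)) \<in> borel_measurable borel"
    using borel_measurable_continuous_onI[OF f] by measurable
  ultimately show ?thesis
    by (intro integrable_const_bound[where B=B] AE_I2 B) auto
qed

lemma invariant_mean_sphere:
  fixes G :: "('e::euclidean_space \<Rightarrow> 'e) set"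
  assumes G: "\<And>g. g \<in> G \<Longrightarrow> orthogonal_transformation g" and r: "0 \<le> r"
  shows "invariant_mean r G (sphere_mean r)"
proof
  fix f :: "'e \<Rightarrow> real" assume f: "continuous_on UNIV f"
  note fm [measurable] = borel_measurable_continuous_onI[OF f]
  {
    fix h :: "'e \<Rightarrow> real" assume h: "continuous_on UNIV h"
    show "sphere_mean r (\<lambda>x. f x + h x) = sphere_mean r f + sphere_mean r h"
      unfolding sphere_mean_def by (rule Bochner_Integration.integral_add) (intro radial_integrable f h)+
  next
    fix c
    show "sphere_mean r (\<lambda>x. c * f x) = c * sphere_mean r f"
      unfolding sphere_mean_def by simp
  next
    fix g assume "g \<in> G"
    then have g: "orthogonal_transformation g" by (rule G)
    note gm [measurable] = orthogonal_transformation_measurable[OF g]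
    have "sphere_mean r f = (\<integral>x. f ((r / norm x) *\<^sub>R x) \<partial>distr ball_measure borel g)"
      by (simp add: sphere_mean_def ball_measure_distr_orthogonal[OF g])
    also have "\<dots> = (\<integral>x. f ((r / norm (g x)) *\<^sub>R g x) \<partial>ball_measure)"
      by (subst integral_distr) auto
    also have "\<dots> = sphere_mean r (\<lambda>x. f (g x))"
      unfolding sphere_mean_def
      by (simp add: orthogonal_transformation_norm[OF g] orthogonal_transformation_scaleR[OF g])
    finally show "sphere_mean r (\<lambda>x. f (g x)) = sphere_mean r f" ..
  next
    fix c assume c: "\<And>x. norm x = r \<Longrightarrow> f x = c"
    \<comment> \<open>At the origin the formula for the radial projection gives 0 and not a point of
      norm \<open>r\<close>; this null set is discarded.\<close>
    have "AE x in lborel. x \<noteq> (0::'e)" by (rule AE_lborel_singleton)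
    then have "AE x in lborel. x \<in> cball 0 1 \<longrightarrow> f ((r / norm x) *\<^sub>R x) = c"
      by eventually_elim (simp add: c r)
    then have "AE x in ball_measure. f ((r / norm x) *\<^sub>R x) = c"
      by (intro AE_uniform_measureI) auto
    then have "sphere_mean r f = (\<integral>x. c \<partial>(ball_measure :: 'e measure))"
      unfolding sphere_mean_def by (intro integral_cong_AE) auto
    also have "\<dots> = c" using measure_ball_space[where 'e='e] by simp
    finally show "sphere_mean r f = c" .
  }
qed

lemma invariant_mean_finite:
  fixes C :: "'e::euclidean_space set"
  assumes C: "finite C" "C \<noteq> {}" and r: "\<And>x. x \<in> C \<Longrightarrow> norm x = r"
    and G: "\<And>g. g \<in> G \<Longrightarrow> inj g \<and> g ` C \<subseteq> C"
  shows "invariant_mean r G (\<lambda>f. (\<Sum>x\<in>C. f x) / real (card C))"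
proof
  fix f :: "'e \<Rightarrow> real" and g assume "g \<in> G"
  then have g: "inj_on g C" "g ` C = C"
    using G C endo_inj_surj by (metis inj_on_subset subset_UNIV)+
  have "(\<Sum>x\<in>C. f (g x)) = (\<Sum>x\<in>C. f x)"
    using sum.reindex[OF g(1), of f] g(2) by simp
  then show "(\<Sum>x\<in>C. f (g x)) / real (card C) = (\<Sum>x\<in>C. f x) / real (card C)" by simp
qed (use C r in \<open>simp_all add: sum.distrib add_divide_distrib flip: sum_distrib_left\<close>)

section \<open>Polynomials as combinations of products of linear forms\<close>

lemma monomial_as_list_product:
  fixes \<alpha> :: "'e::euclidean_space \<Rightarrow> nat"
  assumes "finite B"
  shows "\<exists>ys. length ys = (\<Sum>i\<in>B. \<alpha> i) \<and> (\<forall>x. (\<Prod>i\<in>B. inner x i ^ \<alpha> i) = prod_list (map (inner x) ys))"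
  using assms
proof (induction B rule: finite_induct)
  case (insert a B)
  then obtain ys where "length ys = (\<Sum>i\<in>B. \<alpha> i)"
    "\<And>x. (\<Prod>i\<in>B. inner x i ^ \<alpha> i) = prod_list (map (inner x) ys)" by auto
  then show ?case using insert by (intro exI[of _ "replicate (\<alpha> a) a @ ys"]) auto
qed simp

lemma continuous_list_product:
  "continuous_on UNIV (\<lambda>x::'e::euclidean_space. prod_list (map (inner x) ys))"
  by (induction ys) (auto intro!: continuous_intros)

text \<open>By multilinearity, polynomials of degree at most \<open>d\<close> are combinations of
  products of at most \<open>d\<close> linear forms taken from any spanning family, so it suffices
  to compare the means on such products.\<close>

lemma invariant_means_agree:
  fixes b :: "'f::finite \<Rightarrow> 'e::euclidean_space"
  assumes I: "invariant_mean r G I" and J: "invariant_mean r G J" and span: "span (range b) = UNIV"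
    and eq: "\<And>us. length us \<le> d \<Longrightarrow> I (\<lambda>x. prod_list (map (inner x) (map b us))) = J (\<lambda>x. prod_list (map (inner x) (map b us)))"
    and f: "poly_fun_degree_le d f"
  shows "I f = J f"
proof -
  interpret I: invariant_mean r G I by (rule I)
  interpret J: invariant_mean r G J by (rule J)
  \<comment> \<open>The list \<open>ys\<close> holds the arbitrary vectors still to be expanded,
    \<open>us\<close> the indices of family members already reached; the induction moves one vector
    at a time from the first to the second.\<close>
  have mono: "I (\<lambda>x. prod_list (map (inner x) (ys @ map b us))) = J (\<lambda>x. prod_list (map (inner x) (ys @ map b us)))"
    if "length ys + length us \<le> d" for ys us
    using that
  proof (induction ys arbitrary: us)
    case Nil
    then show ?case using eq by simp
  next
    case (Cons y ys)
    have "y \<in> span (range b)" using span by simp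
    then obtain c where c: "y = (\<Sum>u\<in>range b. c u *\<^sub>R u)"
      by (auto simp: span_finite)
    define P where "P u x = prod_list (map (inner x) (ys @ u # map b us))" for u x
    have P: "continuous_on UNIV (P u)" "continuous_on UNIV (\<lambda>x. c u * P u x)" for u
      unfolding P_def by (intro continuous_intros continuous_list_product)+
    have IJ: "I (P u) = J (P u)" if "u \<in> range b" for u
    proof -
      obtain t where "u = b t" using \<open>u \<in> range b\<close> by auto
      then show ?thesis using Cons.IH[of "t # us"] Cons.prems by (simp add: P_def[abs_def])
    qed
    have "prod_list (map (inner x) ((y # ys) @ map b us)) = (\<Sum>u\<in>range b. c u * P u x)" for x
      by (simp add: P_def c inner_sum_right sum_distrib_right sum_distrib_left mult_ac)
    then show ?case
      by (simp only: I.mean_sum J.mean_sum I.mean_scale J.mean_scale P finite_imageI finite IJ cong: sum.cong)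
  qed
  obtain A c where A: "finite A" "\<forall>\<alpha>\<in>A. (\<Sum>i\<in>Basis. \<alpha> i) \<le> d"
    and feq: "f = (\<lambda>x. \<Sum>\<alpha>\<in>A. c \<alpha> * (\<Prod>i\<in>Basis. inner x i ^ \<alpha> i))"
    using f by (auto simp: poly_fun_degree_le_def)
  have cont: "continuous_on UNIV (\<lambda>x::'e. \<Prod>i\<in>Basis. inner x i ^ \<alpha> i)" for \<alpha> :: "'e \<Rightarrow> nat"
    by (intro continuous_intros)
  have IJ: "I (\<lambda>x. \<Prod>i\<in>Basis. inner x i ^ \<alpha> i) = J (\<lambda>x. \<Prod>i\<in>Basis. inner x i ^ \<alpha> i)" if "\<alpha> \<in> A" for \<alpha>
  proof -
    obtain ys where "length ys \<le> d" "\<And>x. (\<Prod>i\<in>Basis. inner x i ^ \<alpha> i) = prod_list (map (inner x) ys)"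
      using monomial_as_list_product[OF finite_Basis, of \<alpha>] A(2) \<open>\<alpha> \<in> A\<close> by metis
    then show ?thesis using mono[of ys "[]"] by simp
  qed
  show ?thesis unfolding feq
    using A(1) by (simp add: I.mean_sum J.mean_sum I.mean_scale J.mean_scale IJ cont continuous_on_mult_left)
qed

text \<open>The 2-adic valuation of a square is even. Hence if \<open>2 ^ d\<close> divides the
  square of an integer, the integer itself is divisible by 2 to the power d/2 rounded up.\<close>

lemma Ints_half_power:
  fixes x :: real
  assumes x: "x \<in> \<int>" and sq: "x^2 / 2 ^ d \<in> \<int>"
  shows "x / 2 ^ ((d + 1) div 2) \<in> \<int>"
proof -
  obtain k where k: "x = of_int k" using x by (auto elim: Ints_cases)
  obtain j where "x^2 / 2 ^ d = of_int j" using sq by (auto elim: Ints_cases)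
  then have "of_int (k^2) = (of_int (j * 2 ^ d) :: real)" by (simp add: k field_simps)
  then have kj: "k^2 = j * 2 ^ d" by (simp only: of_int_eq_iff)
  define e where "e = d div 2"
  have "(2 ^ e)^2 dvd k^2"
    unfolding kj power_mult[symmetric] by (intro dvd_mult le_imp_power_dvd) (simp add: e_def)
  then obtain l where l: "k = 2 ^ e * l" by (auto simp: pow_divides_pow_iff elim: dvdE)
  have "2 ^ ((d + 1) div 2) dvd k"
  proof (cases "even d")
    case True
    then have "(d + 1) div 2 = e" by (auto simp: e_def)
    then show ?thesis by (simp add: l)
  next
    case False
    then have d: "d = Suc (2 * e)" "(d + 1) div 2 = Suc e" by (auto simp: e_def elim: oddE)
    have "(2 ^ e)^2 * l^2 = (2 ^ e)^2 * (2 * j)"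
      using kj unfolding d l by (simp add: power_mult_distrib power_mult[symmetric] mult.commute)
    then have "l^2 = 2 * j" by simp
    then have "even (l^2)" by simp
    then show ?thesis by (auto simp: d l elim: evenE)
  qed
  then obtain i where "k = 2 ^ ((d + 1) div 2) * i" by (rule dvdE)
  then show ?thesis by (simp add: k)
qed

text \<open>Only the one term that is rounded down can lose a unit, and
  \<open>2 * k \<le> 2 * n + 1\<close> still implies \<open>k \<le> n\<close>.\<close>

lemma half_sum_le:
  fixes k :: nat
  assumes "2 * k \<le> a + b + d"
  shows "k \<le> (a + 1) div 2 + b div 2 + (d + 1) div 2"
proof -
  have "a \<le> 2 * ((a + 1) div 2)" "b \<le> 2 * (b div 2) + 1" "d \<le> 2 * ((d + 1) div 2)" by simp_all
  then show ?thesis using assms by linarith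
qed

text \<open>The sum is the expansion of the product of the factors -1 + 1 over the elements of
  \<open>D\<close>.\<close>

lemma alternating_sum_Pow:
  assumes "finite D"
  shows "(\<Sum>B\<in>Pow D. (-1) ^ card B) = (if D = {} then 1 else (0::real))"
proof -
  have "(\<Sum>B\<in>Pow D. (-1) ^ card B) = (\<Prod>x\<in>D. (-1) + (1::real))"
    using assms by (simp only: prod_add) simp
  then show ?thesis using assms by (simp add: prod_zero_iff) auto
qed

section \<open>The setting for the Barnes-Wall lattice\<close>

locale barnes_wall_setup = binary_field m \<zeta> for m and \<zeta> :: "'f::{field,finite}" +
  fixes b :: "'f \<Rightarrow> 'e::euclidean_space" and v :: "nat \<Rightarrow> 'f" and \<sigma> \<eta> :: "'e \<Rightarrow> 'e" and BW :: "'e set"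
  assumes primitive: "primitive_element \<zeta>"
    and span_b: "span (range b) = UNIV"
    and inner_b: "inner (b u) (b w) = (if u = w then 1 / 2 ^ m else 0)"
    and linear_\<sigma>: "linear \<sigma>" and \<sigma>_b: "\<sigma> (b u) = b (\<zeta> * u)"
    and \<eta>_eq: "\<eta> = \<sigma> ^^ ((4 ^ m - 1) div 3)"
    and basis_v: "f2_basis (2 * m) v"
    and BW_eq: "BW = barnes_wall m b v"
begin

subsection \<open>Coordinates and operators\<close>

text \<open>As \<open>b u\<close> has square length \<open>1 / 2 ^ m\<close>, the factor
  \<open>2 ^ m\<close> turns the inner product into the coefficient of \<open>b u\<close> in
  \<open>x\<close>.\<close>

definition co :: "'e \<Rightarrow> 'f \<Rightarrow> real" where "co x u = 2 ^ m * inner x (b u)"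

definition mk :: "('f \<Rightarrow> real) \<Rightarrow> 'e" where "mk f = (\<Sum>u\<in>UNIV. f u *\<^sub>R b u)"

lemma co_mk [simp]: "co (mk f) u = f u"
proof -
  have "inner (mk f) (b u) = (\<Sum>w\<in>UNIV. if w = u then f w / 2 ^ m else 0)"
    unfolding mk_def inner_sum_left by (rule sum.cong) (auto simp: inner_b)
  then show ?thesis by (simp add: co_def)
qed

lemma co_add [simp]: "co (x + y) u = co x u + co y u"
  and co_diff [simp]: "co (x - y) u = co x u - co y u"
  and co_minus [simp]: "co (- x) u = - co x u"
  and co_scaleR [simp]: "co (c *\<^sub>R x) u = c * co x u"
  and co_sum: "co (\<Sum>i\<in>A. f i) u = (\<Sum>i\<in>A. co (f i) u)"
  by (simp_all add: co_def inner_add_left inner_diff_left inner_sum_left algebra_simps sum_distrib_left)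

lemma co_eqI:
  assumes "\<And>u. co x u = co y u" shows "x = y"
proof -
  have "inner (x - y) (b u) = 0" for u using assms[of u] by (simp add: co_def inner_diff_left)
  then have *: "orthogonal (x - y) z" if "z \<in> range b" for z using that by (auto simp: orthogonal_def)
  have "orthogonal (x - y) (x - y)"
    by (rule orthogonal_to_span[where S="range b"]) (use * in \<open>auto simp: span_b\<close>)
  then show ?thesis by (simp add: orthogonal_def)
qed

lemma mk_co [simp]: "mk (co x) = x" by (rule co_eqI) simp

lemma inner_co: "inner x y = (\<Sum>u\<in>UNIV. co x u * co y u) / 2 ^ m"
proof -
  have "inner x y = inner x (mk (co y))" by simp
  also have "\<dots> = (\<Sum>u\<in>UNIV. co y u * inner x (b u))" by (simp only: mk_def inner_sum_right inner_scaleR_right)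
  also have "\<dots> = (\<Sum>u\<in>UNIV. co x u * co y u) / 2 ^ m"
    by (simp add: co_def sum_divide_distrib mult_ac)
  finally show ?thesis .
qed

lemma co_b: "co (b u) w = (if w = u then 1 else 0)"
  by (simp add: co_def inner_b)

definition shift :: "'f \<Rightarrow> 'e \<Rightarrow> 'e" where "shift a x = mk (\<lambda>u. co x (u + a))"
definition modulate :: "'f \<Rightarrow> 'e \<Rightarrow> 'e" where "modulate c x = mk (\<lambda>u. chi (c * u) * co x u)"
definition cubic :: "'f \<Rightarrow> 'e \<Rightarrow> 'e" where "cubic l x = mk (\<lambda>u. chi (l * u^3) * co x u)"
text \<open>Dividing by \<open>2 ^ m\<close>, the square root of the number of field elements, makes
  this Fourier transform an orthogonal involution.\<close>

definition hadamard :: "'e \<Rightarrow> 'e" where "hadamard x = mk (\<lambda>u. (\<Sum>w\<in>UNIV. chi (u * w) * co x w) / 2 ^ m)"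

lemma co_ops [simp]:
  "co (shift a x) u = co x (u + a)"
  "co (modulate c x) u = chi (c * u) * co x u"
  "co (cubic l x) u = chi (l * u^3) * co x u"
  "co (hadamard x) u = (\<Sum>w\<in>UNIV. chi (u * w) * co x w) / 2 ^ m"
  by (simp_all add: shift_def modulate_def cubic_def hadamard_def)

lemma zeta_nonzero: "\<zeta> \<noteq> 0"
proof -
  have "\<zeta> ^ 1 \<in> range (\<lambda>n::nat. \<zeta> ^ n)" by blast
  then show ?thesis using primitive by (auto simp: primitive_element_def)
qed

lemma co_\<sigma> [simp]: "co (\<sigma> x) u = co x (u / \<zeta>)"
proof -
  have "\<sigma> x = \<sigma> (mk (co x))" by simp
  also have "\<dots> = (\<Sum>w\<in>UNIV. co x w *\<^sub>R b (\<zeta> * w))"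
    by (simp only: mk_def linear_sum[OF linear_\<sigma>] linear_scale[OF linear_\<sigma>] \<sigma>_b)
  also have "co \<dots> u = (\<Sum>w\<in>UNIV. if w = u / \<zeta> then co x w else 0)"
    unfolding co_sum by (rule sum.cong) (auto simp: co_b zeta_nonzero)
  finally show ?thesis by simp
qed

lemma linear_ops: "linear (shift a)" "linear (modulate c)" "linear (cubic l)" "linear hadamard"
  by (intro linearI co_eqI; simp add: algebra_simps sum.distrib sum_divide_distrib add_divide_distrib sum_distrib_left)+

lemma shift_adjoint: "inner (shift a x) y = inner x (shift a y)"
  unfolding inner_co co_ops
  by (intro arg_cong2[where f="(/)"] refl sum.reindex_bij_witness[where i="\<lambda>u. u + a" and j="\<lambda>u. u + a"]) auto

lemma modulate_adjoint: "inner (modulate c x) y = inner x (modulate c y)"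
  and cubic_adjoint: "inner (cubic l x) y = inner x (cubic l y)"
  by (simp_all add: inner_co mult_ac)

lemma hadamard_adjoint: "inner (hadamard x) y = inner x (hadamard y)"
proof -
  have "(\<Sum>u\<in>UNIV. \<Sum>w\<in>UNIV. chi (u * w) * co x w * co y u) = (\<Sum>u\<in>UNIV. \<Sum>w\<in>UNIV. co x u * (chi (u * w) * co y w))"
    by (subst sum.swap) (simp add: mult_ac)
  then show ?thesis
    by (simp add: inner_co sum_distrib_left sum_distrib_right flip: sum_divide_distrib)
qed

lemma involutions [simp]: "shift a (shift a x) = x" "modulate c (modulate c x) = x" "cubic l (cubic l x) = x"
  by (rule co_eqI, simp)+

lemma sum_chi_product: "(\<Sum>u\<in>UNIV. chi (s * u) * chi (u * t)) = (if s = t then 4 ^ m else 0)"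
proof -
  have "chi (s * u) * chi (u * t) = chi ((s + t) * u)" for u
    by (simp add: distrib_left distrib_right chi_add mult.commute)
  then show ?thesis using add_eq_iff[of s t 0] by (simp add: sum_chi_UNIV)
qed

lemma hadamard_involution [simp]: "hadamard (hadamard x) = x"
proof (rule co_eqI)
  fix s
  have "co (hadamard (hadamard x)) s = (\<Sum>u\<in>UNIV. \<Sum>t\<in>UNIV. chi (s * u) * chi (u * t) * co x t) / 4 ^ m"
    by (simp add: sum_distrib_left sum_divide_distrib mult_ac flip: power_mult_distrib)
  also have "(\<Sum>u\<in>UNIV. \<Sum>t\<in>UNIV. chi (s * u) * chi (u * t) * co x t)
      = (\<Sum>t\<in>UNIV. (\<Sum>u\<in>UNIV. chi (s * u) * chi (u * t)) * co x t)"
    by (subst sum.swap) (simp add: sum_distrib_right)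
  also have "\<dots> = (\<Sum>t\<in>UNIV. if t = s then 4 ^ m * co x t else 0)"
    by (rule sum.cong) (auto simp: sum_chi_product)
  finally show "co (hadamard (hadamard x)) s = co x s" by simp
qed

lemma orthogonal_ops:
  "orthogonal_transformation (shift a)" "orthogonal_transformation (modulate c)"
  "orthogonal_transformation (cubic l)" "orthogonal_transformation hadamard"
  by (simp_all add: orthogonal_transformation_def linear_ops shift_adjoint modulate_adjoint
      cubic_adjoint hadamard_adjoint)

lemma orthogonal_\<sigma>: "orthogonal_transformation \<sigma>"
  unfolding orthogonal_transformation_def inner_co co_\<sigma>
  by (intro conjI linear_\<sigma> allI arg_cong2[where f="(/)"] refl
      sum.reindex_bij_witness[where i="\<lambda>u. \<zeta> * u" and j="\<lambda>u. u / \<zeta>"]) (auto simp: zeta_nonzero)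

subsection \<open>Integrality of quadratic exponential sums\<close>

text \<open>Despite the cube this is a quadratic phase over the prime field: \<open>u^3\<close> is
  the product of \<open>u\<close> with its Frobenius image \<open>u^2\<close>, so the trace of
  \<open>l * u^3\<close> is a quadratic form.\<close>

definition phase :: "'f \<Rightarrow> 'f \<Rightarrow> 'f \<Rightarrow> real" where "phase l c u = chi (l * u^3 + c * u)"

lemma phase_mult: "phase l c u * phase l' c' u = phase (l + l') (c + c') u"
proof -
  have "(l + l') * u^3 + (c + c') * u = (l * u^3 + c * u) + (l' * u^3 + c' * u)"
    by (simp add: algebra_simps)
  then show ?thesis by (simp only: phase_def chi_add)
qed

lemma cube_add: "(u + t)^3 = u^3 + u^2 * t + u * t^2 + t^3" for u t :: 'f
proof -
  have "(u + t)^3 = (u + t) * (u^2 + t^2)"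
    unfolding square_add[symmetric] by (simp add: power3_eq_cube power2_eq_square mult.assoc)
  then show ?thesis by (simp add: algebra_simps power2_eq_square power3_eq_cube)
qed

text \<open>The mixed terms of the cube are \<open>l * t * u^2\<close> and
  \<open>l * t^2 * u\<close>. With \<open>\<mu>^2 = l * t\<close> the first is the square of
  \<open>\<mu> * u\<close>, and \<open>chi\<close> does not see squaring, so both give linear
  characters of \<open>u\<close>.\<close>

lemma chi_cube_add:
  obtains k where "\<And>u. chi (l * (u + t)^3) = chi (l * u^3) * chi (k * u) * chi (l * t^3)"
proof -
  obtain \<mu> where \<mu>: "\<mu>^2 = l * t" by (rule obtain_sqrt)
  have "chi (l * (u + t)^3) = chi (l * u^3) * chi ((\<mu> + l * t^2) * u) * chi (l * t^3)" for u
  proof -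
    have "l * (u + t)^3 = l * u^3 + (\<mu> * u)^2 + l * t^2 * u + l * t^3"
      by (simp add: cube_add power_mult_distrib \<mu> algebra_simps)
    then show ?thesis by (simp add: chi_add distrib_right)
  qed
  then show thesis using that by blast
qed

text \<open>The discrete derivative of a quadratic phase is, up to sign, a linear character: the
  terms in \<open>l * u^3\<close> and \<open>c * u\<close> occur twice and cancel.\<close>

lemma phase_shift:
  obtains e k where "e \<in> \<int>" "\<And>u. phase l c u * phase l c (u + t) = e * chi (k * u)"
proof -
  obtain k where k: "\<And>u. chi (l * (u + t)^3) = chi (l * u^3) * chi (k * u) * chi (l * t^3)"
    using chi_cube_add[of l t] by blast
  have "phase l c u * phase l c (u + t) = chi (l * t^3) * chi (c * t) * chi (k * u)" for u
  proof -
    have "phase l c u * phase l c (u + t) = (chi (l * u^3) * chi (l * u^3)) * (chi (c * u) * chi (c * u)) *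
        (chi (l * t^3) * chi (c * t) * chi (k * u))"
      by (simp only: phase_def chi_add distrib_left k mult_ac)
    then show ?thesis by simp
  qed
  then show thesis using that[of "chi (l * t^3) * chi (c * t)" k] by simp
qed

lemma sum_coset:
  assumes "subgp U"
  shows "(\<Sum>u | u + a \<in> U. f u) = (\<Sum>t\<in>U. f (a + t :: 'f))"
  by (rule sum.reindex_bij_witness[where i="\<lambda>t. a + t" and j="\<lambda>u. u + a"]) (auto simp: add.commute)

text \<open>The classical squaring of a Gauss sum. Substituting \<open>w = u + t\<close> in the
  square leaves, for each \<open>t\<close> in \<open>U\<close>, a sum of a linear character over a
  coset of \<open>U\<close>, which up to an integer factor is 0 or \<open>card U\<close>.\<close>

lemma phase_sum_Ints:
  assumes U: "subgp U"
  shows "(\<Sum>u | u + a \<in> U. phase l c u) \<in> \<int>"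
    and "(\<Sum>u | u + a \<in> U. phase l c u)^2 / card U \<in> \<int>"
proof -
  let ?S = "\<Sum>u | u + a \<in> U. phase l c u"
  show "?S \<in> \<int>" by (intro Ints_sum) (simp add: phase_def)
  have U0: "real (card U) \<noteq> 0" using subgp_0[OF U] by auto
  have inner: "(\<Sum>u | u + a \<in> U. phase l c u * phase l c (u + t)) / card U \<in> \<int>" for t
  proof -
    obtain e k where ek: "e \<in> \<int>" "\<And>u. phase l c u * phase l c (u + t) = e * chi (k * u)"
      using phase_shift[of l c t] by blast
    have "(\<Sum>u | u + a \<in> U. phase l c u * phase l c (u + t)) = e * chi (k * a) * (\<Sum>s\<in>U. chi (k * s))"
      by (simp add: ek(2) sum_coset[OF U] distrib_left chi_add sum_distrib_left mult_ac)
    then show ?thesis using ek(1) U0 by (simp add: sum_chi_subgp[OF U])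
  qed
  have "?S^2 = (\<Sum>u | u + a \<in> U. \<Sum>w | w + a \<in> U. phase l c u * phase l c w)"
    by (simp add: power2_eq_square sum_product)
  also have "\<dots> = (\<Sum>u | u + a \<in> U. \<Sum>t\<in>U. phase l c u * phase l c (u + t))"
  proof (rule sum.cong[OF refl])
    fix u assume "u \<in> {u. u + a \<in> U}"
    then have u: "u + a \<in> U" by simp
    show "(\<Sum>w | w + a \<in> U. phase l c u * phase l c w) = (\<Sum>t\<in>U. phase l c u * phase l c (u + t))"
    proof (rule sum.reindex_bij_witness[where i="\<lambda>t. u + t" and j="\<lambda>w. u + w"])
      fix w assume "w \<in> {w. w + a \<in> U}"
      moreover have "(u + a) + (w + a) = u + w + (a + a)" by (simp only: ac_simps)
      ultimately show "u + w \<in> U" using subgp_add[OF U u, of "w + a"] by (simp add: char_two)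
    next
      fix t assume "t \<in> U"
      then show "u + t \<in> {w. w + a \<in> U}" using subgp_add[OF U u, of t] by (simp add: ac_simps)
    qed auto
  qed
  also have "\<dots> = (\<Sum>t\<in>U. \<Sum>u | u + a \<in> U. phase l c u * phase l c (u + t))"
    by (rule sum.swap)
  finally show "?S^2 / card U \<in> \<int>"
    using inner by (simp add: sum_divide_distrib Ints_sum)
qed

text \<open>The quadratic phase restricted to the coset \<open>a + U\<close>. Up to powers of 2, the
  generators of \<open>BW\<close>, their images under \<open>cubic\<close> and
  \<open>hadamard\<close>, and the dual basis all have this shape.\<close>

definition twisted :: "'f \<Rightarrow> 'f \<Rightarrow> 'f \<Rightarrow> 'f set \<Rightarrow> 'e" where
  "twisted l c a U = mk (\<lambda>u. if u + a \<in> U then phase l c u else 0)"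

lemma co_twisted: "co (twisted l c a U) u = (if u + a \<in> U then phase l c u else 0)"
  by (simp add: twisted_def)

text \<open>The inner product is \<open>1 / 2 ^ m\<close> times a phase sum over the intersection of
  two cosets, which is empty or a coset of \<open>U \<inter> V\<close>. If the latter has order
  \<open>2 ^ d\<close>, the sum is divisible by 2 to the power d/2 rounded up, and
  \<open>r + s \<le> d + 2 * m\<close> makes all powers of 2 together outweigh the denominator.
  Rounding up for one vector and down for the other reflects the pairing of the lattice with its
  dual.\<close>

lemma twisted_inner_Ints:
  assumes U: "subgp U" "card U = 2 ^ r" and V: "subgp V" "card V = 2 ^ s"
  shows "2 ^ ((2 * m - r + 1) div 2) * 2 ^ ((2 * m - s) div 2) * inner (twisted l c a U) (twisted l' c' a' V) \<in> \<int>"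
proof -
  have inner: "inner (twisted l c a U) (twisted l' c' a' V)
      = (\<Sum>u | u + a \<in> U \<and> u + a' \<in> V. phase (l + l') (c + c') u) / 2 ^ m"
    by (simp add: inner_co co_twisted phase_mult if_distrib[of "\<lambda>x. x * _"] if_distrib[of "\<lambda>x. _ * x"]
        sum.If_cases Collect_conj_eq cong: if_cong) (simp add: Int_commute)
  show ?thesis
  proof (cases "\<exists>a0. a0 + a \<in> U \<and> a0 + a' \<in> V")
    case False
    then have empty: "{u. u + a \<in> U \<and> u + a' \<in> V} = {}" by blast
    show ?thesis unfolding inner empty by simp
  next
    case True
    then obtain a0 where a0: "a0 + a \<in> U" "a0 + a' \<in> V" by auto
    \<comment> \<open>With the common point \<open>a0\<close> as base point for both cosets, their
      intersection becomes a single coset of \<open>U \<inter> V\<close>.\<close>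
    have "u + a0 + (a0 + a) = u + a" "u + a0 + (a0 + a') = u + a'" for u :: 'f
      by (metis add.assoc add_cancel2(1))+
    then have set: "{u. u + a \<in> U \<and> u + a' \<in> V} = {u. u + a0 \<in> U \<inter> V}"
      using a0 subgp_add_iff[OF U(1)] subgp_add_iff[OF V(1)] by (metis (no_types, lifting) Int_iff)
    have UV: "subgp (U \<inter> V)" using U V by (intro subgp_Int)
    obtain d where d: "card (U \<inter> V) = 2 ^ d" using card_subgp[OF UV] .
    have "(2::nat) ^ (r + s) \<le> 2 ^ (d + 2 * m)"
      using card_subgp_Int[OF U(1) V(1)] by (simp add: U V d card_field power_add power_mult)
    then have rs: "r + s \<le> d + 2 * m" by simp
    define S where "S = (\<Sum>u | u + a0 \<in> U \<inter> V. phase (l + l') (c + c') u)"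
    define e where "e = (d + 1) div 2"
    define \<alpha> where "\<alpha> = (2 * m - r + 1) div 2 + (2 * m - s) div 2"
    have "S \<in> \<int>" "S^2 / 2 ^ d \<in> \<int>"
      using phase_sum_Ints[OF UV, of "l + l'" "c + c'" a0] by (simp_all add: S_def d)
    then have S: "S / 2 ^ e \<in> \<int>" unfolding e_def by (rule Ints_half_power)
    have "2 * m \<le> (2 * m - r) + (2 * m - s) + d" using rs by linarith
    then have "m \<le> \<alpha> + e" unfolding \<alpha>_def e_def by (rule half_sum_le)
    then obtain j where j: "\<alpha> + e = m + j" by (metis le_Suc_ex)
    have "2 ^ \<alpha> * S / 2 ^ m = 2 ^ j * (S / 2 ^ e)"
      using j by (simp add: field_simps flip: power_add)
    also have "\<dots> \<in> \<int>" using S by (intro Ints_mult Ints_power) auto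
    finally show ?thesis by (simp only: inner set S_def[symmetric] \<alpha>_def power_add times_divide_eq_right)
  qed
qed

end

section \<open>Integral spans\<close>

lemma module_int: "Modules.module (\<lambda>(k::int) x::'e::real_vector. of_int k *\<^sub>R x)"
  by unfold_locales (simp_all add: algebra_simps)

lemma int_span_base: "x \<in> S \<Longrightarrow> x \<in> int_span S"
  unfolding int_span_def by (rule Modules.module.span_base[OF module_int])

lemma int_span_add: "x \<in> int_span S \<Longrightarrow> y \<in> int_span S \<Longrightarrow> x + y \<in> int_span S"
  unfolding int_span_def by (rule Modules.module.span_add[OF module_int])

lemma int_span_scale: "x \<in> int_span S \<Longrightarrow> of_int k *\<^sub>R x \<in> int_span S"
  unfolding int_span_def by (rule Modules.module.span_scale[OF module_int])

lemma int_span_sum: "(\<And>i. i \<in> A \<Longrightarrow> h i \<in> int_span S) \<Longrightarrow> sum h A \<in> int_span S"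
  unfolding int_span_def by (rule Modules.module.span_sum[OF module_int])

lemma int_span_induct [consumes 1, case_names zero add]:
  assumes "x \<in> int_span S" "P 0" "\<And>k x y. x \<in> S \<Longrightarrow> P y \<Longrightarrow> P (of_int k *\<^sub>R x + y)"
  shows "P x"
  using Modules.module.span_induct_alt[OF module_int, of x S P] assms unfolding int_span_def by blast

context barnes_wall_setup
begin

subsection \<open>The generators of the Barnes-Wall lattice and their dual basis\<close>

lemma module_bit: "Modules.module (bit_scale :: bit \<Rightarrow> 'f \<Rightarrow> 'f)"
  by unfold_locales (auto simp: bit_scale_def char_two)

definition index_set :: "nat set" where "index_set = {1..2 * m}"

lemma index_set_finite [simp]: "finite index_set" and card_index_set [simp]: "card index_set = 2 * m"
  by (simp_all add: index_set_def)

lemma co_twisted_0: "co (twisted 0 0 0 U) u = (if u \<in> U then 1 else 0)"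
  by (simp add: co_twisted phase_def)

definition vsum :: "nat set \<Rightarrow> 'f" where "vsum A = (\<Sum>i\<in>A. v i)"

definition coord_subspace :: "nat set \<Rightarrow> 'f set" where "coord_subspace S = vsum ` Pow S"

text \<open>Common summands cancel in characteristic two, so index sets under symmetric difference
  model addition in the field.\<close>

lemma vsum_add:
  assumes "finite A" "finite B"
  shows "vsum A + vsum B = vsum (sym_diff A B)"
proof -
  have "vsum A = vsum (A - B) + vsum (A \<inter> B)" "vsum B = vsum (B - A) + vsum (A \<inter> B)"
    unfolding vsum_def using assms by (metis Int_Diff_Un Int_Diff_disjoint Int_commute add.commute finite_Diff finite_Int sum.union_disjoint)+
  moreover have "vsum (sym_diff A B) = vsum (A - B) + vsum (B - A)"
    unfolding vsum_def using assms by (intro sum.union_disjoint) auto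
  moreover have "x + y + (z + y) = x + z" for x y z :: 'f
    by (metis add.commute add.left_commute add_cancel2(1))
  ultimately show ?thesis by simp
qed

lemma subgp_coord_subspace: "finite S \<Longrightarrow> subgp (coord_subspace S)"
proof -
  assume S: "finite S"
  have "vsum A + vsum B \<in> coord_subspace S" if "A \<subseteq> S" "B \<subseteq> S" for A B
    using that S vsum_add[of A B] by (auto simp: coord_subspace_def finite_subset)
  then have "x + y \<in> coord_subspace S" if "x \<in> coord_subspace S" "y \<in> coord_subspace S" for x y
    using that unfolding coord_subspace_def by blast
  moreover have "0 \<in> coord_subspace S"
    unfolding coord_subspace_def by (rule image_eqI[of _ _ "{}"]) (simp_all add: vsum_def)
  ultimately show ?thesis unfolding subgp_def by blast
qed

lemma span_bit_eq:
  assumes S: "finite S" shows "Modules.module.span bit_scale (v ` S) = coord_subspace S"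
proof (intro equalityI subsetI)
  fix x assume "x \<in> Modules.module.span bit_scale (v ` S)"
  then show "x \<in> coord_subspace S"
  proof (induction rule: Modules.module.span_induct_alt[OF module_bit, consumes 1])
    case 1
    then show ?case using subgp_coord_subspace[OF S] by (simp add: subgp_0)
  next
    case (2 c x y)
    then obtain i where "i \<in> S" "x = v i" by auto
    then have "x \<in> coord_subspace S" by (auto simp: coord_subspace_def vsum_def intro!: image_eqI[of _ _ "{i}"])
    then show ?case using 2 subgp_coord_subspace[OF S]
      by (auto simp: bit_scale_def subgp_add)
  qed
next
  fix x assume "x \<in> coord_subspace S"
  then obtain A where A: "A \<subseteq> S" "x = (\<Sum>i\<in>A. v i)" by (auto simp: coord_subspace_def vsum_def)
  show "x \<in> Modules.module.span bit_scale (v ` S)"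
    unfolding A(2) by (intro Modules.module.span_sum[OF module_bit] Modules.module.span_base[OF module_bit])
      (use A(1) in blast)
qed

text \<open>Spanning gives surjectivity, and both sides have \<open>4 ^ m\<close> elements.\<close>

lemma bij_vsum: "bij_betw vsum (Pow index_set) UNIV"
proof -
  have surj: "vsum ` Pow index_set = UNIV"
    using basis_v span_bit_eq[of index_set] unfolding f2_basis_def coord_subspace_def index_set_def by simp
  have "card (Pow index_set) = CARD('f)"
    by (simp add: card_Pow card_field power_mult)
  then have "inj_on vsum (Pow index_set)"
    using surj by (intro eq_card_imp_inj_on) simp_all
  then show ?thesis using surj by (simp add: bij_betw_def)
qed

lemma inj_vsum: "inj_on vsum (Pow index_set)" using bij_vsum by (simp add: bij_betw_def)

lemma vsum_in_coord_subspace: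
  assumes "A \<subseteq> index_set" "S \<subseteq> index_set"
  shows "vsum A \<in> coord_subspace S \<longleftrightarrow> A \<subseteq> S"
proof
  assume "vsum A \<in> coord_subspace S"
  then obtain B where "B \<subseteq> S" "vsum A = vsum B" by (auto simp: coord_subspace_def)
  then show "A \<subseteq> S" using inj_onD[OF inj_vsum, of A B] assms by auto
qed (auto simp: coord_subspace_def)

lemma card_coord_subspace: "S \<subseteq> index_set \<Longrightarrow> card (coord_subspace S) = 2 ^ card S"
  unfolding coord_subspace_def
  by (subst card_image) (auto intro: inj_on_subset[OF inj_vsum] simp: card_Pow finite_subset)

text \<open>By nondegeneracy, \<open>c\<close> is determined by the signs of its character on the
  basis \<open>v\<close>. There are as many elements \<open>c\<close> as sign patterns, so every
  pattern occurs.\<close>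

lemma obtain_character:
  assumes "T \<subseteq> index_set"
  obtains c where "\<And>i. i \<in> index_set \<Longrightarrow> chi (c * v i) = (if i \<in> T then 1 else -1)"
proof -
  define neg where "neg c = {i \<in> index_set. chi (c * v i) = -1}" for c
  have "inj neg"
  proof (rule injI, rule ccontr)
    fix c d assume eq: "neg c = neg d" and "c \<noteq> d"
    have same: "chi (c * v i) = chi (d * v i)" if "i \<in> index_set" for i
    proof -
      have "i \<in> neg c \<longleftrightarrow> i \<in> neg d" using eq by simp
      then show ?thesis using that chi_cases[of "c * v i"] chi_cases[of "d * v i"] by (auto simp: neg_def)
    qed
    have "c + d \<noteq> 0" using \<open>c \<noteq> d\<close> by (simp add: add_eq_iff)
    then obtain u where u: "chi ((c + d) * u) = -1" by (rule chi_nontrivial)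
    obtain A where A: "A \<subseteq> index_set" "u = vsum A"
      using bij_vsum by (auto simp: bij_betw_def)
    have "finite A" by (rule finite_subset[OF A(1)]) simp
    have "chi ((c + d) * vsum B) = 1" if "finite B" "B \<subseteq> index_set" for B
      using that
    proof (induction B)
      case (insert i B)
      then have "(c + d) * vsum (insert i B) = c * v i + d * v i + (c + d) * vsum B"
        by (simp add: vsum_def distrib_left distrib_right add_ac)
      moreover have "chi (c * v i) * chi (d * v i) = 1" using same[of i] insert.prems by simp
      moreover have "chi ((c + d) * vsum B) = 1" using insert by simp
      ultimately show ?case by (simp only: chi_add mult_1_right)
    qed (simp add: vsum_def)
    from this[OF \<open>finite A\<close> A(1)] show False using u A(2) by simp
  qed
  moreover have "card (Pow index_set) = CARD('f)"
    by (simp add: card_Pow card_field power_mult)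
  moreover have "range neg \<subseteq> Pow index_set" by (auto simp: neg_def)
  ultimately have "range neg = Pow index_set"
    by (intro card_subset_eq) (auto simp: card_image)
  then obtain c where "neg c = index_set - T" by (metis Diff_subset PowI imageE)
  then have "chi (c * v i) = (if i \<in> T then 1 else -1)" if "i \<in> index_set" for i
    using that chi_cases[of "c * v i"] assms unfolding neg_def by auto
  then show thesis using that by blast
qed

text \<open>The coordinate vector of a field element with respect to \<open>v\<close>, recorded as
  its support.\<close>

definition idx :: "'f \<Rightarrow> nat set" where "idx = inv_into (Pow index_set) vsum"

lemma idx_vsum [simp]: "A \<subseteq> index_set \<Longrightarrow> idx (vsum A) = A"
  unfolding idx_def by (intro inv_into_f_f inj_vsum) auto

lemma vsum_idx [simp]: "vsum (idx u) = u" and idx_subset: "idx u \<subseteq> index_set"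
  using bij_vsum f_inv_into_f[of u vsum "Pow index_set"] inv_into_into[of u vsum "Pow index_set"]
  by (auto simp: idx_def bij_betw_def)

definition gen :: "nat set \<Rightarrow> 'e" where
  "gen T = 2 ^ ((2 * m - card T + 1) div 2) *\<^sub>R twisted 0 0 0 (coord_subspace T)"

text \<open>Moebius inversion on subsets: \<open>gen T\<close> is a multiple of the indicator of the
  subsets of \<open>T\<close>, and the alternating signs on the supersets of \<open>T\<close> are
  dual to it. The power of 2 complements that of \<open>gen T\<close> to
  \<open>2 ^ m\<close>.\<close>

definition dual_gen :: "nat set \<Rightarrow> 'e" where
  "dual_gen T = 2 ^ (card T div 2) *\<^sub>R mk (\<lambda>u. if T \<subseteq> idx u then (-1) ^ card (idx u - T) else 0)"

lemma BW_int_span: "BW = int_span (gen ` Pow index_set)"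
proof -
  have gen: "2 ^ ((2 * m - card T + 1) div 2) *\<^sub>R (\<Sum>u\<in>Modules.module.span bit_scale (v ` T). b u) = gen T"
    if "T \<subseteq> index_set" for T
  proof -
    have "(\<Sum>u\<in>coord_subspace T. b u) = twisted 0 0 0 (coord_subspace T)"
      by (rule co_eqI) (simp add: co_sum co_b co_twisted_0 sum.delta if_distrib)
    then show ?thesis using that by (simp add: span_bit_eq finite_subset gen_def)
  qed
  have card: "card T \<le> 2 * m" if "T \<subseteq> index_set" for T
    using card_mono[OF _ that] by simp
  have "{(2 ^ ((2 * m - r + 1) div 2)) *\<^sub>R (\<Sum>u\<in>U. b u) | U r.
                 r \<le> 2 * m \<and> U \<in> basis_subspaces (2 * m) v r} = gen ` Pow index_set" (is "?A = ?B")
  proof (intro equalityI subsetI)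
    fix x assume "x \<in> ?A"
    then obtain U r where x: "x = 2 ^ ((2 * m - r + 1) div 2) *\<^sub>R (\<Sum>u\<in>U. b u)"
      and "U \<in> basis_subspaces (2 * m) v r" by blast
    then obtain T where T: "T \<subseteq> index_set" "card T = r" "U = Modules.module.span bit_scale (v ` T)"
      unfolding basis_subspaces_def index_set_def by blast
    then have "x = gen T" using gen[OF T(1)] x by simp
    then show "x \<in> ?B" using T by blast
  next
    fix x assume "x \<in> ?B"
    then obtain T where T: "T \<subseteq> index_set" "x = gen T" by blast
    have "Modules.module.span bit_scale (v ` T) \<in> basis_subspaces (2 * m) v (card T)"
      using T(1) unfolding basis_subspaces_def index_set_def by blast
    then show "x \<in> ?A" unfolding T(2) gen[OF T(1), symmetric] using card[OF T(1)] by blast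
  qed
  then show ?thesis by (simp add: BW_eq barnes_wall_def)
qed

text \<open>The supersets of \<open>T\<close> index the coset of \<open>vsum T\<close> modulo the
  span of the other basis vectors, and the alternating sign is the linear character with value 1 on
  \<open>v i\<close> for \<open>i\<close> in \<open>T\<close> and -1 on the others. Thus
  \<open>twisted_inner_Ints\<close> applies to the dual basis.\<close>

lemma dual_gen_twisted:
  assumes T: "T \<subseteq> index_set"
  obtains c a where
    "dual_gen T = 2 ^ ((2 * m - (2 * m - card T)) div 2) *\<^sub>R twisted 0 c a (coord_subspace (index_set - T))"
    "card (coord_subspace (index_set - T)) = 2 ^ (2 * m - card T)"
proof -
  have fin: "finite T" by (rule finite_subset[OF T]) simp
  have cT: "card T \<le> 2 * m" using card_mono[OF _ T] by simp
  obtain c where c: "\<And>i. i \<in> index_set \<Longrightarrow> chi (c * v i) = (if i \<in> T then 1 else -1)"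
    using obtain_character[OF T] by blast
  have chi_vsum: "chi (c * vsum A) = (-1) ^ card (A - T)" if "finite A" "A \<subseteq> index_set" for A
    using that
  proof (induction A)
    case (insert i A)
    then show ?case using c[of i] by (cases "i \<in> T") (auto simp: vsum_def distrib_left chi_add insert_Diff_if)
  qed (simp add: vsum_def)
  have mem: "vsum A + vsum T \<in> coord_subspace (index_set - T) \<longleftrightarrow> T \<subseteq> A" if A: "A \<subseteq> index_set" for A
  proof -
    have "vsum A + vsum T = vsum (sym_diff A T)" using A fin by (intro vsum_add) (auto intro: finite_subset)
    moreover have "sym_diff A T \<subseteq> index_set" using A T by blast
    ultimately show ?thesis using vsum_in_coord_subspace[of "sym_diff A T" "index_set - T"] A by auto
  qed
  have "mk (\<lambda>u. if T \<subseteq> idx u then (-1) ^ card (idx u - T) else 0) = twisted 0 c (vsum T) (coord_subspace (index_set - T))"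
  proof (rule co_eqI)
    fix u
    show "co (mk (\<lambda>u. if T \<subseteq> idx u then (-1) ^ card (idx u - T) else 0)) u = co (twisted 0 c (vsum T) (coord_subspace (index_set - T))) u"
      using mem[OF idx_subset, of u] chi_vsum[OF _ idx_subset, of u] finite_subset[OF idx_subset, of u]
      by (simp add: co_twisted phase_def)
  qed
  moreover have "card (coord_subspace (index_set - T)) = 2 ^ (2 * m - card T)"
    using T fin by (subst card_coord_subspace) (auto simp: card_Diff_subset)
  ultimately show thesis using that[of c "vsum T"] cT by (simp add: dual_gen_def)
qed

text \<open>Only index sets between \<open>T\<close> and \<open>S\<close> contribute, and their
  signs form the alternating sum over the subsets of \<open>S - T\<close>.\<close>

lemma gen_dual_gen:
  assumes S: "S \<subseteq> index_set" and T: "T \<subseteq> index_set"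
  shows "inner (gen S) (dual_gen T) = (if S = T then 1 else 0)"
proof -
  have fin: "finite S" "finite T" using S T index_set_finite by (blast intro: finite_subset)+
  define K :: real where "K = 2 ^ ((2 * m - card S + 1) div 2) * 2 ^ (card T div 2) / 2 ^ m"
  have "inner (gen S) (dual_gen T) = K * (\<Sum>u\<in>UNIV. (if u \<in> coord_subspace S then 1 else 0) *
      (if T \<subseteq> idx u then (-1) ^ card (idx u - T) else 0))"
  proof -
    have "inner (gen S) (dual_gen T) = 2 ^ ((2 * m - card S + 1) div 2) * (2 ^ (card T div 2) *
        inner (twisted 0 0 0 (coord_subspace S)) (mk (\<lambda>u. if T \<subseteq> idx u then (-1) ^ card (idx u - T) else 0)))"
      by (simp add: gen_def dual_gen_def)
    then show ?thesis by (simp add: inner_co co_twisted_0 K_def)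
  qed
  also have "(\<Sum>u\<in>UNIV. (if u \<in> coord_subspace S then 1 else 0) *
      (if T \<subseteq> idx u then (-1) ^ card (idx u - T) else (0::real)))
      = (\<Sum>A\<in>Pow index_set. (if vsum A \<in> coord_subspace S then 1 else 0) *
      (if T \<subseteq> idx (vsum A) then (-1) ^ card (idx (vsum A) - T) else 0))"
    by (rule sum.reindex_bij_betw[OF bij_vsum, symmetric])
  also have "\<dots> = (\<Sum>A\<in>Pow index_set. if T \<subseteq> A \<and> A \<subseteq> S then (-1) ^ card (A - T) else 0)"
    by (rule sum.cong) (auto simp: vsum_in_coord_subspace S)
  also have "\<dots> = (\<Sum>A | T \<subseteq> A \<and> A \<subseteq> S. (-1) ^ card (A - T))"
    using S by (subst sum.If_cases) (auto intro!: sum.cong)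
  also have "\<dots> = (if S = T then 1 else 0)"
  proof (cases "T \<subseteq> S")
    case True
    have "(\<Sum>A | T \<subseteq> A \<and> A \<subseteq> S. (-1) ^ card (A - T)) = (\<Sum>B\<in>Pow (S - T). (-1) ^ card B :: real)"
      by (rule sum.reindex_bij_witness[where i="\<lambda>B. T \<union> B" and j="\<lambda>A. A - T"])
        (use True in \<open>auto intro!: arg_cong[where f=card]\<close>)
    then show ?thesis using alternating_sum_Pow[of "S - T"] fin True by auto
  next
    case False
    then have empty: "{A. T \<subseteq> A \<and> A \<subseteq> S} = {}" and "S \<noteq> T" by auto
    then show ?thesis unfolding empty by simp
  qed
  finally have *: "inner (gen S) (dual_gen T) = K * (if S = T then 1 else 0)" .
  have "K = 1" if "S = T"
  proof -
    have "card T \<le> 2 * m" using card_mono[OF _ T] by simp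
    \<comment> \<open>One half is rounded up and the other down, and the two numbers have equal
      parity, so nothing is lost.\<close>
    then have "(2 * m - card T + 1) div 2 + card T div 2 = m" by presburger
    then show ?thesis by (simp add: K_def that flip: power_add)
  qed
  then show ?thesis using * by auto
qed

text \<open>Duality gives the expansion for every \<open>gen S\<close>. Each
  \<open>b (vsum A)\<close> is a multiple of \<open>gen A\<close> minus the basis vectors of the
  proper subsets of \<open>A\<close>, so induction over subsets extends it to the whole
  space.\<close>

lemma expand_gen: "x = (\<Sum>T\<in>Pow index_set. inner x (dual_gen T) *\<^sub>R gen T)"
proof -
  define P where "P = {x. x = (\<Sum>T\<in>Pow index_set. inner x (dual_gen T) *\<^sub>R gen T)}"
  have sub: "subspace P"
  proof -
    have "c *\<^sub>R x \<in> P" if "x \<in> P" for c x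
    proof -
      have "c *\<^sub>R x = c *\<^sub>R (\<Sum>T\<in>Pow index_set. inner x (dual_gen T) *\<^sub>R gen T)"
        using that unfolding P_def by (intro arg_cong[where f="scaleR c"]) blast
      also have "\<dots> = (\<Sum>T\<in>Pow index_set. inner (c *\<^sub>R x) (dual_gen T) *\<^sub>R gen T)"
        by (simp add: scaleR_sum_right)
      finally show ?thesis unfolding P_def by blast
    qed
    moreover have "x + y \<in> P" if "x \<in> P" "y \<in> P" for x y
      using that unfolding P_def by (simp add: inner_add_left scaleR_add_left sum.distrib)
    moreover have "0 \<in> P" by (simp add: P_def)
    ultimately show ?thesis unfolding subspace_def by blast
  qed
  have gen: "gen S \<in> P" if "S \<subseteq> index_set" for S
  proof -
    have "(\<Sum>T\<in>Pow index_set. inner (gen S) (dual_gen T) *\<^sub>R gen T) = (\<Sum>T\<in>Pow index_set. if T = S then gen T else 0)"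
      by (rule sum.cong) (auto simp: gen_dual_gen that)
    then show ?thesis using that by (simp add: P_def)
  qed
  have b: "b (vsum A) \<in> P" if "finite A" "A \<subseteq> index_set" for A
    using that
  proof (induction A rule: finite_psubset_induct)
    case (psubset A)
    have "twisted 0 0 0 (coord_subspace A) = (\<Sum>B\<in>Pow A. b (vsum B))"
    proof -
      have "twisted 0 0 0 (coord_subspace A) = (\<Sum>u\<in>coord_subspace A. b u)"
        by (rule co_eqI) (simp add: co_sum co_b co_twisted_0 sum.delta if_distrib)
      also have "\<dots> = (\<Sum>B\<in>Pow A. b (vsum B))"
        unfolding coord_subspace_def using psubset.prems
        by (subst sum.reindex) (auto intro: inj_on_subset[OF inj_vsum])
      finally show ?thesis .
    qed
    also have "Pow A = insert A {B. B \<subset> A}" by auto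
    also have "(\<Sum>B\<in>insert A {B. B \<subset> A}. b (vsum B)) = b (vsum A) + (\<Sum>B | B \<subset> A. b (vsum B))"
      using psubset.hyps by (subst sum.insert) (auto intro: finite_subset[of _ "Pow A"])
    finally have "b (vsum A) = twisted 0 0 0 (coord_subspace A) - (\<Sum>B | B \<subset> A. b (vsum B))" by simp
    moreover have "twisted 0 0 0 (coord_subspace A) \<in> P"
    proof -
      have "(1 / 2 ^ ((2 * m - card A + 1) div 2)) *\<^sub>R gen A \<in> P"
        using gen[OF psubset.prems] by (intro subspace_scale[OF sub])
      then show ?thesis by (simp add: gen_def)
    qed
    moreover have "(\<Sum>B | B \<subset> A. b (vsum B)) \<in> P"
      using psubset by (intro subspace_sum[OF sub]) auto
    ultimately show ?case by (simp add: subspace_diff[OF sub])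
  qed
  have "range b \<subseteq> P"
    using b[OF _ idx_subset] finite_subset[OF idx_subset] by auto
  then have "span (range b) \<subseteq> P" by (rule span_minimal) (rule sub)
  then show ?thesis using span_b by (auto simp: P_def)
qed

text \<open>The inner products with \<open>dual_gen\<close> are the coefficients with respect to the
  generators \<open>gen\<close>.\<close>

lemma BW_iff: "x \<in> BW \<longleftrightarrow> (\<forall>T. T \<subseteq> index_set \<longrightarrow> inner x (dual_gen T) \<in> \<int>)"
proof
  assume "x \<in> BW"
  then show "\<forall>T. T \<subseteq> index_set \<longrightarrow> inner x (dual_gen T) \<in> \<int>"
    unfolding BW_int_span
    by (induction rule: int_span_induct) (auto simp: inner_add_left gen_dual_gen)
next
  assume *: "\<forall>T. T \<subseteq> index_set \<longrightarrow> inner x (dual_gen T) \<in> \<int>"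
  have "(\<Sum>T\<in>Pow index_set. inner x (dual_gen T) *\<^sub>R gen T) \<in> BW"
    unfolding BW_int_span
  proof (rule int_span_sum)
    fix T assume T: "T \<in> Pow index_set"
    then have "inner x (dual_gen T) \<in> \<int>" using * by simp
    then obtain k where "inner x (dual_gen T) = of_int k" by (rule Ints_cases)
    then show "inner x (dual_gen T) *\<^sub>R gen T \<in> int_span (gen ` Pow index_set)"
      by (simp only:) (intro int_span_scale int_span_base imageI T)
  qed
  then show "x \<in> BW" using expand_gen[of x] by simp
qed

definition BWd :: "'e set" where "BWd = dual_lattice BW"

lemma gen_in_BW: "T \<subseteq> index_set \<Longrightarrow> gen T \<in> BW"
  unfolding BW_int_span by (auto intro: int_span_base)

lemma BWd_iff: "x \<in> BWd \<longleftrightarrow> (\<forall>T. T \<subseteq> index_set \<longrightarrow> inner x (gen T) \<in> \<int>)"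
proof
  assume "x \<in> BWd"
  then show "\<forall>T. T \<subseteq> index_set \<longrightarrow> inner x (gen T) \<in> \<int>"
    by (auto simp: BWd_def dual_lattice_def gen_in_BW)
next
  assume *: "\<forall>T. T \<subseteq> index_set \<longrightarrow> inner x (gen T) \<in> \<int>"
  have "inner x y \<in> \<int>" if "y \<in> BW" for y
    using that unfolding BW_int_span
    by (induction rule: int_span_induct) (auto simp: inner_add_right *)
  then show "x \<in> BWd" by (auto simp: BWd_def dual_lattice_def)
qed

lemma BW_closed: "x \<in> BW \<Longrightarrow> y \<in> BW \<Longrightarrow> x + y \<in> BW" "x \<in> BW \<Longrightarrow> k \<in> \<int> \<Longrightarrow> k *\<^sub>R x \<in> BW"
  and BWd_closed: "x \<in> BWd \<Longrightarrow> y \<in> BWd \<Longrightarrow> x + y \<in> BWd" "x \<in> BWd \<Longrightarrow> k \<in> \<int> \<Longrightarrow> k *\<^sub>R x \<in> BWd"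
  by (auto simp: BW_iff BWd_iff inner_add_left)

text \<open>Membership is tested against the dual basis, whose members are twisted as well. Here
  \<open>U\<close> ranges over all subgroups and not just coordinate subspaces, which is what lets
  \<open>hadamard\<close> and \<open>\<sigma>\<close> preserve \<open>BW\<close>; the freedom in
  \<open>l\<close> does the same for \<open>cubic\<close>.\<close>

lemma twisted_in_BW:
  assumes U: "subgp U" "card U = 2 ^ r"
  shows "2 ^ ((2 * m - r + 1) div 2) *\<^sub>R twisted l c a U \<in> BW"
  unfolding BW_iff
proof (intro allI impI)
  fix T assume "T \<subseteq> index_set"
  then obtain c' a' where
    eq: "dual_gen T = 2 ^ ((2 * m - (2 * m - card T)) div 2) *\<^sub>R twisted 0 c' a' (coord_subspace (index_set - T))"
    and card: "card (coord_subspace (index_set - T)) = 2 ^ (2 * m - card T)"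
    by (rule dual_gen_twisted)
  show "inner (2 ^ ((2 * m - r + 1) div 2) *\<^sub>R twisted l c a U) (dual_gen T) \<in> \<int>"
    using twisted_inner_Ints[OF U subgp_coord_subspace card, of l c a 0 c' a'] unfolding eq
    by (simp only: inner_scaleR_left inner_scaleR_right mult_ac index_set_finite finite_Diff)
qed

lemma twisted_in_BWd:
  assumes U: "subgp U" "card U = 2 ^ r"
  shows "2 ^ ((2 * m - r) div 2) *\<^sub>R twisted l c a U \<in> BWd"
  unfolding BWd_iff
proof (intro allI impI)
  fix T assume T: "T \<subseteq> index_set"
  then show "inner (2 ^ ((2 * m - r) div 2) *\<^sub>R twisted l c a U) (gen T) \<in> \<int>"
    using twisted_inner_Ints[OF subgp_coord_subspace card_coord_subspace[OF T] U, of 0 0 0 l c a]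
    by (simp add: gen_def inner_commute mult_ac finite_subset)
qed


subsection \<open>Automorphisms of the Barnes-Wall lattice\<close>

lemma twisted_in_BW_le:
  assumes "subgp U" "card U = 2 ^ r" "(2 * m - r + 1) div 2 \<le> k"
  shows "2 ^ k *\<^sub>R twisted l c a U \<in> BW"
proof -
  have "2 ^ k = 2 ^ (k - (2 * m - r + 1) div 2) * (2 ^ ((2 * m - r + 1) div 2) :: real)"
    using assms(3) by (simp flip: power_add)
  then have eq: "2 ^ k *\<^sub>R twisted l c a U
      = 2 ^ (k - (2 * m - r + 1) div 2) *\<^sub>R (2 ^ ((2 * m - r + 1) div 2) *\<^sub>R twisted l c a U)"
    by simp
  show ?thesis unfolding eq by (intro BW_closed(2) twisted_in_BW assms) simp
qed

lemma twisted_in_BWd_le: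
  assumes "subgp U" "card U = 2 ^ r" "(2 * m - r) div 2 \<le> k"
  shows "2 ^ k *\<^sub>R twisted l c a U \<in> BWd"
proof -
  have "2 ^ k = 2 ^ (k - (2 * m - r) div 2) * (2 ^ ((2 * m - r) div 2) :: real)"
    using assms(3) by (simp flip: power_add)
  then have eq: "2 ^ k *\<^sub>R twisted l c a U
      = 2 ^ (k - (2 * m - r) div 2) *\<^sub>R (2 ^ ((2 * m - r) div 2) *\<^sub>R twisted l c a U)"
    by simp
  show ?thesis unfolding eq by (intro BWd_closed(2) twisted_in_BWd assms) simp
qed

lemma subgp_coord: "T \<subseteq> index_set \<Longrightarrow> subgp (coord_subspace T)"
  by (rule subgp_coord_subspace) (rule finite_subset[OF _ index_set_finite])

lemma card_index_le: "T \<subseteq> index_set \<Longrightarrow> card T \<le> 2 * m"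
  using card_mono[of index_set T] by simp

lemma linear_into:
  assumes g: "linear g" and gen: "\<And>T. T \<subseteq> index_set \<Longrightarrow> g (gen T) \<in> L"
    and L: "0 \<in> L" "\<And>x y. x \<in> L \<Longrightarrow> y \<in> L \<Longrightarrow> x + y \<in> L" "\<And>k x. x \<in> L \<Longrightarrow> of_int k *\<^sub>R x \<in> L"
    and x: "x \<in> BW"
  shows "g x \<in> L"
  using x unfolding BW_int_span
proof (induction rule: int_span_induct)
  case zero
  then show ?case by (simp add: linear_0[OF g] L(1))
next
  case (add k x y)
  then show ?case using gen by (auto simp: linear_add[OF g] linear_scale[OF g] intro!: L(2,3))
qed

lemma BW_0: "0 \<in> BW" and BWd_0: "0 \<in> BWd"
  by (simp_all add: BW_iff BWd_iff)

lemma linear_into_BW: "linear g \<Longrightarrow> (\<And>T. T \<subseteq> index_set \<Longrightarrow> g (gen T) \<in> BW) \<Longrightarrow> x \<in> BW \<Longrightarrow> g x \<in> BW"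
  by (rule linear_into) (auto intro: BW_0 BW_closed)

lemma linear_into_BWd: "linear g \<Longrightarrow> (\<And>T. T \<subseteq> index_set \<Longrightarrow> g (gen T) \<in> BWd) \<Longrightarrow> x \<in> BW \<Longrightarrow> g x \<in> BWd"
  by (rule linear_into) (auto intro: BWd_0 BWd_closed)

lemma cubic_BW: "x \<in> BW \<Longrightarrow> cubic l x \<in> BW"
proof (rule linear_into_BW[OF linear_ops(3)])
  fix T assume T: "T \<subseteq> index_set"
  have "cubic l (twisted 0 0 0 U) = twisted l 0 0 U" for U
    by (rule co_eqI) (simp add: co_twisted phase_def)
  then have "cubic l (gen T) = 2 ^ ((2 * m - card T + 1) div 2) *\<^sub>R twisted l 0 0 (coord_subspace T)"
    by (simp add: gen_def linear_scale[OF linear_ops(3)])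
  then show "cubic l (gen T) \<in> BW"
    using twisted_in_BW[OF subgp_coord[OF T] card_coord_subspace[OF T]] by simp
qed

text \<open>The Fourier transform carries the indicator of a subspace to a multiple of that of its
  orthogonal complement, and the power of 2 that results is the one belonging to a subspace of the
  complementary dimension.\<close>

lemma hadamard_BW: "x \<in> BW \<Longrightarrow> hadamard x \<in> BW"
proof (rule linear_into_BW[OF linear_ops(4)])
  fix T assume T: "T \<subseteq> index_set"
  let ?U = "coord_subspace T" and ?r = "card T"
  have U: "subgp ?U" and card: "card ?U = 2 ^ ?r" and r: "?r \<le> 2 * m"
    using T by (simp_all add: subgp_coord card_coord_subspace card_index_le)
  have had: "hadamard (twisted 0 0 0 ?U) = (2 ^ ?r / 2 ^ m) *\<^sub>R twisted 0 0 0 (perp ?U)"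
  proof (rule co_eqI)
    fix u
    have "(\<Sum>w\<in>UNIV. chi (u * w) * co (twisted 0 0 0 ?U) w) = (\<Sum>w\<in>UNIV. if w \<in> ?U then chi (u * w) else 0)"
      by (rule sum.cong) (auto simp: co_twisted_0)
    also have "\<dots> = (\<Sum>w\<in>?U. chi (u * w))"
      by (simp add: sum.If_cases)
    also have "\<dots> = (if u \<in> perp ?U then 2 ^ ?r else 0)"
      by (simp add: sum_chi_subgp[OF U] card perp_def)
    finally show "co (hadamard (twisted 0 0 0 ?U)) u = co ((2 ^ ?r / 2 ^ m) *\<^sub>R twisted 0 0 0 (perp ?U)) u"
      by (simp add: co_twisted_0)
  qed
  have "card (perp ?U) * 2 ^ ?r = 2 ^ (2 * m)"
    using card_perp[OF U] card by (simp add: power_mult)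
  also have "\<dots> = 2 ^ (2 * m - ?r) * 2 ^ ?r"
    using r by (simp flip: power_add)
  finally have card_p: "card (perp ?U) = 2 ^ (2 * m - ?r)" by simp
  have e: "(2 * m - ?r + 1) div 2 + ?r = m + (?r + 1) div 2" using r by presburger
  have "2 ^ ((2 * m - ?r + 1) div 2) * (2 ^ ?r / 2 ^ m) = (2 ^ ((2 * m - ?r + 1) div 2 + ?r) / 2 ^ m :: real)"
    by (simp add: power_add)
  also have "\<dots> = 2 ^ ((?r + 1) div 2)"
    unfolding e by (simp add: power_add)
  finally have "hadamard (gen T) = 2 ^ ((?r + 1) div 2) *\<^sub>R twisted 0 0 0 (perp ?U)"
    by (simp add: gen_def linear_scale[OF linear_ops(4)] had)
  also have "\<dots> \<in> BW"
    by (rule twisted_in_BW_le[OF subgp_perp card_p]) (use r in simp)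
  finally show "hadamard (gen T) \<in> BW" .
qed

text \<open>Multiplication by \<open>\<zeta>\<close> moves a coordinate subspace to another subspace
  of the same dimension, which \<open>twisted_in_BW\<close> also covers.\<close>

lemma \<sigma>_BW: "x \<in> BW \<Longrightarrow> \<sigma> x \<in> BW"
proof (rule linear_into_BW[OF linear_\<sigma>])
  fix T assume T: "T \<subseteq> index_set"
  let ?U = "coord_subspace T"
  have U: "subgp ?U" and card: "card ?U = 2 ^ card T"
    using T by (simp_all add: subgp_coord card_coord_subspace)
  have mem: "u / \<zeta> \<in> ?U \<longleftrightarrow> u \<in> (*) \<zeta> ` ?U" for u
    using zeta_nonzero by (auto simp: image_iff intro!: bexI[of _ "u / \<zeta>"])
  have "\<sigma> (twisted 0 0 0 ?U) = twisted 0 0 0 ((*) \<zeta> ` ?U)"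
    by (rule co_eqI) (simp add: co_twisted_0 mem)
  then have "\<sigma> (gen T) = 2 ^ ((2 * m - card T + 1) div 2) *\<^sub>R twisted 0 0 0 ((*) \<zeta> ` ?U)"
    by (simp add: gen_def linear_scale[OF linear_\<sigma>])
  moreover have "subgp ((*) \<zeta> ` ?U)"
    unfolding subgp_def using U by (auto simp: subgp_0 subgp_add image_iff simp flip: distrib_left)
  moreover have "card ((*) \<zeta> ` ?U) = 2 ^ card T"
    using card zeta_nonzero by (subst card_image) (auto simp: inj_on_def)
  ultimately show "\<sigma> (gen T) \<in> BW" using twisted_in_BW by simp
qed

lemma adjoint_BWd:
  assumes "\<And>x y. inner (g x) y = inner x (g y)" "\<And>x. x \<in> BW \<Longrightarrow> g x \<in> BW" "x \<in> BWd"
  shows "g x \<in> BWd"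
  using assms by (auto simp: BWd_def dual_lattice_def)

text \<open>
  The reason for the trivial action of the extraspecial group on the quotients: either the
  dimension of the support grows by 1, or a factor 2 is gained.
\<close>

lemma shift_diff_twisted:
  assumes U: "subgp U" "card U = 2 ^ r"
  obtains p q V where "p \<in> \<int>" "q \<in> \<int>" "p = 0 \<or> subgp V \<and> card V = 2 ^ (r + 1) \<and> r + 1 \<le> 2 * m"
    "shift a (twisted 0 c a' U) - twisted 0 c a' U = p *\<^sub>R twisted 0 c a' V + (2 * q) *\<^sub>R twisted 0 c a' U"
proof (cases "a \<in> U")
  case True
  have eq: "shift a (twisted 0 c a' U) - twisted 0 c a' U = 0 *\<^sub>R twisted 0 c a' UNIV + (2 * ((chi (c * a) - 1) / 2)) *\<^sub>R twisted 0 c a' U"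
  proof (rule co_eqI)
    fix u
    have "u + a + a' \<in> U \<longleftrightarrow> u + a' \<in> U"
      using subgp_add_iff[OF U(1) True, of "u + a'"] by (simp add: ac_simps)
    then show "co (shift a (twisted 0 c a' U) - twisted 0 c a' U) u
        = co (0 *\<^sub>R twisted 0 c a' UNIV + (2 * ((chi (c * a) - 1) / 2)) *\<^sub>R twisted 0 c a' U) u"
      by (simp add: co_twisted phase_def distrib_left chi_add algebra_simps)
  qed
  have q: "(chi (c * a) - 1) / 2 \<in> \<int>" using chi_cases[of "c * a"] by auto
  show thesis by (rule that[OF Ints_0 q disjI1[OF refl] eq])
next
  case False
  define V where "V = U \<union> {w. w + a \<in> U}"
  have V: "subgp V" "U \<inter> {w. w + a \<in> U} = {}"
    unfolding V_def by (fact subgp_extend[OF U(1) False])+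
  have cV: "card V = 2 ^ (r + 1)"
    unfolding V_def subgp_extend(3)[OF U(1) False] U(2) by simp
  have "card V \<le> CARD('f)" by (rule card_mono) simp_all
  then have "(2::nat) ^ (r + 1) \<le> 2 ^ (2 * m)"
    unfolding cV by (simp only: card_field power_mult) simp
  then have r: "r + 1 \<le> 2 * m" by (rule power_le_imp_le_exp[rotated]) simp
  have eq: "shift a (twisted 0 c a' U) - twisted 0 c a' U
      = chi (c * a) *\<^sub>R twisted 0 c a' V + (2 * (- (chi (c * a) + 1) / 2)) *\<^sub>R twisted 0 c a' U"
  proof (rule co_eqI)
    fix u
    have "u + a' + a = u + a + a'" by (simp only: ac_simps)
    then have disj: "u + a' \<notin> U \<or> u + a + a' \<notin> U" and mem: "u + a' \<in> V \<longleftrightarrow> u + a' \<in> U \<or> u + a + a' \<in> U"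
      using V(2) unfolding V_def by (metis (no_types, lifting) disjoint_iff mem_Collect_eq, metis (no_types, lifting) UnCI UnE mem_Collect_eq)
    show "co (shift a (twisted 0 c a' U) - twisted 0 c a' U) u
        = co (chi (c * a) *\<^sub>R twisted 0 c a' V + (2 * (- (chi (c * a) + 1) / 2)) *\<^sub>R twisted 0 c a' U) u"
      using disj mem
      by (cases "u + a' \<in> U"; cases "u + a + a' \<in> U")
        (simp_all add: co_twisted phase_def distrib_left chi_add algebra_simps)
  qed
  have q: "- (chi (c * a) + 1) / 2 \<in> \<int>" using chi_cases[of "c * a"] by auto
  show thesis by (rule that[OF chi_Ints q _ eq]) (use V(1) cV r in blast)
qed

text \<open>By \<open>shift_diff_twisted\<close> the difference has two parts. The one on the larger
  support, once halved, carries the exponent of the dual lattice in dimension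
  \<open>card T + 1\<close>; in the other the factor 2 cancels.\<close>

lemma shift_diff_BW:
  assumes x: "x \<in> BW" shows "(1 / 2) *\<^sub>R (shift a x - x) \<in> BWd"
proof (rule linear_into_BWd[OF _ _ x])
  show "linear (\<lambda>x. (1 / 2) *\<^sub>R (shift a x - x))"
    by (intro linear_compose_scale_right linear_compose_sub linear_ops linear_id[unfolded id_def])
  fix T assume T: "T \<subseteq> index_set"
  let ?U = "coord_subspace T" and ?k = "(2 * m - card T + 1) div 2"
  have U: "subgp ?U" and card: "card ?U = 2 ^ card T"
    using T by (simp_all add: subgp_coord card_coord_subspace)
  obtain p q V where pq: "p \<in> \<int>" "q \<in> \<int>" and V: "p = 0 \<or> subgp V \<and> card V = 2 ^ (card T + 1) \<and> card T + 1 \<le> 2 * m"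
    and eq: "shift a (twisted 0 0 0 ?U) - twisted 0 0 0 ?U = p *\<^sub>R twisted 0 0 0 V + (2 * q) *\<^sub>R twisted 0 0 0 ?U"
    by (rule shift_diff_twisted[OF U card])
  have "shift a (gen T) - gen T = 2 ^ ?k *\<^sub>R (shift a (twisted 0 0 0 ?U) - twisted 0 0 0 ?U)"
    by (simp add: gen_def linear_scale[OF linear_ops(1)] scaleR_diff_right)
  then have *: "(1 / 2) *\<^sub>R (shift a (gen T) - gen T)
      = p *\<^sub>R ((2 ^ ?k / 2) *\<^sub>R twisted 0 0 0 V) + q *\<^sub>R (2 ^ ?k *\<^sub>R twisted 0 0 0 ?U)"
    unfolding eq by (simp add: scaleR_add_right mult_ac)
  have "2 ^ ?k *\<^sub>R twisted 0 0 0 ?U \<in> BWd"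
    by (rule twisted_in_BWd_le[OF U card]) simp
  moreover have "p *\<^sub>R ((2 ^ ?k / 2) *\<^sub>R twisted 0 0 0 V) \<in> BWd"
  proof (cases "p = 0")
    case False
    then have V: "subgp V" "card V = 2 ^ (card T + 1)" "card T + 1 \<le> 2 * m" using V by auto
    \<comment> \<open>For a positive integer, half of it rounded up exceeds half of its predecessor
      rounded down by 1.\<close>
    have "?k = Suc ((2 * m - (card T + 1)) div 2)" using V(3) by presburger
    then have half: "2 ^ ?k / 2 = (2 ^ ((2 * m - (card T + 1)) div 2) :: real)" by simp
    show ?thesis unfolding half by (intro BWd_closed(2) twisted_in_BWd V pq)
  qed (simp add: BWd_0)
  ultimately show "(1 / 2) *\<^sub>R (shift a (gen T) - gen T) \<in> BWd"
    unfolding * using pq BWd_closed by blast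
qed

text \<open>As \<open>shift a\<close> is self-adjoint, the difference can be moved to the dual
  basis; it then suffices that \<open>shift a (dual_gen T) - dual_gen T\<close> lies in
  \<open>BW\<close>, where \<open>x\<close> pairs integrally.\<close>

lemma shift_diff_BWd:
  assumes x: "x \<in> BWd" shows "shift a x - x \<in> BW"
  unfolding BW_iff
proof (intro allI impI)
  fix T assume T: "T \<subseteq> index_set"
  let ?U = "coord_subspace (index_set - T)" and ?r = "2 * m - card T"
  let ?k = "(2 * m - ?r) div 2"
  obtain c a' where eqd: "dual_gen T = 2 ^ ?k *\<^sub>R twisted 0 c a' ?U" and card: "card ?U = 2 ^ ?r"
    by (rule dual_gen_twisted[OF T])
  have U: "subgp ?U" by (rule subgp_coord) blast
  obtain p q V where pq: "p \<in> \<int>" "q \<in> \<int>" and V: "p = 0 \<or> subgp V \<and> card V = 2 ^ (?r + 1) \<and> ?r + 1 \<le> 2 * m"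
    and eq: "shift a (twisted 0 c a' ?U) - twisted 0 c a' ?U = p *\<^sub>R twisted 0 c a' V + (2 * q) *\<^sub>R twisted 0 c a' ?U"
    by (rule shift_diff_twisted[OF U card])
  have "shift a (dual_gen T) - dual_gen T = 2 ^ ?k *\<^sub>R (shift a (twisted 0 c a' ?U) - twisted 0 c a' ?U)"
    by (simp add: eqd linear_scale[OF linear_ops(1)] scaleR_diff_right)
  then have *: "shift a (dual_gen T) - dual_gen T
      = p *\<^sub>R (2 ^ ?k *\<^sub>R twisted 0 c a' V) + q *\<^sub>R (2 ^ Suc ?k *\<^sub>R twisted 0 c a' ?U)"
    unfolding eq by (simp add: scaleR_add_right mult_ac)
  have "2 ^ Suc ?k *\<^sub>R twisted 0 c a' ?U \<in> BW"
    by (rule twisted_in_BW_le[OF U card]) simp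
  moreover have "p *\<^sub>R (2 ^ ?k *\<^sub>R twisted 0 c a' V) \<in> BW"
  proof (cases "p = 0")
    case False
    then have V: "subgp V" "card V = 2 ^ (?r + 1)" "?r + 1 \<le> 2 * m" using V by auto
    have "(2 * m - (?r + 1) + 1) div 2 \<le> ?k" using V(3) by simp
    then show ?thesis by (intro BW_closed(2) twisted_in_BW_le[OF V(1,2)] pq)
  qed (simp add: BW_0)
  ultimately have "shift a (dual_gen T) - dual_gen T \<in> BW"
    unfolding * using pq BW_closed by blast
  then have "inner x (shift a (dual_gen T) - dual_gen T) \<in> \<int>"
    using x by (auto simp: BWd_def dual_lattice_def)
  then show "inner (shift a x - x) (dual_gen T) \<in> \<int>"
    by (simp add: inner_diff_left inner_diff_right shift_adjoint)
qed

text \<open>The Fourier transform exchanges translations with multiplications by characters, so what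
  holds for \<open>shift\<close> carries over to \<open>modulate\<close>.\<close>

lemma modulate_hadamard: "modulate c x = hadamard (shift c (hadamard x))"
proof -
  have "hadamard (modulate c x) = shift c (hadamard x)"
    by (rule co_eqI) (simp add: distrib_right chi_add mult.assoc)
  then show ?thesis by (metis hadamard_involution)
qed

lemma modulate_diff: "modulate c x - x = hadamard (shift c (hadamard x) - hadamard x)"
  by (simp add: linear_diff[OF linear_ops(4)] modulate_hadamard)

lemma hadamard_BWd: "x \<in> BWd \<Longrightarrow> hadamard x \<in> BWd"
  by (rule adjoint_BWd[OF hadamard_adjoint hadamard_BW])

lemma modulate_diff_BW: "x \<in> BW \<Longrightarrow> (1 / 2) *\<^sub>R (modulate c x - x) \<in> BWd"
  unfolding modulate_diff linear_scale[OF linear_ops(4), symmetric]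
  by (intro hadamard_BWd shift_diff_BW hadamard_BW)

lemma modulate_diff_BWd: "x \<in> BWd \<Longrightarrow> modulate c x - x \<in> BW"
  unfolding modulate_diff by (intro hadamard_BWd shift_diff_BWd hadamard_BW)

lemma BW_subset_BWd: "BW \<subseteq> BWd"
proof
  fix x assume "x \<in> BW"
  moreover have "gen T \<in> BWd" if "T \<subseteq> index_set" for T
    unfolding gen_def by (rule twisted_in_BWd_le[OF subgp_coord[OF that] card_coord_subspace[OF that]]) simp
  ultimately show "x \<in> BWd"
    using linear_into_BWd[of "\<lambda>x. x"] linear_id[unfolded id_def] by blast
qed

text \<open>The image of a vector of \<open>BW\<close> differs from it by an element of
  \<open>twice_dual BW\<close>, which is contained in \<open>\<Gamma>\<close>.\<close>

lemma lattice_plus_invariant: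
  assumes "\<Gamma> \<in> L_plus BW \<sigma>" and x: "x \<in> \<Gamma>"
  shows "shift a x \<in> \<Gamma>" "modulate c x \<in> \<Gamma>"
proof -
  have "is_lattice \<Gamma>" "twice_dual BW \<subseteq> \<Gamma>" "\<Gamma> \<subseteq> BW" using assms by (auto simp: L_plus_def)
  then have "x + 2 *\<^sub>R y \<in> \<Gamma>" if "y \<in> BWd" for y
    using that x by (auto simp: is_lattice_def twice_dual_def BWd_def intro!: int_span_add)
  moreover have "x \<in> BW" using x \<open>\<Gamma> \<subseteq> BW\<close> by blast
  ultimately show "shift a x \<in> \<Gamma>" "modulate c x \<in> \<Gamma>"
    using shift_diff_BW[of x a] modulate_diff_BW[of x c] by force+
qed

text \<open>The image of a vector of the dual lattice differs from it by an element of
  \<open>BW\<close>, which is contained in \<open>\<Lambda>\<close>.\<close>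

lemma lattice_minus_invariant:
  assumes "\<Lambda> \<in> L_minus BW \<sigma>" and x: "x \<in> \<Lambda>"
  shows "shift a x \<in> \<Lambda>" "modulate c x \<in> \<Lambda>"
proof -
  have "is_lattice \<Lambda>" "BW \<subseteq> \<Lambda>" "\<Lambda> \<subseteq> BWd" using assms by (auto simp: L_minus_def BWd_def)
  then have "x + y \<in> \<Lambda>" if "y \<in> BW" for y
    using that x by (auto simp: is_lattice_def intro!: int_span_add)
  moreover have "x \<in> BWd" using x \<open>\<Lambda> \<subseteq> BWd\<close> by blast
  ultimately show "shift a x \<in> \<Lambda>" "modulate c x \<in> \<Lambda>"
    using shift_diff_BWd[of x a] modulate_diff_BWd[of x c] by force+
qed

section \<open>Finiteness of the layers\<close>

lemma gen_separates:
  assumes "\<And>T. T \<subseteq> index_set \<Longrightarrow> inner x (gen T) = inner y (gen T)"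
  shows "x = y"
proof -
  have "inner (x - y) (x - y) = inner (x - y) (\<Sum>T\<in>Pow index_set. inner (x - y) (dual_gen T) *\<^sub>R gen T)"
    by (subst (2) expand_gen) (rule refl)
  also have "\<dots> = 0" using assms by (simp add: inner_sum_right inner_diff_left)
  finally show ?thesis by simp
qed

text \<open>A vector is determined by its inner products with the generators; these are integers,
  bounded by the Cauchy-Schwarz inequality.\<close>

lemma finite_layer_BWd: "finite (layer BWd d)"
proof -
  let ?f = "\<lambda>x. \<lambda>T\<in>Pow index_set. inner x (gen T)"
  have "inj_on ?f (layer BWd d)"
  proof (rule inj_onI)
    fix x y assume "?f x = ?f y"
    then have "inner x (gen T) = inner y (gen T)" if "T \<subseteq> index_set" for T
      using that by (metis PowI restrict_apply')
    then show "x = y" by (rule gen_separates)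
  qed
  moreover have "?f ` layer BWd d \<subseteq> (\<Pi>\<^sub>E T\<in>Pow index_set. {k \<in> \<int>. \<bar>k\<bar> \<le> sqrt d * norm (gen T)})"
  proof (intro image_subsetI)
    fix x assume "x \<in> layer BWd d"
    then have x: "x \<in> BWd" "norm x = sqrt d" by (auto simp: layer_def norm_eq_sqrt_inner)
    show "?f x \<in> (\<Pi>\<^sub>E T\<in>Pow index_set. {k \<in> \<int>. \<bar>k\<bar> \<le> sqrt d * norm (gen T)})"
      using x(1) Cauchy_Schwarz_ineq2[of x] unfolding x(2)[symmetric] BWd_iff by auto
  qed
  moreover have "finite (\<Pi>\<^sub>E T\<in>Pow index_set. {k \<in> \<int>. \<bar>k\<bar> \<le> sqrt d * norm (gen T)})"
    by (intro finite_PiE finite_abs_int_segment) simp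
  ultimately show ?thesis by (meson finite_imageD finite_subset)
qed

end

section \<open>The largest normal 2-subgroup\<close>

text \<open>The fibre of the multiplication map over \<open>n \<otimes> k\<close> consists of the
  pairs \<open>(n \<otimes> x, inv x \<otimes> k)\<close> with \<open>x\<close> in
  \<open>N \<inter> M\<close>.\<close>

lemma (in group) card_set_mult:
  assumes fin: "finite (carrier G)" and N: "subgroup N G" and M: "subgroup M G"
  shows "card (N <#> M) * card (N \<inter> M) = card N * card M"
proof -
  have sub: "N \<subseteq> carrier G" "M \<subseteq> carrier G" using N M by (simp_all add: subgroup.subset)
  then have fins: "finite N" "finite M" using fin by (simp_all add: finite_subset)
  have fib: "card {p \<in> N \<times> M. fst p \<otimes> snd p = z} = card (N \<inter> M)" if z: "z \<in> N <#> M" for z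
  proof -
    obtain n k where nk: "n \<in> N" "k \<in> M" "z = n \<otimes> k" using z by (auto simp: set_mult_def)
    have "bij_betw (\<lambda>x. (n \<otimes> x, inv x \<otimes> k)) (N \<inter> M) {p \<in> N \<times> M. fst p \<otimes> snd p = z}"
    proof (rule bij_betw_byWitness[where f'="\<lambda>p. inv n \<otimes> fst p"])
      have c: "n \<in> carrier G" "k \<in> carrier G" using nk sub by auto
      have pair: "x \<in> N" "y \<in> M" "x \<otimes> y = n \<otimes> k" "x \<in> carrier G" "y \<in> carrier G"
        if "(x, y) \<in> {p \<in> N \<times> M. fst p \<otimes> snd p = z}" for x y
        using that sub nk(3) by auto
      show "\<forall>x\<in>N \<inter> M. inv n \<otimes> fst (n \<otimes> x, inv x \<otimes> k) = x"
        using c sub by (auto simp: m_assoc[symmetric] subsetD)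
      show "\<forall>p\<in>{p \<in> N \<times> M. fst p \<otimes> snd p = z}. (n \<otimes> (inv n \<otimes> fst p), inv (inv n \<otimes> fst p) \<otimes> k) = p"
      proof
        fix p assume p: "p \<in> {p \<in> N \<times> M. fst p \<otimes> snd p = z}"
        obtain x y where xy: "p = (x, y)" by (cases p)
        note xyc = pair[OF p[unfolded xy]]
        have "inv (inv n \<otimes> x) \<otimes> k = inv x \<otimes> (x \<otimes> y)"
          unfolding xyc(3) using c xyc(4) by (simp add: inv_mult_group m_assoc)
        also have "\<dots> = y" using xyc(4,5) by (simp add: m_assoc[symmetric])
        finally have 1: "inv (inv n \<otimes> x) \<otimes> k = y" .
        have "n \<otimes> (inv n \<otimes> x) = x" using c xyc(4) by (simp add: m_assoc[symmetric])
        then show "(n \<otimes> (inv n \<otimes> fst p), inv (inv n \<otimes> fst p) \<otimes> k) = p"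
          using 1 by (simp add: xy)
      qed
      show "(\<lambda>x. (n \<otimes> x, inv x \<otimes> k)) ` (N \<inter> M) \<subseteq> {p \<in> N \<times> M. fst p \<otimes> snd p = z}"
      proof (rule image_subsetI)
        fix x assume x: "x \<in> N \<inter> M"
        then have xc: "x \<in> carrier G" using sub by auto
        have "x \<otimes> (inv x \<otimes> k) = k" using c xc by (simp add: m_assoc[symmetric])
        then have "n \<otimes> x \<otimes> (inv x \<otimes> k) = z" using c xc nk(3) by (simp add: m_assoc)
        then show "(n \<otimes> x, inv x \<otimes> k) \<in> {p \<in> N \<times> M. fst p \<otimes> snd p = z}"
          using x nk N M by (simp add: subgroup.m_closed subgroup.m_inv_closed)
      qed
      show "(\<lambda>p. inv n \<otimes> fst p) ` {p \<in> N \<times> M. fst p \<otimes> snd p = z} \<subseteq> N \<inter> M"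
      proof (rule image_subsetI)
        fix p assume p: "p \<in> {p \<in> N \<times> M. fst p \<otimes> snd p = z}"
        obtain x y where xy: "p = (x, y)" by (cases p)
        note xyc = pair[OF p[unfolded xy]]
        have "inv n \<otimes> x = inv n \<otimes> (x \<otimes> y) \<otimes> inv y" using c xyc(4,5) by (simp add: m_assoc)
        also have "\<dots> = k \<otimes> inv y" unfolding xyc(3) using c xyc(5) by (simp add: m_assoc[symmetric])
        finally have "inv n \<otimes> x \<in> M"
          using subgroup.m_closed[OF M nk(2) subgroup.m_inv_closed[OF M xyc(2)]] by simp
        moreover have "inv n \<otimes> x \<in> N"
          by (rule subgroup.m_closed[OF N subgroup.m_inv_closed[OF N nk(1)] xyc(1)])
        ultimately show "inv n \<otimes> fst p \<in> N \<inter> M" by (simp add: xy)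
      qed
    qed
    then show ?thesis by (simp add: bij_betw_same_card)
  qed
  have "card N * card M = card (N \<times> M)" by (simp add: card_cartesian_product)
  also have "N \<times> M = (\<Union>z\<in>N <#> M. {p \<in> N \<times> M. fst p \<otimes> snd p = z})"
    by (auto simp: set_mult_def) blast
  also have "card \<dots> = (\<Sum>z\<in>N <#> M. card {p \<in> N \<times> M. fst p \<otimes> snd p = z})"
    using fins by (intro card_UN_disjoint) (auto intro: finite_subset[OF set_mult_closed[OF sub]] fin)
  also have "\<dots> = card (N <#> M) * card (N \<inter> M)" by (simp add: fib)
  finally show ?thesis ..
qed

text \<open>A normal 2-subgroup \<open>N\<close> of maximal order contains every other such
  \<open>M\<close>, because the product of the two is again a normal 2-subgroup. Hence a greatest
  one exists and \<open>GREATEST\<close> denotes it.\<close>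

lemma O2_normal:
  assumes "group G" and fin: "finite (carrier G)"
  shows "O2 G \<lhd> G"
proof -
  interpret group G by fact
  define P where "P N \<longleftrightarrow> N \<lhd> G \<and> (\<exists>k. card N = 2 ^ k)" for N
  have one: "P {\<one>\<^bsub>G\<^esub>}" unfolding P_def by (intro conjI one_is_normal exI[of _ 0]) simp
  have bdd: "card N \<le> card (carrier G)" if "P N" for N
  proof -
    have "subgroup N G" using that by (simp add: P_def normal_imp_subgroup)
    then show ?thesis by (intro card_mono fin subgroup.subset)
  qed
  have "\<exists>N. P N \<and> (\<forall>M. P M \<longrightarrow> card M \<le> card N)"
    by (rule ex_has_greatest_nat[where P=P and f=card and b="Suc (card (carrier G))", OF one])
      (simp add: bdd less_Suc_eq_le)
  then obtain N where N: "P N" and max: "\<And>M. P M \<Longrightarrow> card M \<le> card N" by blast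
  have greatest: "M \<subseteq> N" if M: "P M" for M
  proof -
    obtain i j where ij: "card N = 2 ^ i" "card M = 2 ^ j" using M N by (auto simp: P_def)
    have NM: "N \<lhd> G" "M \<lhd> G" and sub: "subgroup N G" "subgroup M G"
      using M N by (auto simp: P_def normal_imp_subgroup)
    have "card (N <#>\<^bsub>G\<^esub> M) dvd 2 ^ (i + j)"
      using card_set_mult[OF fin sub] by (metis dvd_triv_left ij power_add)
    then have "\<exists>k. card (N <#>\<^bsub>G\<^esub> M) = 2 ^ k"
      by (metis divides_primepow_nat two_is_prime_nat)
    moreover have "N <#>\<^bsub>G\<^esub> M \<lhd> G" by (rule normal_subgroup_set_mult_closed[OF NM])
    ultimately have "card (N <#>\<^bsub>G\<^esub> M) \<le> card N" by (intro max) (simp add: P_def)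
    moreover have "N \<subseteq> N <#>\<^bsub>G\<^esub> M" "M \<subseteq> N <#>\<^bsub>G\<^esub> M"
    proof -
      show "N \<subseteq> N <#>\<^bsub>G\<^esub> M"
      proof
        fix x assume "x \<in> N"
        then show "x \<in> N <#>\<^bsub>G\<^esub> M"
          unfolding set_mult_def using subgroup.mem_carrier[OF sub(1)] subgroup.one_closed[OF sub(2)]
          by (intro UN_I[of x] UN_I[of "\<one>\<^bsub>G\<^esub>"]) auto
      qed
      show "M \<subseteq> N <#>\<^bsub>G\<^esub> M"
      proof
        fix x assume "x \<in> M"
        then show "x \<in> N <#>\<^bsub>G\<^esub> M"
          unfolding set_mult_def using subgroup.mem_carrier[OF sub(2)] subgroup.one_closed[OF sub(1)]
          by (intro UN_I[of "\<one>\<^bsub>G\<^esub>"] UN_I[of x]) auto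
      qed
    qed
    moreover have "finite (N <#>\<^bsub>G\<^esub> M)"
      by (rule finite_subset[OF set_mult_closed fin]) (intro subgroup.subset sub)+
    ultimately have "N <#>\<^bsub>G\<^esub> M = N" by (metis card_seteq)
    then show ?thesis using \<open>M \<subseteq> N <#>\<^bsub>G\<^esub> M\<close> by simp
  qed
  have "O2 G = N"
    unfolding O2_def by (rule Greatest_equality) (use N greatest in \<open>auto simp: P_def\<close>)
  then show ?thesis using N by (simp add: P_def)
qed

text \<open>Conjugation by \<open>g\<close> sends the generators into the generated subgroup, by
  normality of \<open>N\<close> and by \<open>conj\<close>. As \<open>g\<close> is its own inverse,
  the resulting inclusion is an equality.\<close>

lemma (in group) involution_in_normalizer_generate:
  assumes N: "N \<lhd> G" and h: "h \<in> carrier G" and g: "g \<in> carrier G" "g \<otimes> g = \<one>"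
    and conj: "g \<otimes> h \<otimes> g \<in> generate G (N \<union> {h})"
  shows "g \<in> normalizer G (generate G (N \<union> {h}))"
proof -
  let ?H = "generate G (N \<union> {h})"
  have NC: "N \<subseteq> carrier G" using N by (simp add: normal_imp_subgroup subgroup.subset)
  then have H: "subgroup ?H G" using h by (intro generate_is_subgroup) auto
  have inv_g: "inv g = g" using g by (simp add: inv_equality)
  have closed: "g \<otimes> x \<otimes> g \<in> ?H" if "x \<in> ?H" for x
    using that
  proof (induction rule: generate.induct)
    case one
    then show ?case using g by (simp add: generate.one)
  next
    case (incl x)
    then show ?case
      using normal.inv_op_closed2[OF N g(1), of x] conj inv_g by (auto intro: generate.incl)
  next
    case (inv x)
    then have x: "x \<in> carrier G" using NC h by auto
    have "g \<otimes> x \<otimes> g \<in> ?H"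
      using inv normal.inv_op_closed2[OF N g(1), of x] conj inv_g by (auto intro: generate.incl)
    then have "inv (g \<otimes> x \<otimes> g) \<in> ?H" by (rule subgroup.m_inv_closed[OF H])
    then show ?case using x g inv_g by (simp add: inv_mult_group m_assoc)
  next
    case (eng x y)
    have c: "x \<in> carrier G" "y \<in> carrier G" using eng(1,2) subgroup.mem_carrier[OF H] by auto
    have "(g \<otimes> x \<otimes> g) \<otimes> (g \<otimes> y \<otimes> g) = g \<otimes> x \<otimes> (g \<otimes> g) \<otimes> (y \<otimes> g)"
      using c g(1) by (simp add: m_assoc)
    also have "\<dots> = g \<otimes> (x \<otimes> y) \<otimes> g" using c g by (simp add: m_assoc)
    finally show ?case using generate.eng[OF eng(3,4)] by simp
  qed
  have eq: "g <# ?H #> inv g = (\<lambda>x. g \<otimes> x \<otimes> g) ` ?H"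
    by (auto simp: l_coset_def r_coset_def inv_g)
  have "(\<lambda>x. g \<otimes> x \<otimes> g) ` ?H = ?H"
  proof (intro equalityI subsetI)
    fix x assume x: "x \<in> ?H"
    then have "x \<in> carrier G" using subgroup.mem_carrier[OF H] by blast
    then have "x = g \<otimes> (g \<otimes> x \<otimes> g) \<otimes> g"
      using g by (metis (no_types, lifting) l_one m_assoc m_closed r_one)
    then show "x \<in> (\<lambda>x. g \<otimes> x \<otimes> g) ` ?H" using closed[OF x] by blast
  qed (use closed in blast)
  then show ?thesis
    using g(1) subgroup.subset[OF H] eq by (simp add: normalizer_def stabilizer_def)
qed

section \<open>The automorphism group of the lattice and elements of \<open>U_group\<close>\<close>

context barnes_wall_setup
begin

lemma Aut_group: "group (Aut_lattice BW)"
proof (rule groupI)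
  fix g assume "g \<in> carrier (Aut_lattice BW)"
  then have g: "orthogonal_transformation g" "g ` BW = BW" by (auto simp: Aut_lattice_def)
  have "inv_into UNIV g \<circ> g = id" using orthogonal_transformation_inj[OF g(1)] by simp
  moreover have "inv_into UNIV g ` BW = BW"
    using g(2) orthogonal_transformation_inj[OF g(1)] by (metis image_inv_f_f)
  ultimately show "\<exists>h\<in>carrier (Aut_lattice BW). h \<otimes>\<^bsub>Aut_lattice BW\<^esub> g = \<one>\<^bsub>Aut_lattice BW\<^esub>"
    using orthogonal_transformation_inv[OF g(1)] by (auto simp: Aut_lattice_def)
next
  fix g h assume "g \<in> carrier (Aut_lattice BW)" "h \<in> carrier (Aut_lattice BW)"
  then have gh: "orthogonal_transformation g" "g ` BW = BW" "orthogonal_transformation h" "h ` BW = BW"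
    by (auto simp: Aut_lattice_def)
  have "(g \<circ> h) ` BW = BW" by (simp only: image_comp[symmetric] gh)
  then show "g \<otimes>\<^bsub>Aut_lattice BW\<^esub> h \<in> carrier (Aut_lattice BW)"
    using orthogonal_transformation_compose[OF gh(1,3)] by (simp add: Aut_lattice_def)
qed (auto simp: Aut_lattice_def id_def)

lemma involution_Aut:
  assumes "orthogonal_transformation g" "\<And>x. x \<in> BW \<Longrightarrow> g x \<in> BW" "\<And>x. g (g x) = x"
  shows "g \<in> carrier (Aut_lattice BW)"
proof -
  have "g ` BW = BW"
  proof (intro equalityI subsetI)
    fix x assume "x \<in> BW"
    then show "x \<in> g ` BW" using assms(2,3) by (intro image_eqI[of _ _ "g x"]) auto
  qed (use assms(2) in auto)
  then show ?thesis using assms(1) by (simp add: Aut_lattice_def)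
qed

lemma \<sigma>_pow: "co ((\<sigma> ^^ k) x) u = co x (u / \<zeta> ^ k)"
  by (induction k arbitrary: u) (simp_all add: field_simps)

text \<open>Multiplication by \<open>\<zeta>\<close> permutes the nonzero elements, so it leaves
  their product unchanged.\<close>

lemma zeta_order: "\<zeta> ^ (4 ^ m - 1) = 1"
proof -
  have "(\<Prod>x\<in>UNIV - {0}. \<zeta> * x) = (\<Prod>x\<in>UNIV - {0::'f}. x)"
    by (rule prod.reindex_bij_witness[where i="\<lambda>x. x / \<zeta>" and j="\<lambda>x. \<zeta> * x"])
      (auto simp: zeta_nonzero)
  then have "\<zeta> ^ (CARD('f) - 1) * (\<Prod>x\<in>UNIV - {0::'f}. x) = (\<Prod>x\<in>UNIV - {0::'f}. x)"
    by (simp add: prod.distrib card_Diff_singleton)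
  moreover have "(\<Prod>x\<in>UNIV - {0::'f}. x) \<noteq> 0" by simp
  ultimately show ?thesis by (simp add: card_field)
qed

text \<open>Since \<open>\<sigma>\<close> has finite order, a preimage of a lattice vector is its
  image under a power of \<open>\<sigma>\<close>.\<close>

lemma \<sigma>_Aut: "\<sigma> \<in> carrier (Aut_lattice BW)"
proof -
  have pow: "(\<sigma> ^^ k) x \<in> BW" if "x \<in> BW" for k x
    using that by (induction k) (auto intro: \<sigma>_BW)
  have "x \<in> \<sigma> ` BW" if "x \<in> BW" for x
  proof -
    have "(4::nat) ^ 1 \<le> 4 ^ m" by (rule power_increasing[OF m_ge_1]) simp
    then obtain k where k: "(4::nat) ^ m - 1 = Suc k" by (cases "(4::nat) ^ m - 1") auto
    have "\<sigma> ((\<sigma> ^^ k) x) = (\<sigma> ^^ (4 ^ m - 1)) x" by (simp only: k funpow.simps comp_apply)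
    also have "\<dots> = x" by (rule co_eqI) (simp only: \<sigma>_pow zeta_order div_by_1)
    finally show ?thesis using pow[OF that, of k] by (metis imageI)
  qed
  then have "\<sigma> ` BW = BW" using \<sigma>_BW by blast
  then show ?thesis using orthogonal_\<sigma> by (simp add: Aut_lattice_def)
qed

lemma \<eta>_Aut: "\<eta> \<in> carrier (Aut_lattice BW)"
proof -
  interpret group "Aut_lattice BW" by (rule Aut_group)
  have "\<sigma> ^^ k \<in> carrier (Aut_lattice BW)" for k
  proof (induction k)
    case 0
    then show ?case using one_closed by (simp add: Aut_lattice_def)
  next
    case (Suc k)
    have "\<sigma> \<otimes>\<^bsub>Aut_lattice BW\<^esub> (\<sigma> ^^ k) = \<sigma> ^^ Suc k" by (simp add: Aut_lattice_def)
    then show ?case using m_closed[OF \<sigma>_Aut Suc] by metis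
  qed
  then show ?thesis by (simp add: \<eta>_eq)
qed

text \<open>The cube root of unity by which \<open>\<eta>\<close> multiplies the indices of the
  basis \<open>b\<close>.\<close>

definition \<omega> :: 'f where "\<omega> = \<zeta> ^ ((4 ^ m - 1) div 3)"

lemma co_\<eta>: "co (\<eta> x) u = co x (u / \<omega>)"
  by (simp add: \<eta>_eq \<sigma>_pow \<omega>_def)

lemma \<omega>_cube: "\<omega> ^ 3 = 1"
proof -
  \<comment> \<open>Powers of 4 are 1 modulo 3, so the division in the exponent of
    \<open>\<omega>\<close> is exact.\<close>
  have "\<exists>j. (4::nat) ^ k = 3 * j + 1" for k
  proof (induction k)
    case (Suc k)
    then obtain j where "(4::nat) ^ k = 3 * j + 1" by blast
    then have "(4::nat) ^ Suc k = 3 * (4 * j + 1) + 1" by simp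
    then show ?case by blast
  qed simp
  then obtain j where "(4::nat) ^ m = 3 * j + 1" by blast
  then have "3 dvd (4::nat) ^ m - 1" by simp
  then have "(4 ^ m - 1) div 3 * 3 = (4::nat) ^ m - 1" by (rule dvd_div_mult_self)
  then show ?thesis unfolding \<omega>_def by (simp only: zeta_order flip: power_mult)
qed

lemma \<omega>_nonzero: "\<omega> \<noteq> 0" by (simp add: \<omega>_def zeta_nonzero)

lemma cubic_\<eta>: "cubic l (\<eta> (cubic l x)) = \<eta> x"
proof (rule co_eqI)
  fix u
  have "(u / \<omega>)^3 = u^3" by (simp add: power_divide \<omega>_cube)
  then show "co (cubic l (\<eta> (cubic l x))) u = co (\<eta> x) u" by (simp add: co_\<eta>)
qed

text \<open>Replacing \<open>w\<close> by \<open>\<omega> * w\<close> absorbs both factors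
  \<open>\<omega>\<close>. As \<open>hadamard\<close> is an involution, it therefore conjugates
  \<open>\<eta>\<close> to its inverse.\<close>

lemma hadamard_\<eta>: "\<eta> (hadamard (\<eta> x)) = hadamard x"
proof (rule co_eqI)
  fix u
  have "(\<Sum>w\<in>UNIV. chi (u / \<omega> * w) * co x (w / \<omega>)) = (\<Sum>w\<in>UNIV. chi (u * w) * co x w)"
    by (rule sum.reindex_bij_witness[where i="\<lambda>w. \<omega> * w" and j="\<lambda>w. w / \<omega>"]) (auto simp: \<omega>_nonzero)
  then show "co (\<eta> (hadamard (\<eta> x))) u = co (hadamard x) u" by (simp add: co_\<eta>)
qed

text \<open>An automorphism is determined by the images of the generators, which stay in finite
  layers. Finiteness is what \<open>O2_normal\<close> asks for.\<close>

lemma finite_Aut: "finite (carrier (Aut_lattice BW))"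
proof -
  let ?r = "\<lambda>g. restrict g (gen ` Pow index_set)"
  have "inj_on ?r (carrier (Aut_lattice BW))"
  proof (rule inj_onI, rule ext)
    fix g h x assume g: "g \<in> carrier (Aut_lattice BW)" and h: "h \<in> carrier (Aut_lattice BW)" and eq: "?r g = ?r h"
    have lin: "linear g" "linear h"
      using g h by (auto simp: Aut_lattice_def orthogonal_transformation_linear)
    have same: "g (gen T) = h (gen T)" if "T \<in> Pow index_set" for T
      using that eq by (metis imageI restrict_apply')
    have "g x = g (\<Sum>T\<in>Pow index_set. inner x (dual_gen T) *\<^sub>R gen T)"
      by (subst expand_gen) (rule refl)
    also have "\<dots> = h (\<Sum>T\<in>Pow index_set. inner x (dual_gen T) *\<^sub>R gen T)"
      by (simp add: linear_sum[OF lin(1)] linear_sum[OF lin(2)] linear_scale[OF lin(1)] linear_scale[OF lin(2)] same)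
    also have "\<dots> = h x" by (subst (2) expand_gen) (rule refl)
    finally show "g x = h x" .
  qed
  moreover have "?r ` carrier (Aut_lattice BW) \<subseteq> (\<Pi>\<^sub>E x\<in>gen ` Pow index_set. layer BWd (inner x x))"
  proof (intro image_subsetI PiE_I)
    fix g x assume g: "g \<in> carrier (Aut_lattice BW)" and x: "x \<in> gen ` Pow index_set"
    then have "x \<in> BW" using gen_in_BW by auto
    then have "g x \<in> BW" "inner (g x) (g x) = inner x x"
      using g by (auto simp: Aut_lattice_def orthogonal_transformation_def)
    then show "?r g x \<in> layer BWd (inner x x)"
      using BW_subset_BWd x by (auto simp: layer_def)
  qed simp
  moreover have "finite (\<Pi>\<^sub>E x\<in>gen ` Pow index_set. layer BWd (inner x x))"
    by (intro finite_PiE finite_layer_BWd) simp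
  ultimately show ?thesis by (meson finite_imageD finite_subset)
qed

text \<open>The two alternatives say that \<open>g\<close> centralises or inverts
  \<open>\<eta>\<close>; either way the conjugate of \<open>\<eta>\<close> stays in the subgroup
  being normalised.\<close>

lemma involution_in_U_group:
  assumes g: "g \<in> carrier (Aut_lattice BW)" "\<And>x. g (g x) = x"
    and conj: "g \<circ> \<eta> \<circ> g = \<eta> \<or> \<eta> \<circ> (g \<circ> \<eta> \<circ> g) = id"
  shows "g \<in> U_group BW \<eta>"
proof -
  let ?G = "Aut_lattice BW"
  interpret group ?G by (rule Aut_group)
  have ops: "x \<otimes>\<^bsub>?G\<^esub> y = x \<circ> y" "\<one>\<^bsub>?G\<^esub> = id" for x y by (simp_all add: Aut_lattice_def)
  have N: "O2 ?G \<lhd> ?G" by (rule O2_normal[OF Aut_group finite_Aut])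
  have gg: "g \<otimes>\<^bsub>?G\<^esub> g = \<one>\<^bsub>?G\<^esub>" using g(2) by (auto simp: ops)
  have "g \<otimes>\<^bsub>?G\<^esub> \<eta> \<otimes>\<^bsub>?G\<^esub> g \<in> generate ?G (O2 ?G \<union> {\<eta>})"
    using conj
  proof
    assume "g \<circ> \<eta> \<circ> g = \<eta>"
    then show ?thesis by (simp add: ops generate.incl)
  next
    assume "\<eta> \<circ> (g \<circ> \<eta> \<circ> g) = id"
    then have "\<eta> \<otimes>\<^bsub>?G\<^esub> (g \<otimes>\<^bsub>?G\<^esub> \<eta> \<otimes>\<^bsub>?G\<^esub> g) = \<one>\<^bsub>?G\<^esub>" by (simp only: ops)
    then have "inv\<^bsub>?G\<^esub> \<eta> = g \<otimes>\<^bsub>?G\<^esub> \<eta> \<otimes>\<^bsub>?G\<^esub> g"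
      using g(1) \<eta>_Aut by (metis inv_equality inv_comm m_closed)
    moreover have "inv\<^bsub>?G\<^esub> \<eta> \<in> generate ?G (O2 ?G \<union> {\<eta>})" by (intro generate.inv) simp
    ultimately show ?thesis by simp
  qed
  then show ?thesis
    unfolding U_group_def Let_def by (rule involution_in_normalizer_generate[OF N \<eta>_Aut g(1) gg])
qed

lemma cubic_U_group: "cubic l \<in> U_group BW \<eta>"
  by (intro involution_in_U_group involution_Aut orthogonal_ops cubic_BW disjI1 ext)
    (simp_all add: cubic_\<eta>)

lemma hadamard_U_group: "hadamard \<in> U_group BW \<eta>"
  by (intro involution_in_U_group involution_Aut orthogonal_ops hadamard_BW disjI2 ext)
    (simp_all add: hadamard_\<eta>)

end

lemma sum_rotate: "(\<Sum>c\<in>C. \<Sum>u\<in>A. \<Sum>d\<in>B. f c u d) = (\<Sum>u\<in>A. \<Sum>d\<in>B. \<Sum>c\<in>C. f c u d)"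
  by (subst sum.swap, rule sum.cong[OF refl], rule sum.swap)

context barnes_wall_setup
begin

subsection \<open>Moments of invariant means up to degree four\<close>

text \<open>Negation kills the odd moments, \<open>shift\<close> and \<open>modulate\<close>
  restrict the even ones, and \<open>cubic\<close>, \<open>hadamard\<close> and
  \<open>\<sigma>\<close> connect all nonzero isotropic pairs.\<close>

definition symmetries :: "('e \<Rightarrow> 'e) set" where
  "symmetries = range shift \<union> range modulate \<union> range cubic \<union> {hadamard, \<sigma>, uminus}"

lemma symmetries_orthogonal: "g \<in> symmetries \<Longrightarrow> orthogonal_transformation g"
  using orthogonal_ops orthogonal_\<sigma> orthogonal_transformation_neg[of "\<lambda>x. x"]
  by (auto simp: symmetries_def)

lemma continuous_co [continuous_intros]: "continuous_on S (\<lambda>x. co x u)"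
  unfolding co_def by (intro continuous_intros)

text \<open>
  \<open>corr a c x\<close> is the inner product of \<open>x\<close> with its image under the element of the
  extraspecial group that corresponds to the pair \<open>(a, c)\<close>; this element squares to 1 if and
  only if \<open>chi (a * c) = 1\<close>.
\<close>

definition corr :: "'f \<Rightarrow> 'f \<Rightarrow> 'e \<Rightarrow> real" where
  "corr a c x = (\<Sum>u\<in>UNIV. chi (c * u) * co x (u + a) * co x u) / 2 ^ m"

lemma continuous_corr [continuous_intros]: "continuous_on S (corr a c)"
  unfolding corr_def[abs_def] by (intro continuous_intros) auto

lemma corr_\<sigma>: "corr a c (\<sigma> x) = corr (a / \<zeta>) (c * \<zeta>) x"
proof -
  have "(\<Sum>u\<in>UNIV. chi (c * u) * co x ((u + a) / \<zeta>) * co x (u / \<zeta>))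
      = (\<Sum>w\<in>UNIV. chi (c * \<zeta> * w) * co x (w + a / \<zeta>) * co x w)"
  proof (rule sum.reindex_bij_witness[where i="\<lambda>w. \<zeta> * w" and j="\<lambda>u. u / \<zeta>"])
    fix u
    have "c * \<zeta> * (u / \<zeta>) = c * u" using zeta_nonzero by simp
    then show "chi (c * \<zeta> * (u / \<zeta>)) * co x (u / \<zeta> + a / \<zeta>) * co x (u / \<zeta>)
        = chi (c * u) * co x ((u + a) / \<zeta>) * co x (u / \<zeta>)"
      by (simp only: add_divide_distrib)
  qed (simp_all add: zeta_nonzero)
  then show ?thesis by (simp only: corr_def co_\<sigma>)
qed

text \<open>Since \<open>(u + 1)^3 + u^3 = u^2 + u + 1\<close>, the extra phase is
  \<open>chi\<close> of \<open>(\<mu> * u)^2 + \<mu>^2 * u + \<mu>^2\<close>, and the first square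
  may be replaced by \<open>\<mu> * u\<close>. Using \<open>\<mu>^2\<close> as parameter makes
  \<open>c\<close> change by an Artin-Schreier element.\<close>

lemma corr_cubic: "corr 1 c (cubic (\<mu>^2) x) = chi (\<mu>^2) * corr 1 (c + \<mu> + \<mu>^2) x"
proof -
  have "chi (c * u) * co (cubic (\<mu>^2) x) (u + 1) * co (cubic (\<mu>^2) x) u
      = chi (\<mu>^2) * (chi ((c + \<mu> + \<mu>^2) * u) * co x (u + 1) * co x u)" for u
  proof -
    have "\<mu>^2 * (u + 1)^3 = \<mu>^2 * u^3 + ((\<mu> * u)^2 + \<mu>^2 * u + \<mu>^2)"
      by (simp add: cube_add power_mult_distrib algebra_simps)
    then have "chi (\<mu>^2 * (u + 1)^3) * chi (\<mu>^2 * u^3) = chi (\<mu> * u) * chi (\<mu>^2 * u) * chi (\<mu>^2)"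
      by (simp only: chi_add chi_square) (simp add: mult_ac)
    then have "chi (c * u) * (chi (\<mu>^2 * (u + 1)^3) * chi (\<mu>^2 * u^3))
        = chi (c * u) * (chi (\<mu> * u) * chi (\<mu>^2 * u) * chi (\<mu>^2))"
      by (simp only:)
    also have "\<dots> = chi (\<mu>^2) * chi ((c + \<mu> + \<mu>^2) * u)"
      unfolding distrib_right chi_add by (simp only: mult_ac)
    finally have "chi (c * u) * (chi (\<mu>^2 * (u + 1)^3) * chi (\<mu>^2 * u^3))
        = chi (\<mu>^2) * chi ((c + \<mu> + \<mu>^2) * u)" .
    moreover have "chi (c * u) * co (cubic (\<mu>^2) x) (u + 1) * co (cubic (\<mu>^2) x) u
        = chi (c * u) * (chi (\<mu>^2 * (u + 1)^3) * chi (\<mu>^2 * u^3)) * (co x (u + 1) * co x u)"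
      by (simp only: co_ops mult_ac)
    ultimately show ?thesis by (simp only: mult_ac)
  qed
  then show ?thesis unfolding corr_def by (simp only: sum_distrib_left[symmetric] times_divide_eq_right)
qed

lemma corr_hadamard: "corr a 0 (hadamard x) = corr 0 a x"
proof -
  have "(\<Sum>u\<in>UNIV. (\<Sum>s\<in>UNIV. chi ((u + a) * s) * co x s) * (\<Sum>t\<in>UNIV. chi (u * t) * co x t))
      = (\<Sum>u\<in>UNIV. \<Sum>s\<in>UNIV. \<Sum>t\<in>UNIV. chi (a * s) * co x s * co x t * (chi (s * u) * chi (u * t)))"
    by (simp add: sum_product distrib_right chi_add) (simp add: mult_ac)
  also have "\<dots> = (\<Sum>s\<in>UNIV. \<Sum>t\<in>UNIV. chi (a * s) * co x s * co x t * (\<Sum>u\<in>UNIV. chi (s * u) * chi (u * t)))"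
    by (subst sum.swap, rule sum.cong[OF refl], subst sum.swap) (simp add: sum_distrib_left)
  also have "\<dots> = (\<Sum>s\<in>UNIV. \<Sum>t\<in>UNIV. if s = t then chi (a * s) * co x s * co x s * 4 ^ m else 0)"
    by (intro sum.cong refl) (simp add: sum_chi_product)
  also have "\<dots> = 4 ^ m * (\<Sum>s\<in>UNIV. chi (a * s) * co x s * co x s)"
    by (simp add: sum_distrib_left mult_ac)
  moreover have "(4::real) ^ m = 2 ^ m * 2 ^ m" by (simp flip: power_mult_distrib)
  ultimately show ?thesis by (simp add: corr_def flip: sum_divide_distrib)
qed

text \<open>Substituting \<open>u + a\<close> for \<open>u\<close> multiplies the sum by
  \<open>chi (a * c)\<close>; the group element is skew-symmetric in this case.\<close>

lemma corr_eq_0: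
  assumes "chi (a * c) = -1" shows "corr a c x = 0"
proof -
  have "(\<Sum>u\<in>UNIV. chi (c * u) * co x (u + a) * co x u) = (\<Sum>u\<in>UNIV. chi (c * (u + a)) * co x (u + a + a) * co x (u + a))"
    by (rule sum.reindex_bij_witness[where i="\<lambda>u. u + a" and j="\<lambda>u. u + a"]) auto
  also have "\<dots> = - (\<Sum>u\<in>UNIV. chi (c * u) * co x (u + a) * co x u)"
    using assms by (simp add: distrib_left chi_add mult_ac sum_negf)
  finally show ?thesis by (simp add: corr_def)
qed

lemma sum_co_square: "(\<Sum>u\<in>UNIV. co x u * co x u) = 2 ^ m * (norm x)^2"
  by (simp add: inner_co power2_norm_eq_inner)

lemma corr_0: "corr 0 0 x = (norm x)^2"
  by (simp add: corr_def sum_co_square)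

text \<open>With \<open>w = u + d\<close> the double sum becomes a Fourier transform, from
  \<open>d\<close> to \<open>c\<close>, of quartic monomials on the parallelograms \<open>u\<close>,
  \<open>u + a\<close>, \<open>u + d\<close>, \<open>u + a + d\<close>.\<close>

lemma corr_square:
  "(corr a c x)^2 = (\<Sum>u\<in>UNIV. \<Sum>d\<in>UNIV. chi (c * d) * (co x u * co x (u + a) * co x (u + d) * co x (u + a + d))) / 4 ^ m"
proof -
  have square: "(corr a c x)^2 = (\<Sum>u\<in>UNIV. \<Sum>w\<in>UNIV. (chi (c * u) * co x (u + a) * co x u) * (chi (c * w) * co x (w + a) * co x w)) / 4 ^ m"
    by (simp add: corr_def power2_eq_square sum_product flip: power_mult_distrib)
  have "(\<Sum>w\<in>UNIV. (chi (c * u) * co x (u + a) * co x u) * (chi (c * w) * co x (w + a) * co x w))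
      = (\<Sum>d\<in>UNIV. chi (c * d) * (co x u * co x (u + a) * co x (u + d) * co x (u + a + d)))" for u
  proof (rule sum.reindex_bij_witness[where i="\<lambda>d. u + d" and j="\<lambda>w. u + w"])
    fix w
    have "u + (u + w) = w" "u + a + (u + w) = w + a"
      by (simp, metis add.assoc add.commute add_cancel2(1))
    then show "chi (c * (u + w)) * (co x u * co x (u + a) * co x (u + (u + w)) * co x (u + a + (u + w)))
        = (chi (c * u) * co x (u + a) * co x u) * (chi (c * w) * co x (w + a) * co x w)"
      by (simp only: distrib_left chi_add mult_ac)
  qed simp_all
  then show ?thesis unfolding square by (simp only:)
qed

text \<open>Summation over \<open>c\<close> isolates \<open>d = 0\<close>, and the sum over
  \<open>a\<close> then completes the square of the sum of all squared coordinates.\<close>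

lemma sum_corr_square: "(\<Sum>a\<in>UNIV. \<Sum>c\<in>UNIV. (corr a c x)^2) = 4 ^ m * (norm x)^4"
proof -
  have "(\<Sum>c\<in>UNIV. (corr a c x)^2) = (\<Sum>u\<in>UNIV. (co x u * co x u) * (co x (u + a) * co x (u + a)))" for a
  proof -
    have "(\<Sum>c\<in>UNIV. (corr a c x)^2)
        = (\<Sum>u\<in>UNIV. \<Sum>d\<in>UNIV. (\<Sum>c\<in>UNIV. chi (d * c)) * (co x u * co x (u + a) * co x (u + d) * co x (u + a + d))) / 4 ^ m"
      unfolding corr_square sum_divide_distrib[symmetric]
      by (subst sum_rotate) (simp only: sum_distrib_right mult.commute)
    also have "\<dots> = (\<Sum>u\<in>UNIV. \<Sum>d\<in>UNIV. if d = 0 then 4 ^ m * (co x u * co x (u + a) * co x (u + d) * co x (u + a + d)) else 0) / 4 ^ m"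
      by (intro arg_cong2[where f="(/)"] refl sum.cong) (simp add: sum_chi_UNIV)
    also have "\<dots> = (\<Sum>u\<in>UNIV. 4 ^ m * ((co x u * co x u) * (co x (u + a) * co x (u + a)))) / 4 ^ m"
      by (simp add: mult_ac)
    also have "\<dots> = (\<Sum>u\<in>UNIV. (co x u * co x u) * (co x (u + a) * co x (u + a)))"
      by (simp flip: sum_distrib_left)
    finally show ?thesis .
  qed
  then have "(\<Sum>a\<in>UNIV. \<Sum>c\<in>UNIV. (corr a c x)^2)
      = (\<Sum>u\<in>UNIV. \<Sum>a\<in>UNIV. (co x u * co x u) * (co x (u + a) * co x (u + a)))"
    by (simp only:) (rule sum.swap)
  also have "\<dots> = (\<Sum>u\<in>UNIV. \<Sum>w\<in>UNIV. (co x u * co x u) * (co x w * co x w))"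
  proof (rule sum.cong[OF refl])
    fix u
    show "(\<Sum>a\<in>UNIV. (co x u * co x u) * (co x (u + a) * co x (u + a)))
        = (\<Sum>w\<in>UNIV. (co x u * co x u) * (co x w * co x w))"
      by (rule sum.reindex_bij_witness[where i="\<lambda>w. u + w" and j="\<lambda>a. u + a"]) simp_all
  qed
  also have "\<dots> = (2 ^ m * (norm x)^2)^2"
    unfolding sum_product[symmetric] sum_co_square by (rule power2_eq_square[symmetric])
  also have "\<dots> = 4 ^ m * (norm x)^4"
  proof -
    have "(2 ^ m)^2 = (4::real) ^ m" by (simp add: power2_eq_square flip: power_mult_distrib)
    moreover have "((norm x)^2)^2 = (norm x)^4" by (simp flip: power_mult)
    ultimately show ?thesis by (simp only: power_mult_distrib)
  qed
  finally show ?thesis .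
qed

text \<open>The nonzero singular vectors of the quadratic form given by the trace of
  \<open>a * c\<close>.\<close>

definition isotropic :: "('f \<times> 'f) set" where
  "isotropic = {(a, c). (a, c) \<noteq> (0, 0) \<and> chi (a * c) = 1}"

section \<open>The moments of an arbitrary invariant mean\<close>

context
  fixes r :: real and I :: "('e \<Rightarrow> real) \<Rightarrow> real"
  assumes mean: "invariant_mean r symmetries I"
begin

interpretation mean: invariant_mean r symmetries I by (rule mean)

lemma mean_inv_ops:
  assumes "continuous_on UNIV f"
  shows "I (\<lambda>x. f (shift a x)) = I f" "I (\<lambda>x. f (modulate a x)) = I f" "I (\<lambda>x. f (cubic a x)) = I f"
    "I (\<lambda>x. f (hadamard x)) = I f" "I (\<lambda>x. f (\<sigma> x)) = I f" "I (\<lambda>x. f (- x)) = I f"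
  by (rule mean.mean_inv[OF assms]; simp add: symmetries_def)+

definition corr_moment :: "'f \<Rightarrow> 'f \<Rightarrow> real" where "corr_moment a c = I (\<lambda>x. (corr a c x)^2)"

lemma continuous_corr_square: "continuous_on UNIV (\<lambda>x. (corr a c x)^2)"
  by (intro continuous_intros)

lemma corr_moment_\<sigma>: "corr_moment a c = corr_moment (a / \<zeta> ^ k) (c * \<zeta> ^ k)"
proof (induction k)
  case (Suc k)
  have "corr_moment a c = corr_moment (a / \<zeta>) (c * \<zeta>)" for a c
    using mean_inv_ops(5)[OF continuous_corr_square, of a c] by (simp add: corr_moment_def corr_\<sigma>)
  from this[of "a / \<zeta> ^ k" "c * \<zeta> ^ k"] show ?case using Suc by (simp add: mult_ac)
qed simp

lemma corr_moment_isotropic: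
  assumes "(a, c) \<in> isotropic"
  shows "corr_moment a c = corr_moment 1 0"
proof -
  have one: "corr_moment a c = corr_moment 1 0" if a: "a \<noteq> 0" and c: "chi (a * c) = 1" for a c
  proof -
    obtain k where k: "a = \<zeta> ^ k"
      using a primitive unfolding primitive_element_def by (metis DiffI UNIV_I imageE singletonD)
    \<comment> \<open>Powers of \<open>\<sigma>\<close> scale \<open>a\<close> and \<open>c\<close>
      inversely, so \<open>a\<close> can be brought to 1 while the product is kept.\<close>
    have "corr_moment a c = corr_moment 1 (a * c)"
      using corr_moment_\<sigma>[of a c k] by (simp add: k mult.commute zeta_nonzero)
    moreover obtain \<mu> where \<mu>: "a * c = \<mu>^2 + \<mu>" using c by (rule chi_eq_1E)
    moreover have "corr_moment 1 (a * c) = corr_moment 1 (a * c + \<mu> + \<mu>^2)"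
      using mean_inv_ops(3)[OF continuous_corr_square, of 1 "a * c" "\<mu>^2"]
      by (simp only: corr_moment_def corr_cubic power_mult_distrib power2_eq_square[of "chi _"] chi_mult_self mult_1_left)
    moreover have "\<mu>^2 + \<mu> + \<mu> + \<mu>^2 = 0" by (simp add: char_two)
    ultimately show ?thesis by simp
  qed
  show ?thesis
  proof (cases "a = 0")
    \<comment> \<open>The argument above asks for a nonzero first entry; the Fourier transform
      relates \<open>(0, c)\<close> to \<open>(c, 0)\<close>.\<close>
    case True
    then have "c \<noteq> 0" using assms by (simp add: isotropic_def)
    have "corr_moment c 0 = corr_moment 0 c"
      using mean_inv_ops(4)[OF continuous_corr_square, of c 0] by (simp add: corr_moment_def corr_hadamard)
    then show ?thesis using one[OF \<open>c \<noteq> 0\<close>, of 0] True by simp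
  next
    case False
    then show ?thesis using assms by (intro one) (auto simp: isotropic_def)
  qed
qed

lemma corr_moment_0: "corr_moment 0 0 = r^4"
  unfolding corr_moment_def by (rule mean.mean_const) (auto intro!: continuous_intros simp: corr_0)

text \<open>Averaging \<open>sum_corr_square\<close> gives \<open>4 ^ m * r^4\<close> as
  \<open>r^4\<close> plus \<open>card isotropic\<close> times the common value on isotropic pairs.
  The resulting formula no longer involves the mean \<open>I\<close>.\<close>

lemma corr_moment_eq:
  "corr_moment a c = (if (a, c) = (0, 0) then r^4 else if (a, c) \<in> isotropic then (4 ^ m - 1) * r^4 / card isotropic else 0)"
proof -
  have other: "corr_moment a c = 0" if "(a, c) \<noteq> (0, 0)" "(a, c) \<notin> isotropic" for a c
  proof -
    have "chi (a * c) = -1" using that chi_cases[of "a * c"] by (auto simp: isotropic_def)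
    then have "corr a c x = 0" for x by (rule corr_eq_0)
    then show ?thesis by (simp add: corr_moment_def mean.mean_const)
  qed
  have "4 ^ m * r^4 = I (\<lambda>x. \<Sum>a\<in>UNIV. \<Sum>c\<in>UNIV. (corr a c x)^2)"
    by (rule mean.mean_const[symmetric]) (auto intro!: continuous_intros simp: sum_corr_square)
  also have "\<dots> = (\<Sum>a\<in>UNIV. \<Sum>c\<in>UNIV. corr_moment a c)"
    unfolding corr_moment_def by (subst mean.mean_sum; (intro continuous_intros | simp | intro sum.cong refl mean.mean_sum)+)
  also have "\<dots> = (\<Sum>(a, c)\<in>UNIV. corr_moment a c)"
    by (simp add: sum.cartesian_product)
  also have "\<dots> = (\<Sum>(a, c)\<in>insert (0, 0) isotropic. corr_moment a c)"
    by (rule sum.mono_neutral_right) (use other in auto)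
  also have "\<dots> = r^4 + (\<Sum>(a, c)\<in>isotropic. corr_moment a c)"
    by (subst sum.insert) (auto simp: isotropic_def corr_moment_0)
  also have "(\<Sum>(a, c)\<in>isotropic. corr_moment a c) = (\<Sum>p\<in>isotropic. corr_moment 1 0)"
    by (rule sum.cong) (auto simp: corr_moment_isotropic)
  finally have "card isotropic * corr_moment 1 0 = (4 ^ m - 1) * r^4"
    by (simp add: algebra_simps)
  moreover have "(1, 0) \<in> isotropic" by (simp add: isotropic_def)
  then have "card isotropic \<noteq> 0" by (auto simp: card_eq_0_iff)
  ultimately have "corr_moment 1 0 = (4 ^ m - 1) * r^4 / card isotropic"
    by (simp add: field_simps)
  then show ?thesis using other corr_moment_isotropic corr_moment_0 by auto
qed

lemma mean_shifted:
  "I (\<lambda>x. co x s * co x (s + a) * co x (s + d) * co x (s + a + d)) = I (\<lambda>x. co x 0 * co x a * co x d * co x (a + d))"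
proof -
  have "I (\<lambda>x. co (shift s x) 0 * co (shift s x) a * co (shift s x) d * co (shift s x) (a + d))
      = I (\<lambda>x. co x 0 * co x a * co x d * co x (a + d))"
    by (rule mean_inv_ops(1)) (intro continuous_intros)
  moreover have "0 + s = s" "a + s = s + a" "d + s = s + d" "a + d + s = s + a + d"
    by (simp_all add: ac_simps)
  ultimately show ?thesis by (simp only: co_ops)
qed

text \<open>Fourier inversion, in the variable \<open>c\<close>, of the averaged identity
  \<open>corr_square\<close>.\<close>

lemma mean_quartic_parallelogram:
  "I (\<lambda>x. co x 0 * co x a * co x d * co x (a + d)) = (\<Sum>c\<in>UNIV. chi (c * d) * corr_moment a c) / 4 ^ m"
proof -
  define M where "M d = I (\<lambda>x. co x 0 * co x a * co x d * co x (a + d))" for d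
  have cm: "corr_moment a c = (\<Sum>d\<in>UNIV. chi (c * d) * M d)" for c
  proof -
    define P where "P u d x = co x u * co x (u + a) * co x (u + d) * co x (u + a + d)" for u d x
    have P: "continuous_on UNIV (P u d)" for u d unfolding P_def by (intro continuous_intros)
    have "corr_moment a c = I (\<lambda>x. (1 / 4 ^ m) * (\<Sum>u\<in>UNIV. \<Sum>d\<in>UNIV. chi (c * d) * P u d x))"
      by (simp add: corr_moment_def corr_square P_def)
    also have "\<dots> = (1 / 4 ^ m) * I (\<lambda>x. \<Sum>u\<in>UNIV. \<Sum>d\<in>UNIV. chi (c * d) * P u d x)"
      by (rule mean.mean_scale) (intro continuous_intros P)
    also have "I (\<lambda>x. \<Sum>u\<in>UNIV. \<Sum>d\<in>UNIV. chi (c * d) * P u d x)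
        = (\<Sum>u\<in>UNIV. I (\<lambda>x. \<Sum>d\<in>UNIV. chi (c * d) * P u d x))"
      by (rule mean.mean_sum) (auto intro!: continuous_intros P)
    also have "\<dots> = (\<Sum>u\<in>UNIV. \<Sum>d\<in>UNIV. I (\<lambda>x. chi (c * d) * P u d x))"
      by (intro sum.cong refl mean.mean_sum) (auto intro!: continuous_intros P)
    also have "\<dots> = (\<Sum>u\<in>UNIV. \<Sum>d\<in>UNIV. chi (c * d) * I (P u d))"
      by (intro sum.cong refl mean.mean_scale P)
    \<comment> \<open>By translation invariance all \<open>4 ^ m\<close> base points
      \<open>u\<close> contribute equally, which cancels the denominator.\<close>
    also have "\<dots> = (\<Sum>u\<in>(UNIV::'f set). \<Sum>d\<in>UNIV. chi (c * d) * M d)"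
      by (simp only: P_def[abs_def] mean_shifted M_def)
    finally show ?thesis by (simp add: card_field)
  qed
  have "(\<Sum>c\<in>UNIV. chi (c * d) * corr_moment a c) = (\<Sum>c\<in>UNIV. \<Sum>t\<in>UNIV. (chi (d * c) * chi (c * t)) * M t)"
    by (simp add: cm sum_distrib_left mult_ac)
  also have "\<dots> = (\<Sum>t\<in>UNIV. (\<Sum>c\<in>UNIV. chi (d * c) * chi (c * t)) * M t)"
    by (subst sum.swap) (simp add: sum_distrib_right)
  also have "\<dots> = (\<Sum>t\<in>UNIV. if t = d then 4 ^ m * M t else 0)"
    by (intro sum.cong refl) (auto simp: sum_chi_product)
  finally show ?thesis by (simp add: M_def)
qed

text \<open>A modulation negates the monomial unless the indices sum to 0. If they do, they form a
  parallelogram based at \<open>s\<close> with sides \<open>s + t\<close> and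
  \<open>s + u\<close>.\<close>

lemma mean_quartic:
  "I (\<lambda>x. co x s * co x t * co x u * co x w)
    = (if s + t + u + w = 0 then (\<Sum>c\<in>UNIV. chi (c * (s + u)) * corr_moment (s + t) c) / 4 ^ m else 0)"
proof (cases "s + t + u + w = 0")
  case True
  then have "w = s + t + u" by (metis add_eq_iff add_0)
  moreover have "s + (s + t) + (s + u) = s + t + u"
    by (metis add.commute add.left_commute add_cancel2(1))
  ultimately have w: "s + (s + t) + (s + u) = w" by (simp only:)
  have "I (\<lambda>x. co x s * co x t * co x u * co x w)
      = I (\<lambda>x. co x s * co x (s + (s + t)) * co x (s + (s + u)) * co x (s + (s + t) + (s + u)))"
    unfolding w by simp
  then show ?thesis by (subst if_P[OF True]) (simp only: mean_shifted mean_quartic_parallelogram)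
next
  case False
  then obtain c where c: "chi ((s + t + u + w) * c) = -1" by (rule chi_nontrivial)
  have "I (\<lambda>x. co x s * co x t * co x u * co x w)
      = I (\<lambda>x. co (modulate c x) s * co (modulate c x) t * co (modulate c x) u * co (modulate c x) w)"
    by (rule mean_inv_ops(2)[symmetric]) (intro continuous_intros)
  also have "\<dots> = I (\<lambda>x. chi ((s + t + u + w) * c) * (co x s * co x t * co x u * co x w))"
    by (simp add: distrib_right chi_add) (simp add: mult_ac)
  also have "\<dots> = - I (\<lambda>x. co x s * co x t * co x u * co x w)"
    unfolding c by (subst mean.mean_scale) (auto intro!: continuous_intros)
  finally show ?thesis using False by simp
qed

text \<open>Modulations kill the mixed terms. Translations make the \<open>4 ^ m\<close> squares
  equal on average, and these sum to \<open>2 ^ m * r^2\<close>.\<close>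

lemma mean_quadratic: "I (\<lambda>x. co x s * co x t) = (if s = t then r^2 / 2 ^ m else 0)"
proof (cases "s = t")
  case True
  have "I (\<lambda>x. co x u * co x u) = I (\<lambda>x. co x 0 * co x 0)" for u
  proof -
    have "I (\<lambda>x. co (shift u x) 0 * co (shift u x) 0) = I (\<lambda>x. co x 0 * co x 0)"
      by (rule mean_inv_ops(1)) (intro continuous_intros)
    then show ?thesis by simp
  qed
  then have same: "I (\<lambda>x. co x u * co x u) = I (\<lambda>x. co x s * co x s)" for u by metis
  have "(\<Sum>u\<in>(UNIV::'f set). I (\<lambda>x. co x u * co x u)) = 4 ^ m * I (\<lambda>x. co x s * co x s)"
    by (subst sum.cong[OF refl same]) (simp add: card_field)
  moreover have "(\<Sum>u\<in>UNIV. I (\<lambda>x. co x u * co x u)) = I (\<lambda>x. \<Sum>u\<in>UNIV. co x u * co x u)"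
    by (rule mean.mean_sum[symmetric]) (auto intro!: continuous_intros)
  moreover have "\<dots> = 2 ^ m * r^2"
    by (rule mean.mean_const) (auto intro!: continuous_intros simp: sum_co_square)
  moreover have "(4::real) ^ m = 2 ^ m * 2 ^ m" by (simp flip: power_mult_distrib)
  ultimately show ?thesis using True by (simp add: field_simps)
next
  case False
  then have "s + t \<noteq> 0" by (simp add: add_eq_iff)
  then obtain c where c: "chi ((s + t) * c) = -1" by (rule chi_nontrivial)
  have "I (\<lambda>x. co x s * co x t) = I (\<lambda>x. co (modulate c x) s * co (modulate c x) t)"
    by (rule mean_inv_ops(2)[symmetric]) (intro continuous_intros)
  also have "\<dots> = I (\<lambda>x. chi ((s + t) * c) * (co x s * co x t))"
    by (simp add: distrib_right chi_add) (simp add: mult_ac)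
  also have "\<dots> = - I (\<lambda>x. co x s * co x t)"
    unfolding c by (subst mean.mean_scale) (auto intro!: continuous_intros)
  finally show ?thesis using False by simp
qed

lemma mean_odd:
  assumes "continuous_on UNIV f" "\<And>x. f (- x) = - f x"
  shows "I f = 0"
proof -
  have "I f = I (\<lambda>x. (-1) * f x)" using mean_inv_ops(6)[OF assms(1)] assms(2) by simp
  also have "\<dots> = - I f" by (subst mean.mean_scale[OF assms(1)]) simp
  finally show ?thesis by simp
qed

lemma mean_1: "I (\<lambda>x. 1) = 1"
  by (rule mean.mean_const) auto

end

text \<open>In each degree up to four the moments are given by formulas in which the mean does not
  occur, and the vectors \<open>b u\<close> span the space.\<close>

lemma symmetric_means_agree:
  assumes I: "invariant_mean r symmetries I" and J: "invariant_mean r symmetries J"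
    and f: "poly_fun_degree_le 4 f"
  shows "I f = J f"
proof (rule invariant_means_agree[OF I J span_b _ f])
  interpret I: invariant_mean r symmetries I by (rule I)
  interpret J: invariant_mean r symmetries J by (rule J)
  fix us :: "'f list" assume "length us \<le> 4"
  define p where "p x = prod_list (map (co x) us)" for x
  have p: "continuous_on UNIV p"
    unfolding p_def by (induction us) (auto intro!: continuous_intros)
  have scale: "(\<lambda>x. prod_list (map (inner x) (map b us))) = (\<lambda>x. (1 / 2 ^ m) ^ length us * p x)"
    unfolding p_def by (rule ext, induction us) (auto simp: co_def)
  have "length us = 0 \<or> length us = 1 \<or> length us = 2 \<or> length us = 3 \<or> length us = 4"
    using \<open>length us \<le> 4\<close> by linarith
  then consider "us = []" | s where "us = [s]" | s t where "us = [s, t]" | s t u where "us = [s, t, u]"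
    | s t u w where "us = [s, t, u, w]"
    by (auto simp: numeral_eq_Suc length_Suc_conv)
  then have "I p = J p"
  proof cases
    case 1
    then show ?thesis using mean_1[OF I] mean_1[OF J] by (simp add: p_def[abs_def])
  next
    case 2
    then have "p (- x) = - p x" for x by (simp add: p_def)
    then show ?thesis using mean_odd[OF I p] mean_odd[OF J p] by simp
  next
    case (3 s t)
    then have "p = (\<lambda>x. co x s * co x t)" by (simp add: p_def[abs_def])
    then show ?thesis by (simp only: mean_quadratic[OF I] mean_quadratic[OF J])
  next
    case 4
    then have "p (- x) = - p x" for x by (simp add: p_def)
    then show ?thesis using mean_odd[OF I p] mean_odd[OF J p] by simp
  next
    case (5 s t u w)
    then have "p = (\<lambda>x. co x s * co x t * co x u * co x w)" by (simp add: p_def[abs_def] mult.assoc)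
    then show ?thesis
      by (simp only: mean_quartic[OF I] mean_quartic[OF J] corr_moment_eq[OF I] corr_moment_eq[OF J])
  qed
  then show "I (\<lambda>x. prod_list (map (inner x) (map b us))) = J (\<lambda>x. prod_list (map (inner x) (map b us)))"
    unfolding scale by (simp only: I.mean_scale[OF p] J.mean_scale[OF p])
qed

section \<open>Designs from the layers of invariant lattices\<close>

lemma symmetric_lattice_universally_strongly_perfect:
  assumes L: "L \<subseteq> BWd" and sym: "\<And>g x. g \<in> symmetries \<Longrightarrow> x \<in> L \<Longrightarrow> g x \<in> L"
  shows "universally_strongly_perfect L"
  unfolding universally_strongly_perfect_def
proof (intro allI impI)
  fix d assume ne: "layer L d \<noteq> {}"
  define r where "r = sqrt d"
  have fin: "finite (layer L d)"
    by (rule finite_subset[OF _ finite_layer_BWd[of d]]) (use L in \<open>auto simp: layer_def\<close>)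
  have r: "norm x = r" if "x \<in> layer L d" for x
    using that by (simp add: layer_def r_def norm_eq_sqrt_inner)
  have "0 \<le> r" using ne r by (metis ex_in_conv norm_ge_zero)
  then have J: "invariant_mean r symmetries (sphere_mean r)"
    by (intro invariant_mean_sphere symmetries_orthogonal)
  have I: "invariant_mean r symmetries (\<lambda>f. (\<Sum>x\<in>layer L d. f x) / real (card (layer L d)))"
  proof (rule invariant_mean_finite[OF fin ne r])
    fix g assume g: "g \<in> symmetries"
    then have "orthogonal_transformation g" by (rule symmetries_orthogonal)
    then show "inj g \<and> g ` layer L d \<subseteq> layer L d"
      using sym[OF g] by (auto simp: layer_def orthogonal_transformation_def orthogonal_transformation_inj)
  qed
  show "spherical_design 4 (layer L d)"
    unfolding spherical_design_def
    using fin ne r symmetric_means_agree[OF I J] by (intro conjI exI[of _ r]) auto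
qed

text \<open>The extraspecial group acts trivially modulo \<open>twice_dual BW\<close>, the maps
  \<open>cubic\<close> and \<open>hadamard\<close> lie in \<open>U_group\<close>, and
  \<open>\<sigma>\<close> and negation preserve any member of \<open>L_plus\<close>.\<close>

lemma plus_universally_strongly_perfect:
  assumes "\<Gamma> \<in> L_plus BW \<sigma>" "\<forall>g\<in>U_group BW \<eta>. g ` \<Gamma> = \<Gamma>"
  shows "universally_strongly_perfect \<Gamma>"
proof (rule symmetric_lattice_universally_strongly_perfect)
  show "\<Gamma> \<subseteq> BWd" using assms(1) BW_subset_BWd by (auto simp: L_plus_def)
  fix g x assume g: "g \<in> symmetries" and x: "x \<in> \<Gamma>"
  have "- x \<in> \<Gamma>"
    using assms(1) x int_span_scale[of x _ "-1"] by (auto simp: L_plus_def is_lattice_def)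
  moreover have "\<sigma> x \<in> \<Gamma>" using assms(1) x by (auto simp: L_plus_def)
  moreover have "h x \<in> \<Gamma>" if "h \<in> U_group BW \<eta>" for h
    using imageI[OF x, of h] bspec[OF assms(2) that] by simp
  ultimately show "g x \<in> \<Gamma>"
    using g lattice_plus_invariant[OF assms(1) x] cubic_U_group hadamard_U_group
    by (auto simp: symmetries_def)
qed

lemma minus_universally_strongly_perfect:
  assumes "\<Lambda> \<in> L_minus BW \<sigma>" "\<forall>g\<in>U_group BW \<eta>. g ` \<Lambda> = \<Lambda>"
  shows "universally_strongly_perfect \<Lambda>"
proof (rule symmetric_lattice_universally_strongly_perfect)
  show "\<Lambda> \<subseteq> BWd" using assms(1) by (auto simp: L_minus_def BWd_def)
  fix g x assume g: "g \<in> symmetries" and x: "x \<in> \<Lambda>"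
  have "- x \<in> \<Lambda>"
    using assms(1) x int_span_scale[of x _ "-1"] by (auto simp: L_minus_def is_lattice_def)
  moreover have "\<sigma> x \<in> \<Lambda>" using assms(1) x by (auto simp: L_minus_def)
  moreover have "h x \<in> \<Lambda>" if "h \<in> U_group BW \<eta>" for h
    using imageI[OF x, of h] bspec[OF assms(2) that] by simp
  ultimately show "g x \<in> \<Lambda>"
    using g lattice_minus_invariant[OF assms(1) x] cubic_U_group hadamard_U_group
    by (auto simp: symmetries_def)
qed

end

theorem theorem8p3:
  fixes m :: nat
    and \<zeta> :: "'f :: {field, finite}"
    and b :: "'f \<Rightarrow> 'e :: euclidean_space"
    and v :: "nat \<Rightarrow> 'f"
    and \<sigma> \<eta> :: "'e \<Rightarrow> 'e"
    and BW :: "'e set"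
    and Y :: "nat \<Rightarrow> (bit, 'y) module"
    and \<rho> :: "nat \<Rightarrow> (('e \<Rightarrow> 'e) set \<Rightarrow> ('e \<Rightarrow> 'e) set) \<Rightarrow> 'y \<Rightarrow> 'y"
  assumes "1 \<le> m"
    and "CARD('f) = 4 ^ m"
    and "primitive_element \<zeta>"
    and "span (range b) = UNIV"
    and "\<And>u w. inner (b u) (b w) = (if u = w then 1 / 2 ^ m else 0)"
    and "linear \<sigma>" and "\<And>u. \<sigma> (b u) = b (\<zeta> * u)"
    and "\<eta> = \<sigma> ^^ ((4 ^ m - 1) div 3)"
    and "f2_basis (2 * m) v"
    and "BW = barnes_wall m b v"
    and "\<And>k. k \<le> m \<Longrightarrow> is_Y m BW \<eta> k (Y k) (\<rho> k)"
  shows "(\<forall>J \<Gamma>. J \<subseteq> M_plus m \<longrightarrow> is_Gamma BW \<sigma> \<eta> Y \<rho> J \<Gamma> \<longrightarrow> universally_strongly_perfect \<Gamma>) \<and>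
    (\<forall>I \<Lambda>. I \<subseteq> M_minus m \<longrightarrow> is_Lambda BW \<sigma> \<eta> Y \<rho> I \<Lambda> \<longrightarrow> universally_strongly_perfect \<Lambda>)"
proof -
  interpret barnes_wall_setup m \<zeta> b v \<sigma> \<eta> BW
  proof
    show "1 \<le> m" "CARD('f) = 4 ^ m" by (rule assms(1), rule assms(2))
    show "primitive_element \<zeta>" by (rule assms(3))
    show "span (range b) = UNIV" by (rule assms(4))
    show "inner (b u) (b w) = (if u = w then 1 / 2 ^ m else 0)" for u w by (rule assms(5))
    show "\<sigma> (x + y) = \<sigma> x + \<sigma> y" for x y by (rule linear_add[OF assms(6)])
    show "\<sigma> (c *\<^sub>R x) = c *\<^sub>R \<sigma> x" for c x by (rule linear_scale[OF assms(6)])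
    show "\<sigma> (b u) = b (\<zeta> * u)" for u by (rule assms(7))
    show "\<eta> = \<sigma> ^^ ((4 ^ m - 1) div 3)" by (rule assms(8))
    show "f2_basis (2 * m) v" by (rule assms(9))
    show "BW = barnes_wall m b v" by (rule assms(10))
  qed
  show ?thesis
  proof (intro conjI allI impI)
    fix J \<Gamma> assume "is_Gamma BW \<sigma> \<eta> Y \<rho> J \<Gamma>"
    then show "universally_strongly_perfect \<Gamma>"
      unfolding is_Gamma_def by (elim conjE) (rule plus_universally_strongly_perfect)
  next
    fix I \<Lambda> assume "is_Lambda BW \<sigma> \<eta> Y \<rho> I \<Lambda>"
    then show "universally_strongly_perfect \<Lambda>"
      unfolding is_Lambda_def by (elim conjE) (rule minus_universally_strongly_perfect)
  qed
qed

end
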